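(* Let $M^2$ be a 2-dimensional Riemannian manifold of constant curvature $K\neq 0$, and let $TM^2$ be its tangent bundle endowed with the Sasaki metric. Suppose that $\tilde F^2\subset TM^2$ is a 2-dimensional totally geodesic submanifold. Then locally (i.e. in a neighbourhood of each of its points) $\tilde F^2$ is an open piece of one of the following submanifolds: (a) a single fiber $T_qM^2$, $q\in M^2$; (b) a cylinder-type surface based on a geodesic $\gamma$ in $M^2$ with elements generated by a parallel unit vector field along $\gamma$; (c) the base manifold $M^2$ embedded into $TM^2$ by the zero vector field.
   Context: Let $\pi:TM\to M$ be the bundle projection of the tangent bundle of a Riemannian manifold $(M,g)$ with Levi-Civita connection $\nabla$. The Sasaki metric on $TM$ is $\langle\langle \tilde X,\tilde Y\rangle\rangle=\langle \pi_*\tilde X,\pi_*\tilde Y\rangle+\langle \mathcal K\tilde X,\mathcal K\tilde Y\rangle$, where $\langle\cdot,\cdot\rangle=g$ and $\mathcal K:TTM\to TM$ is the connection map; in induced local coordinates $(x^i,\xi^i)$ on $TM$, for $\tilde X=\tilde X^i\frac{\partial}{\partial x^i}+\tilde X^{n+i}\frac{\partial}{\partial \xi^i}$ at the point $(q,\xi)$, one has $\pi_*\tilde X=\tilde X^i\partial_i$ and $\mathcal K\tilde X=(\tilde X^{n+i}+\Gamma^i_{jk}(q)\xi^j\tilde X^k)\partial_i$. A cylinder-type surface based on a geodesic $\gamma(s)$ with elements generated by a parallel unit vector field $e(s)$ along $\gamma$ is the surface $\{(\gamma(s),\,t\,e(s))\}\subset TM$, where $s$ is the arc-length parameter of $\gamma$,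 $t\in\mathbb R$, and $\nabla_{\gamma'}e=0$, $|e|=1$. *)

theory Defs
  imports "HOL-Analysis.Analysis"
begin

section \<open>Smooth maps between open subsets of Euclidean spaces\<close>

fun Ck_on :: "nat \<Rightarrow> 'a::euclidean_space set \<Rightarrow> ('a \<Rightarrow> 'b::real_normed_vector) \<Rightarrow> bool" where
  "Ck_on 0 S f \<longleftrightarrow> continuous_on S f"
| "Ck_on (Suc k) S f \<longleftrightarrow>
     (\<forall>x\<in>S. f differentiable (at x)) \<and>
     (\<forall>u. Ck_on k S (\<lambda>x. frechet_derivative f (at x) u))"

definition smooth_on :: "'a::euclidean_space set \<Rightarrow> ('a \<Rightarrow> 'b::real_normed_vector) \<Rightarrow> bool" where
  "smooth_on S f \<longleftrightarrow> (\<forall>k. Ck_on k S f)"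

section \<open>Smooth manifolds\<close>

text \<open>A manifold modelled on a Euclidean space is given by a (not necessarily maximal) smooth
  atlas. A chart is a pair of its domain and its coordinate map; the values of the coordinate map
  outside the domain are irrelevant. The atlas determines the underlying set and the topology.\<close>

type_synonym ('a, 'e) chart = "'a set \<times> ('a \<Rightarrow> 'e)"

abbreviation chart_dom :: "('a, 'e) chart \<Rightarrow> 'a set" where
  "chart_dom c \<equiv> fst c"

abbreviation chart_map :: "('a, 'e) chart \<Rightarrow> 'a \<Rightarrow> 'e" where
  "chart_map c \<equiv> snd c"

definition chart_inv :: "('a, 'e) chart \<Rightarrow> 'e \<Rightarrow> 'a" where
  "chart_inv c = inv_into (chart_dom c) (chart_map c)"

definition points :: "('a, 'e) chart set \<Rightarrow> 'a set" where
  "points A = (\<Union>c\<in>A. chart_dom c)"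

definition atlas_topology :: "('a, 'e::topological_space) chart set \<Rightarrow> 'a topology" where
  "atlas_topology A =
     topology_generated_by {chart_dom c \<inter> chart_map c -` W | c W. c \<in> A \<and> open W}"

definition smooth_atlas :: "('a, 'e::euclidean_space) chart set \<Rightarrow> bool" where
  "smooth_atlas A \<longleftrightarrow>
     (\<forall>c\<in>A. inj_on (chart_map c) (chart_dom c) \<and> open (chart_map c ` chart_dom c)) \<and>
     (\<forall>c\<in>A. \<forall>d\<in>A.
        open (chart_map c ` (chart_dom c \<inter> chart_dom d)) \<and>
        smooth_on (chart_map c ` (chart_dom c \<inter> chart_dom d)) (chart_map d \<circ> chart_inv c)) \<and>
     Hausdorff_space (atlas_topology A) \<and>
     second_countable (atlas_topology A)"

section \<open>Tangent vectors and the tangent bundle\<close>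

text \<open>A tangent vector at a point is represented by the family of its components in all charts
  of the atlas around that point, related by the Jacobians of the coordinate changes. The family
  is zero at all other charts, so that equality of tangent vectors is equality of functions.\<close>

type_synonym ('a, 'e) tvec = "('a, 'e) chart \<Rightarrow> 'e"

definition tangent_space ::
    "('a, 'e::euclidean_space) chart set \<Rightarrow> 'a \<Rightarrow> ('a, 'e) tvec set" where
  "tangent_space A p =
     {v. (\<forall>c. \<not> (c \<in> A \<and> p \<in> chart_dom c) \<longrightarrow> v c = 0) \<and>
         (\<forall>c\<in>A. \<forall>d\<in>A. p \<in> chart_dom c \<inter> chart_dom d \<longrightarrow>
            v d = frechet_derivative (chart_map d \<circ> chart_inv c) (at (chart_map c p)) (v c))}"

text \<open>The tangent vector at \<open>p\<close> with components \<open>u\<close> in the chart \<open>c\<close>.\<close>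

definition coord_vec ::
    "('a, 'e::euclidean_space) chart set \<Rightarrow> ('a, 'e) chart \<Rightarrow> 'a \<Rightarrow> 'e \<Rightarrow> ('a, 'e) tvec" where
  "coord_vec A c p u =
     (\<lambda>d. if d \<in> A \<and> p \<in> chart_dom d
          then frechet_derivative (chart_map d \<circ> chart_inv c) (at (chart_map c p)) u else 0)"

text \<open>The induced chart \<open>(x, \<xi>)\<close> on the tangent bundle.\<close>

definition tangent_chart ::
    "('a, 'e::euclidean_space) chart set \<Rightarrow> ('a, 'e) chart \<Rightarrow> ('a \<times> ('a, 'e) tvec, 'e \<times> 'e) chart"
  where
  "tangent_chart A c = (Sigma (chart_dom c) (tangent_space A), \<lambda>(p, v). (chart_map c p, v c))"

definition tangent_bundle ::
    "('a, 'e::euclidean_space) chart set \<Rightarrow> ('a \<times> ('a, 'e) tvec, 'e \<times> 'e) chart set" where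
  "tangent_bundle A = tangent_chart A ` A"

section \<open>Riemannian metrics, Levi-Civita connection, curvature\<close>

type_synonym ('a, 'e) metric_tensor = "'a \<Rightarrow> ('a, 'e) tvec \<Rightarrow> ('a, 'e) tvec \<Rightarrow> real"

text \<open>The coordinate expression \<open>g\<^sub>i\<^sub>j(x) u\<^sup>i w\<^sup>j\<close> of the metric in the chart \<open>c\<close>.\<close>

definition metric_in ::
    "('a, 'e::euclidean_space) chart set \<Rightarrow> ('a, 'e) metric_tensor \<Rightarrow> ('a, 'e) chart \<Rightarrow>
     'e \<Rightarrow> 'e \<Rightarrow> 'e \<Rightarrow> real" where
  "metric_in A g c x u w =
     g (chart_inv c x) (coord_vec A c (chart_inv c x) u) (coord_vec A c (chart_inv c x) w)"

definition riemannian_manifold ::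
    "('a, 'e::euclidean_space) chart set \<Rightarrow> ('a, 'e) metric_tensor \<Rightarrow> bool" where
  "riemannian_manifold A g \<longleftrightarrow>
     smooth_atlas A \<and>
     (\<forall>c\<in>A.
        (\<forall>x\<in>chart_map c ` chart_dom c.
           bilinear (metric_in A g c x) \<and>
           (\<forall>u w. metric_in A g c x u w = metric_in A g c x w u) \<and>
           (\<forall>u. u \<noteq> 0 \<longrightarrow> metric_in A g c x u u > 0)) \<and>
        (\<forall>u w. smooth_on (chart_map c ` chart_dom c) (\<lambda>x. metric_in A g c x u w)))"

text \<open>\<open>christoffel A g c x u v\<close> is the vector \<open>\<Gamma>\<^sup>i\<^sub>j\<^sub>k(x) u\<^sup>j v\<^sup>k\<close> of the Levi-Civita connection, characterised
  by the Koszul formula for vector fields with constant components.\<close>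

definition christoffel ::
    "('a, 'e::euclidean_space) chart set \<Rightarrow> ('a, 'e) metric_tensor \<Rightarrow> ('a, 'e) chart \<Rightarrow>
     'e \<Rightarrow> 'e \<Rightarrow> 'e \<Rightarrow> 'e" where
  "christoffel A g c x u v =
     (THE w. \<forall>z. 2 * metric_in A g c x w z =
        frechet_derivative (\<lambda>y. metric_in A g c y v z) (at x) u +
        frechet_derivative (\<lambda>y. metric_in A g c y u z) (at x) v -
        frechet_derivative (\<lambda>y. metric_in A g c y u v) (at x) z)"

text \<open>\<open>R(u,v)w = \<nabla>\<^sub>u\<nabla>\<^sub>v w - \<nabla>\<^sub>v\<nabla>\<^sub>u w - \<nabla>\<^bsub>[u,v]\<^esub> w\<close> in coordinates.\<close>

definition curvature_tensor ::
    "('a, 'e::euclidean_space) chart set \<Rightarrow> ('a, 'e) metric_tensor \<Rightarrow> ('a, 'e) chart \<Rightarrow>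
     'e \<Rightarrow> 'e \<Rightarrow> 'e \<Rightarrow> 'e \<Rightarrow> 'e" where
  "curvature_tensor A g c x u v w =
     frechet_derivative (\<lambda>y. christoffel A g c y v w) (at x) u -
     frechet_derivative (\<lambda>y. christoffel A g c y u w) (at x) v +
     christoffel A g c x u (christoffel A g c x v w) -
     christoffel A g c x v (christoffel A g c x u w)"

definition sectional_curvature ::
    "('a, 'e::euclidean_space) chart set \<Rightarrow> ('a, 'e) metric_tensor \<Rightarrow> ('a, 'e) chart \<Rightarrow>
     'e \<Rightarrow> 'e \<Rightarrow> 'e \<Rightarrow> real" where
  "sectional_curvature A g c x u v =
     metric_in A g c x (curvature_tensor A g c x u v v) u /
     (metric_in A g c x u u * metric_in A g c x v v - (metric_in A g c x u v)\<^sup>2)"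

definition constant_curvature ::
    "('a, 'e::euclidean_space) chart set \<Rightarrow> ('a, 'e) metric_tensor \<Rightarrow> real \<Rightarrow> bool" where
  "constant_curvature A g K \<longleftrightarrow>
     (\<forall>c\<in>A. \<forall>x\<in>chart_map c ` chart_dom c. \<forall>u v.
        u \<noteq> v \<and> independent {u, v} \<longrightarrow> sectional_curvature A g c x u v = K)"

section \<open>The Sasaki metric\<close>

definition proj_star ::
    "('a, 'e::euclidean_space) chart set \<Rightarrow> 'a \<times> ('a, 'e) tvec \<Rightarrow>
     ('a \<times> ('a, 'e) tvec, 'e \<times> 'e) tvec \<Rightarrow> ('a, 'e) tvec" where
  "proj_star A Q X =
     (\<lambda>c. if c \<in> A \<and> fst Q \<in> chart_dom c then fst (X (tangent_chart A c)) else 0)"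

definition connection_map ::
    "('a, 'e::euclidean_space) chart set \<Rightarrow> ('a, 'e) metric_tensor \<Rightarrow> 'a \<times> ('a, 'e) tvec \<Rightarrow>
     ('a \<times> ('a, 'e) tvec, 'e \<times> 'e) tvec \<Rightarrow> ('a, 'e) tvec" where
  "connection_map A g Q X =
     (\<lambda>c. if c \<in> A \<and> fst Q \<in> chart_dom c
          then snd (X (tangent_chart A c)) +
               christoffel A g c (chart_map c (fst Q)) (snd Q c) (fst (X (tangent_chart A c)))
          else 0)"

definition sasaki ::
    "('a, 'e::euclidean_space) chart set \<Rightarrow> ('a, 'e) metric_tensor \<Rightarrow>
     ('a \<times> ('a, 'e) tvec, 'e \<times> 'e) metric_tensor" where
  "sasaki A g Q X Y =
     g (fst Q) (proj_star A Q X) (proj_star A Q Y) +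
     g (fst Q) (connection_map A g Q X) (connection_map A g Q Y)"

section \<open>Submanifolds\<close>

text \<open>\<open>B\<close> is a smooth atlas on a subset of the manifold \<open>A\<close> for which the inclusion is a smooth
  immersion; openness of the coordinate image of \<open>chart_dom b \<inter> chart_dom c\<close> is continuity of the
  inclusion. Embedded submanifolds are those for which, in addition, the topology of \<open>B\<close> is the
  subspace topology.\<close>

definition submanifold ::
    "('a, 'e::euclidean_space) chart set \<Rightarrow> ('a, 'f::euclidean_space) chart set \<Rightarrow> bool" where
  "submanifold A B \<longleftrightarrow>
     smooth_atlas B \<and> points B \<subseteq> points A \<and>
     (\<forall>b\<in>B. \<forall>c\<in>A.
        open (chart_map b ` (chart_dom b \<inter> chart_dom c)) \<and>
        smooth_on (chart_map b ` (chart_dom b \<inter> chart_dom c)) (chart_map c \<circ> chart_inv b) \<and>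
        (\<forall>y\<in>chart_map b ` (chart_dom b \<inter> chart_dom c).
           inj (frechet_derivative (chart_map c \<circ> chart_inv b) (at y))))"

text \<open>With \<open>r\<close> the local parametrisation of the submanifold in the chart \<open>c\<close>, the vector \<open>w\<close> below is
  the ambient covariant derivative \<open>\<nabla>\<^sub>v (r\<^sub>* u)\<close> of the coordinate field \<open>r\<^sub>* u\<close>; the second fundamental
  form is its component normal to the submanifold.\<close>

definition second_fundamental_form ::
    "('a, 'e::euclidean_space) chart set \<Rightarrow> ('a, 'e) metric_tensor \<Rightarrow>
     ('a, 'f::euclidean_space) chart \<Rightarrow> ('a, 'e) chart \<Rightarrow> 'f \<Rightarrow> 'f \<Rightarrow> 'f \<Rightarrow> 'e" where
  "second_fundamental_form A g b c y u v =
     (let r = chart_map c \<circ> chart_inv b;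
          D = (\<lambda>y. frechet_derivative r (at y));
          w = frechet_derivative (\<lambda>y'. D y' u) (at y) v + christoffel A g c (r y) (D y v) (D y u)
      in THE n. w - n \<in> range (D y) \<and> (\<forall>z. metric_in A g c (r y) n (D y z) = 0))"

definition totally_geodesic ::
    "('a, 'e::euclidean_space) chart set \<Rightarrow> ('a, 'e) metric_tensor \<Rightarrow>
     ('a, 'f::euclidean_space) chart set \<Rightarrow> bool" where
  "totally_geodesic A g B \<longleftrightarrow>
     (\<forall>b\<in>B. \<forall>c\<in>A. \<forall>y\<in>chart_map b ` (chart_dom b \<inter> chart_dom c). \<forall>u v.
        second_fundamental_form A g b c y u v = 0)"

section \<open>Geodesics and parallel vector fields along curves\<close>

definition smooth_curve ::
    "('a, 'e::euclidean_space) chart set \<Rightarrow> real set \<Rightarrow> (real \<Rightarrow> 'a) \<Rightarrow> bool" where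
  "smooth_curve A I \<gamma> \<longleftrightarrow>
     \<gamma> ` I \<subseteq> points A \<and>
     (\<forall>c\<in>A. open (I \<inter> \<gamma> -` chart_dom c) \<and> smooth_on (I \<inter> \<gamma> -` chart_dom c) (chart_map c \<circ> \<gamma>))"

definition velocity ::
    "('a, 'e::euclidean_space) chart set \<Rightarrow> (real \<Rightarrow> 'a) \<Rightarrow> real \<Rightarrow> ('a, 'e) tvec" where
  "velocity A \<gamma> s =
     (\<lambda>c. if c \<in> A \<and> \<gamma> s \<in> chart_dom c then vector_derivative (chart_map c \<circ> \<gamma>) (at s) else 0)"

definition smooth_field_along ::
    "('a, 'e::euclidean_space) chart set \<Rightarrow> real set \<Rightarrow> (real \<Rightarrow> 'a) \<Rightarrow> (real \<Rightarrow> ('a, 'e) tvec) \<Rightarrow> bool"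
  where
  "smooth_field_along A I \<gamma> e \<longleftrightarrow>
     (\<forall>s\<in>I. e s \<in> tangent_space A (\<gamma> s)) \<and>
     (\<forall>c\<in>A. smooth_on (I \<inter> \<gamma> -` chart_dom c) (\<lambda>s. e s c))"

definition covariant_derivative ::
    "('a, 'e::euclidean_space) chart set \<Rightarrow> ('a, 'e) metric_tensor \<Rightarrow> (real \<Rightarrow> 'a) \<Rightarrow>
     (real \<Rightarrow> ('a, 'e) tvec) \<Rightarrow> real \<Rightarrow> ('a, 'e) tvec" where
  "covariant_derivative A g \<gamma> e s =
     (\<lambda>c. if c \<in> A \<and> \<gamma> s \<in> chart_dom c
          then vector_derivative (\<lambda>t. e t c) (at s) +
               christoffel A g c (chart_map c (\<gamma> s)) (velocity A \<gamma> s c) (e s c)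
          else 0)"

definition unit_speed_geodesic ::
    "('a, 'e::euclidean_space) chart set \<Rightarrow> ('a, 'e) metric_tensor \<Rightarrow> real set \<Rightarrow> (real \<Rightarrow> 'a) \<Rightarrow> bool"
  where
  "unit_speed_geodesic A g I \<gamma> \<longleftrightarrow>
     smooth_curve A I \<gamma> \<and>
     (\<forall>s\<in>I. covariant_derivative A g \<gamma> (velocity A \<gamma>) s = (\<lambda>c. 0)) \<and>
     (\<forall>s\<in>I. g (\<gamma> s) (velocity A \<gamma> s) (velocity A \<gamma> s) = 1)"

definition parallel_unit_field ::
    "('a, 'e::euclidean_space) chart set \<Rightarrow> ('a, 'e) metric_tensor \<Rightarrow> real set \<Rightarrow> (real \<Rightarrow> 'a) \<Rightarrow>
     (real \<Rightarrow> ('a, 'e) tvec) \<Rightarrow> bool" where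
  "parallel_unit_field A g I \<gamma> e \<longleftrightarrow>
     smooth_field_along A I \<gamma> e \<and>
     (\<forall>s\<in>I. covariant_derivative A g \<gamma> e s = (\<lambda>c. 0)) \<and>
     (\<forall>s\<in>I. g (\<gamma> s) (e s) (e s) = 1)"

section \<open>The model submanifolds of the tangent bundle\<close>

definition fiber ::
    "('a, 'e::euclidean_space) chart set \<Rightarrow> 'a \<Rightarrow> ('a \<times> ('a, 'e) tvec) set" where
  "fiber A q = {q} \<times> tangent_space A q"

definition zero_section ::
    "('a, 'e::euclidean_space) chart set \<Rightarrow> ('a \<times> ('a, 'e) tvec) set" where
  "zero_section A = points A \<times> {\<lambda>c. 0}"

definition cylinder ::
    "real set \<Rightarrow> (real \<Rightarrow> 'a) \<Rightarrow> (real \<Rightarrow> ('a, 'e::euclidean_space) tvec) \<Rightarrow> ('a \<times> ('a, 'e) tvec) set"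
  where
  "cylinder I \<gamma> e = {(\<gamma> s, \<lambda>c. t *\<^sub>R e s c) | s t. s \<in> I}"

definition open_piece :: "('a, 'e::euclidean_space) chart set \<Rightarrow> 'a set \<Rightarrow> 'a set \<Rightarrow> bool" where
  "open_piece A V S \<longleftrightarrow> openin (subtopology (atlas_topology A) S) V"

end

theory Submission
  imports Defs
begin

text \<open>Along a surface in the tangent bundle let \<open>a u\<close> and \<open>b u\<close> be the horizontal and the vertical part of
the image of a tangent vector \<open>u\<close>, and let \<open>\<xi>\<close> be the position in the fibre. With the Levi-Civita
connection of the Sasaki metric (\<open>sas_chr\<close>) total geodesy becomes a pair of equations for the
covariant derivatives of \<open>a\<close> and \<open>b\<close>. The base has dimension two and constant curvature, so in an
orthonormal frame, with vectors as complex numbers and \<open>\<omega>(p,q) = Im (cnj p * q)\<close>, they read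

  \<open>(\<nabla>\<^sub>v a) u = (K/2) (\<beta>(u) \<i> a v + \<beta>(v) \<i> a u)\<close>,  \<open>(\<nabla>\<^sub>v b) u = - (K/2) \<omega>(a v, a u) \<i> \<xi>\<close>,
  \<open>\<nabla>\<^sub>v \<xi> = b v\<close>,

where \<open>\<beta>(u) = \<omega>(\<xi>, b u)\<close> (\<open>tg_immersion_system\<close>). In an orthonormal frame of the surface the scalars
\<open>\<rho> = |\<xi>|\<^sup>2\<close>, \<open>\<alpha> = \<omega>(a f1, a f2)\<close>, \<open>\<delta> = \<omega>(b f1, b f2)\<close>, the components \<open>\<theta>1\<close>, \<open>\<theta>2\<close> of half the gradient of
\<open>\<rho>\<close>, the components of \<open>\<beta>\<close> and those of the form \<open>\<langle>a u, a v\<rangle>\<close> satisfy a closed first order system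
(\<open>scalar_derivs\<close>). It says that the Hessian of \<open>\<rho>/2\<close> is \<open>\<langle>b u, b v\<rangle>\<close>, and that \<open>\<beta>\<close> is dual to a Killing
field; the rotated field \<open>n\<close> with components \<open>\<beta>2\<close>, \<open>- \<beta>1\<close> satisfies \<open>\<nabla>n = \<sigma> id\<close> for
\<open>\<sigma> = \<delta> - K \<alpha> \<rho> / 2\<close>.

Suppose \<open>\<alpha> \<noteq> 0\<close> at a point. The second derivatives of \<open>\<theta>1\<^sup>2 + \<theta>2\<^sup>2\<close> commute only if \<open>\<beta>\<close> annihilates the
gradient of \<open>\<rho>\<close>; one derivative later \<open>|\<beta>|\<^sup>4 = \<rho>\<^sup>2 \<sigma> \<delta>\<close>, and the derivative of this identity along \<open>n\<close>
says, if \<open>\<beta> \<noteq> 0\<close>, that \<open>3 (K \<alpha> \<rho> / 2)\<^sup>2 = - (K\<^sup>2 / 4) \<rho> |a n|\<^sup>2\<close>, which is impossible. So \<open>\<beta>\<close> vanishes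
near the point, hence \<open>\<sigma>\<close> does, and this forces \<open>\<xi> = 0\<close>: the surface lies in the zero section, and
\<open>\<alpha>\<^sup>2 = 1\<close>. Since \<open>\<alpha>\<^sup>2\<close> is therefore \<open>0\<close> or \<open>1\<close>, a zero of \<open>\<alpha>\<close> has a neighbourhood on which \<open>\<alpha> = 0\<close>.
There \<open>\<delta>\<close> annihilates the form \<open>\<langle>a u, a v\<rangle>\<close> and \<open>\<delta>\<^sup>2\<close> is \<open>0\<close> or \<open>1\<close>. Near a point with \<open>\<delta> \<noteq> 0\<close> we get
\<open>a = 0\<close>, so the surface stays in one fibre. Otherwise \<open>a\<close> and \<open>b\<close> have rank one and \<open>\<beta> = 0\<close>
(\<open>tg_system_classification\<close>). In particular the type of a point is locally constant.

In the last case the images of \<open>a\<close> and \<open>b\<close> are spanned by parallel unit fields \<open>T\<close> and \<open>N\<close>, and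
\<open>\<xi> = \<tau> N\<close>. The forms \<open>ds\<close> and \<open>d\<tau>\<close> with \<open>a = ds T\<close> and \<open>b = d\<tau> N\<close> are closed (\<open>cylinder_fields\<close>), so
\<open>s\<close> and \<open>\<tau>\<close> are local coordinates. The base point depends only on \<open>s\<close> and moves along a geodesic with
velocity \<open>T\<close>, and \<open>N\<close> is parallel along it: the surface is a cylinder (\<open>local_cylinder\<close>).

All this happens in one chart of the base and the induced chart of the tangent bundle. That the
Sasaki metric has the expected form there (\<open>sasaki_in_chart\<close>), and that the curves found in one chart
are geodesics with respect to all charts, rests on the transformation law of the Christoffel symbols
(\<open>christoffel_change\<close>).\<close>

section \<open>Calculus of smooth maps\<close>

lemma has_derivative_frechet:
  "f differentiable (at x) \<Longrightarrow> (f has_derivative frechet_derivative f (at x)) (at x)"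
  using frechet_derivative_works by blast

lemma frechet_derivative_cong_open:
  assumes "open S" "x \<in> S" "\<And>y. y \<in> S \<Longrightarrow> f y = g y"
  shows "frechet_derivative f (at x) = frechet_derivative g (at x)"
proof -
  have "(f has_derivative D) (at x) \<longleftrightarrow> (g has_derivative D) (at x)" for D
    using has_derivative_transform_within_open[OF _ assms(1,2), of f D UNIV g]
      has_derivative_transform_within_open[OF _ assms(1,2), of g D UNIV f] assms(3) by auto
  then show ?thesis unfolding frechet_derivative_def by simp
qed

lemma Ck_on_cong_open:
  assumes "open S" "\<And>x. x \<in> S \<Longrightarrow> f x = g x" "Ck_on k S f"
  shows "Ck_on k S g"
  using assms(2,3)
proof (induction k arbitrary: f g)
  case 0
  then show ?case using continuous_on_cong[of S S f g] by simp
next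
  case (Suc k)
  have "g differentiable (at x)" if "x \<in> S" for x
  proof -
    have "f differentiable (at x)" using Suc.prems(2) that by simp
    then show ?thesis
      using has_derivative_transform_within_open[OF _ assms(1) that, of f _ UNIV g] Suc.prems(1)
      unfolding differentiable_def by blast
  qed
  moreover have "Ck_on k S (\<lambda>x. frechet_derivative g (at x) u)" for u
  proof (rule Suc.IH)
    show "Ck_on k S (\<lambda>x. frechet_derivative f (at x) u)" using Suc.prems(2) by simp
    show "frechet_derivative f (at x) u = frechet_derivative g (at x) u" if "x \<in> S" for x
      using frechet_derivative_cong_open[OF assms(1) that Suc.prems(1)] by simp
  qed
  ultimately show ?case by simp
qed

lemma Ck_on_SucI:
  assumes "open S" "\<And>x. x \<in> S \<Longrightarrow> (f has_derivative f' x) (at x)"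
    and "\<And>u. Ck_on k S (\<lambda>x. f' x u)"
  shows "Ck_on (Suc k) S f"
proof -
  have "Ck_on k S (\<lambda>x. frechet_derivative f (at x) u)" for u
    by (rule Ck_on_cong_open[OF assms(1) _ assms(3)[of u]])
      (metis assms(2) frechet_derivative_at)
  moreover have "\<forall>x\<in>S. f differentiable (at x)"
    using assms(2) unfolding differentiable_def by blast
  ultimately show ?thesis by simp
qed

lemma Ck_on_SucD:
  assumes "Ck_on (Suc k) S f"
  shows "Ck_on k S f"
  using assms
proof (induction k arbitrary: f)
  case 0
  then show ?case
    by (auto intro!: continuous_at_imp_continuous_on differentiable_imp_continuous_within)
next
  case (Suc k)
  then show ?case by simp
qed

lemma Ck_on_subset: "Ck_on k S f \<Longrightarrow> T \<subseteq> S \<Longrightarrow> Ck_on k T f"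
  by (induction k arbitrary: f) (auto intro: continuous_on_subset)

lemma Ck_on_const: "Ck_on k S (\<lambda>x. c)"
  by (induction k arbitrary: c) (auto)

lemma Ck_on_linear:
  assumes "open S" "bounded_linear f"
  shows "Ck_on k S f"
proof (cases k)
  case 0
  then show ?thesis using assms by (simp add: linear_continuous_on)
next
  case (Suc k)
  show ?thesis unfolding Suc
    by (rule Ck_on_SucI[OF assms(1), where f'="\<lambda>x. f"])
      (auto intro: Ck_on_const bounded_linear_imp_has_derivative assms)
qed

lemma Ck_on_add:
  assumes "open S" "Ck_on k S f" "Ck_on k S g"
  shows "Ck_on k S (\<lambda>x. f x + g x)"
  using assms(2,3)
proof (induction k arbitrary: f g)
  case 0
  then show ?case by (auto intro: continuous_intros)
next
  case (Suc k)
  show ?case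
    by (rule Ck_on_SucI[OF assms(1), where
          f'="\<lambda>x u. frechet_derivative f (at x) u + frechet_derivative g (at x) u"])
      (use Suc in \<open>auto intro!: has_derivative_add has_derivative_frechet\<close>)
qed

lemma (in bounded_bilinear) Ck_on_prod:
  assumes "open S" "Ck_on k S f" "Ck_on k S g"
  shows "Ck_on k S (\<lambda>x. prod (f x) (g x))"
  using assms(2,3)
proof (induction k arbitrary: f g)
  case 0
  then show ?case by (auto intro: continuous_on)
next
  case (Suc k)
  show ?case
    by (rule Ck_on_SucI[OF assms(1), where
          f'="\<lambda>x u. prod (f x) (frechet_derivative g (at x) u) +
              prod (frechet_derivative f (at x) u) (g x)"])
      (use Suc.prems in \<open>auto intro!: FDERIV has_derivative_frechet Ck_on_add Suc.IH assms(1)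
         intro: Ck_on_SucD\<close>)
qed

lemma Ck_on_sum:
  assumes "open S" "\<And>i. i \<in> I \<Longrightarrow> Ck_on k S (f i)"
  shows "Ck_on k S (\<lambda>x. \<Sum>i\<in>I. f i x)"
  using assms(2)
  by (induction I rule: infinite_finite_induct) (auto intro!: Ck_on_const Ck_on_add assms(1))

lemma linear_expand:
  fixes f :: "'a::euclidean_space \<Rightarrow> 'b::real_vector"
  assumes "linear f"
  shows "f v = (\<Sum>i\<in>Basis. (v \<bullet> i) *\<^sub>R f i)"
proof -
  have "f v = f (\<Sum>i\<in>Basis. (v \<bullet> i) *\<^sub>R i)" by (simp add: euclidean_representation)
  then show ?thesis by (simp add: linear_sum[OF assms] linear_cmul[OF assms])
qed

text \<open>At \<open>x\<close> the outer map is differentiated in a direction that depends on \<open>x\<close>. Expanding this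
  direction in the basis leaves products to which the induction hypothesis applies.\<close>

lemma Ck_on_compose:
  fixes f :: "'a::euclidean_space \<Rightarrow> 'b::euclidean_space" and g :: "'b \<Rightarrow> 'c::real_normed_vector"
  assumes "open S" "open T" "Ck_on k S f" "Ck_on k T g" "f ` S \<subseteq> T"
  shows "Ck_on k S (\<lambda>x. g (f x))"
  using assms(3,4)
proof (induction k arbitrary: g)
  case 0
  then show ?case using assms(5) continuous_on_compose2 by auto
next
  case (Suc k)
  have f: "Ck_on k S f" by (rule Ck_on_SucD) fact
  have eq: "frechet_derivative g (at (f x)) v =
      (\<Sum>i\<in>Basis. (v \<bullet> i) *\<^sub>R frechet_derivative g (at (f x)) i)" if "x \<in> S" for x v
  proof -
    have "linear (frechet_derivative g (at (f x)))"
      using Suc.prems(2) assms(5) that by (intro linear_frechet_derivative) auto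
    then show ?thesis by (rule linear_expand)
  qed
  show ?case
  proof (rule Ck_on_SucI[OF assms(1), where
        f'="\<lambda>x u. \<Sum>i\<in>Basis. (frechet_derivative f (at x) u \<bullet> i) *\<^sub>R frechet_derivative g (at (f x)) i"])
    fix x assume x: "x \<in> S"
    have "(f has_derivative frechet_derivative f (at x)) (at x)"
      using Suc.prems(1) x by (auto intro: has_derivative_frechet)
    moreover have "(g has_derivative frechet_derivative g (at (f x))) (at (f x))"
      using Suc.prems(2) x assms(5) by (auto intro: has_derivative_frechet)
    ultimately have "((\<lambda>x. g (f x)) has_derivative
        (\<lambda>u. frechet_derivative g (at (f x)) (frechet_derivative f (at x) u))) (at x)"
      by (rule has_derivative_compose)
    then show "((\<lambda>x. g (f x)) has_derivative
      (\<lambda>u. \<Sum>i\<in>Basis. (frechet_derivative f (at x) u \<bullet> i) *\<^sub>R frechet_derivative g (at (f x)) i)) (at x)"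
      by (simp only: eq[OF x, symmetric])
  next
    fix u
    show "Ck_on k S (\<lambda>x. \<Sum>i\<in>Basis. (frechet_derivative f (at x) u \<bullet> i) *\<^sub>R frechet_derivative g (at (f
        x)) i)"
      using Suc.prems f
      by (intro Ck_on_sum assms(1) bounded_bilinear.Ck_on_prod[OF bounded_bilinear_scaleR]
          bounded_bilinear.Ck_on_prod[OF bounded_bilinear_inner] Suc.IH Ck_on_const) auto
  qed
qed

lemma smooth_on_cong:
  assumes "open S" "\<And>x. x \<in> S \<Longrightarrow> f x = g x" "smooth_on S f"
  shows "smooth_on S g"
  using Ck_on_cong_open[OF assms(1,2)] assms(3) unfolding smooth_on_def by simp

lemma smooth_on_subset: "smooth_on S f \<Longrightarrow> T \<subseteq> S \<Longrightarrow> smooth_on T f"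
  by (auto simp: smooth_on_def intro: Ck_on_subset)

lemma smooth_on_const: "smooth_on S (\<lambda>x. c)"
  by (simp add: smooth_on_def Ck_on_const)

lemma smooth_on_linear: "open S \<Longrightarrow> bounded_linear f \<Longrightarrow> smooth_on S f"
  by (simp add: smooth_on_def Ck_on_linear)

lemma smooth_on_id: "open S \<Longrightarrow> smooth_on S (\<lambda>x. x)"
  by (rule smooth_on_linear) auto

lemma smooth_on_add:
  "open S \<Longrightarrow> smooth_on S f \<Longrightarrow> smooth_on S g \<Longrightarrow> smooth_on S (\<lambda>x. f x + g x)"
  by (simp add: smooth_on_def Ck_on_add)

lemma smooth_on_scaleR:
  "open S \<Longrightarrow> smooth_on S f \<Longrightarrow> smooth_on S g \<Longrightarrow> smooth_on S (\<lambda>x. f x *\<^sub>R g x)"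
  by (simp add: smooth_on_def bounded_bilinear.Ck_on_prod[OF bounded_bilinear_scaleR])

lemma smooth_on_mult:
  fixes f g :: "'a::euclidean_space \<Rightarrow> 'b::real_normed_algebra"
  shows "open S \<Longrightarrow> smooth_on S f \<Longrightarrow> smooth_on S g \<Longrightarrow> smooth_on S (\<lambda>x. f x * g x)"
  by (simp add: smooth_on_def bounded_bilinear.Ck_on_prod[OF bounded_bilinear_mult])

lemma smooth_on_minus:
  assumes "open S" "smooth_on S f"
  shows "smooth_on S (\<lambda>x. - f x)"
proof -
  have "smooth_on S (\<lambda>x. (- 1 :: real) *\<^sub>R f x)"
    by (intro smooth_on_scaleR assms smooth_on_const)
  then show ?thesis by simp
qed

lemma smooth_on_diff:
  assumes "open S" "smooth_on S f" "smooth_on S g"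
  shows "smooth_on S (\<lambda>x. f x - g x)"
proof -
  have "smooth_on S (\<lambda>x. f x + - g x)"
    by (intro smooth_on_add smooth_on_minus assms)
  then show ?thesis by simp
qed

lemma smooth_on_power:
  fixes f :: "'a::euclidean_space \<Rightarrow> 'b::real_normed_algebra_1"
  shows "open S \<Longrightarrow> smooth_on S f \<Longrightarrow> smooth_on S (\<lambda>x. f x ^ n)"
  by (induction n) (auto intro: smooth_on_const smooth_on_mult)

lemma smooth_on_sum:
  "open S \<Longrightarrow> (\<And>i. i \<in> I \<Longrightarrow> smooth_on S (f i)) \<Longrightarrow> smooth_on S (\<lambda>x. \<Sum>i\<in>I. f i x)"
  by (simp add: smooth_on_def Ck_on_sum)

lemma smooth_on_compose:
  fixes f :: "'a::euclidean_space \<Rightarrow> 'b::euclidean_space" and g :: "'b \<Rightarrow> 'c::real_normed_vector"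
  shows "open S \<Longrightarrow> open T \<Longrightarrow> smooth_on S f \<Longrightarrow> smooth_on T g \<Longrightarrow> f ` S \<subseteq> T \<Longrightarrow> smooth_on S (\<lambda>x. g (f x))"
  by (simp add: smooth_on_def Ck_on_compose[of S T])

lemma smooth_on_bounded_linear:
  fixes f :: "'a::euclidean_space \<Rightarrow> 'b::euclidean_space"
  shows "open S \<Longrightarrow> bounded_linear g \<Longrightarrow> smooth_on S f \<Longrightarrow> smooth_on S (\<lambda>x. g (f x))"
  by (rule smooth_on_compose[OF _ open_UNIV]) (auto intro: smooth_on_linear)

lemma smooth_on_Pair:
  fixes f :: "'a::euclidean_space \<Rightarrow> 'b::euclidean_space" and g :: "'a \<Rightarrow> 'c::euclidean_space"
  assumes "open S" "smooth_on S f" "smooth_on S g"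
  shows "smooth_on S (\<lambda>x. (f x, g x))"
proof -
  have "smooth_on S (\<lambda>x. (f x, 0) + (0, g x))"
    by (intro smooth_on_add assms smooth_on_bounded_linear[where g="\<lambda>u. (u, 0)"]
        smooth_on_bounded_linear[where g="\<lambda>u. (0, u)"] bounded_linear_Pair bounded_linear_zero
            bounded_linear_ident)
  then show ?thesis by simp
qed

lemma smooth_on_fst:
  fixes f :: "'a::euclidean_space \<Rightarrow> 'b::euclidean_space \<times> 'c::euclidean_space"
  shows "open S \<Longrightarrow> smooth_on S f \<Longrightarrow> smooth_on S (\<lambda>x. fst (f x))"
  by (rule smooth_on_bounded_linear[OF _ bounded_linear_fst])

lemma smooth_on_snd:
  fixes f :: "'a::euclidean_space \<Rightarrow> 'b::euclidean_space \<times> 'c::euclidean_space"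
  shows "open S \<Longrightarrow> smooth_on S f \<Longrightarrow> smooth_on S (\<lambda>x. snd (f x))"
  by (rule smooth_on_bounded_linear[OF _ bounded_linear_snd])

text \<open>The factor and the exponent change under differentiation, so the induction is over all of
  them.\<close>

lemma Ck_on_powr: "Ck_on k {0<..} (\<lambda>x::real. c * x powr p)"
proof (induction k arbitrary: c p)
  case 0
  then show ?case by (auto intro!: continuous_intros)
next
  case (Suc k)
  show ?case
  proof (rule Ck_on_SucI[where f'="\<lambda>x u. (u * c * p) * x powr (p - 1)"])
    fix x :: real assume "x \<in> {0<..}"
    then have "((\<lambda>x. c * x powr p) has_real_derivative c * (p * x powr (p - 1))) (at x)"
      by (intro DERIV_cmult has_real_derivative_powr) auto
    then show "((\<lambda>x. c * x powr p) has_derivative (\<lambda>u. (u * c * p) * x powr (p - 1))) (at x)"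
      unfolding has_field_derivative_def
      by (rule has_derivative_eq_rhs) (simp add: fun_eq_iff mult_ac)
  qed (use Suc in auto)
qed

lemma smooth_on_powr:
  assumes "open S" "smooth_on S f" "\<And>x. x \<in> S \<Longrightarrow> f x > 0"
  shows "smooth_on S (\<lambda>x. (f x::real) powr p)"
  by (rule smooth_on_compose[of S "{0<..}" f "\<lambda>x. x powr p"])
    (use assms Ck_on_powr[of _ 1] in \<open>auto simp: smooth_on_def\<close>)

lemma smooth_on_inverse_sqrt:
  assumes "open S" "smooth_on S f" "\<And>x. x \<in> S \<Longrightarrow> f x > 0"
  shows "smooth_on S (\<lambda>x. inverse (sqrt (f x)))"
  by (rule smooth_on_cong[OF assms(1) _ smooth_on_powr[where p="-1/2", OF assms(1,2)]])
    (use assms(3) in \<open>auto simp: powr_minus powr_half_sqrt less_imp_le\<close>)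

lemmas smooth_intros = smooth_on_const smooth_on_id smooth_on_add smooth_on_diff smooth_on_minus
  smooth_on_mult smooth_on_scaleR smooth_on_power smooth_on_Pair

lemma smooth_on_differentiable: "smooth_on S f \<Longrightarrow> x \<in> S \<Longrightarrow> f differentiable (at x)"
  unfolding smooth_on_def by (metis Ck_on.simps(2))

lemma smooth_on_has_derivative:
  "smooth_on S f \<Longrightarrow> x \<in> S \<Longrightarrow> (f has_derivative frechet_derivative f (at x)) (at x)"
  by (intro has_derivative_frechet smooth_on_differentiable)

lemma smooth_on_frechet: "smooth_on S f \<Longrightarrow> smooth_on S (\<lambda>x. frechet_derivative f (at x) u)"
  unfolding smooth_on_def by (metis Ck_on.simps(2))

lemma smooth_on_continuous: "smooth_on S f \<Longrightarrow> continuous_on S f"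
  unfolding smooth_on_def by (metis Ck_on.simps(1))

text \<open>The regularity argument for first order systems: each order of differentiability of a
  solution passes through the right-hand side to its derivative.\<close>

lemma smooth_onI_derivative:
  assumes "open S" "\<And>x. x \<in> S \<Longrightarrow> (f has_derivative f' x) (at x)"
    and "\<And>k u. Ck_on k S f \<Longrightarrow> Ck_on k S (\<lambda>x. f' x u)"
  shows "smooth_on S f"
proof -
  have "Ck_on k S f" for k
  proof (induction k)
    case 0
    then show ?case using assms(2)
      by (auto intro!: continuous_at_imp_continuous_on has_derivative_continuous)
  next
    case (Suc k)
    then show ?case using assms Ck_on_SucI by blast
  qed
  then show ?thesis by (simp add: smooth_on_def)
qed

lemma linear_frechet_smooth: "smooth_on S f \<Longrightarrow> x \<in> S \<Longrightarrow> linear (frechet_derivative f (at x))"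
  by (intro linear_frechet_derivative smooth_on_differentiable)

section \<open>Smooth families of linear maps\<close>

lemma smooth_on_linear_family:
  fixes B :: "'a::euclidean_space \<Rightarrow> 'b::euclidean_space \<Rightarrow> 'c::real_normed_vector"
  assumes "open S" "\<And>x. x \<in> S \<Longrightarrow> linear (B x)" "\<And>u. smooth_on S (\<lambda>x. B x u)" "smooth_on S p"
  shows "smooth_on S (\<lambda>x. B x (p x))"
proof (rule smooth_on_cong[OF assms(1)])
  show "(\<Sum>i\<in>Basis. (p x \<bullet> i) *\<^sub>R B x i) = B x (p x)" if "x \<in> S" for x
    by (rule linear_expand[OF assms(2)[OF that], symmetric])
  show "smooth_on S (\<lambda>x. \<Sum>i\<in>Basis. (p x \<bullet> i) *\<^sub>R B x i)"
    using assms
    by (intro smooth_on_sum smooth_on_scaleR smooth_on_bounded_linear[OF _ bounded_linear_inner_left])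
        auto
qed

lemma smooth_on_bilinear_family:
  fixes B :: "'a::euclidean_space \<Rightarrow> 'b::euclidean_space \<Rightarrow> 'd::euclidean_space \<Rightarrow> 'c::real_normed_vector"
  assumes "open S" "\<And>x. x \<in> S \<Longrightarrow> bilinear (B x)" "\<And>u w. smooth_on S (\<lambda>x. B x u w)"
    "smooth_on S p" "smooth_on S q"
  shows "smooth_on S (\<lambda>x. B x (p x) (q x))"
proof (rule smooth_on_linear_family[where B="\<lambda>x. B x (p x)"])
  show "smooth_on S (\<lambda>x. B x (p x) u)" for u
    by (rule smooth_on_linear_family[where B="\<lambda>x v. B x v u"])
      (use assms in \<open>auto simp: bilinear_def\<close>)
qed (use assms in \<open>auto simp: bilinear_def\<close>)

text \<open>Derivatives are unique, so linear relations between members of the family pass to them.\<close>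

lemma linear_family_derivative_linear:
  assumes "open S" "x \<in> S" "\<And>y. y \<in> S \<Longrightarrow> linear (B y)"
    "\<And>u. ((\<lambda>y. B y u) has_derivative (\<lambda>v. B' v u)) (at x)"
  shows "linear (\<lambda>u. B' v u)"
proof -
  have "B' v (u + w) = B' v u + B' v w" for u w
  proof -
    have "((\<lambda>y. B y (u + w)) has_derivative (\<lambda>v. B' v u + B' v w)) (at x)"
      by (rule has_derivative_transform_within_open[OF has_derivative_add[OF assms(4)[of u] assms(4)[of
          w]] assms(1,2)])
        (simp add: linear_add assms(3))
    from has_derivative_unique[OF this assms(4)] show ?thesis by metis
  qed
  moreover have "B' v (c *\<^sub>R u) = c *\<^sub>R B' v u" for c u
  proof -
    have "((\<lambda>y. B y (c *\<^sub>R u)) has_derivative (\<lambda>v. c *\<^sub>R B' v u)) (at x)"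
      by (rule has_derivative_transform_within_open[OF has_derivative_scaleR_right[OF assms(4)[of u]]
          assms(1,2)])
        (simp add: linear_cmul assms(3))
    from has_derivative_unique[OF this assms(4)] show ?thesis by metis
  qed
  ultimately show ?thesis by (rule linearI)
qed

lemma has_derivative_linear_family:
  fixes B :: "'a::real_normed_vector \<Rightarrow> 'b::euclidean_space \<Rightarrow> 'c::real_normed_vector"
  assumes "open S" "x \<in> S" "\<And>y. y \<in> S \<Longrightarrow> linear (B y)"
    "\<And>u. ((\<lambda>y. B y u) has_derivative (\<lambda>v. B' v u)) (at x)"
    "(p has_derivative p') (at x)"
  shows "((\<lambda>y. B y (p y)) has_derivative (\<lambda>v. B' v (p x) + B x (p' v))) (at x)"
proof -
  have "((\<lambda>y. \<Sum>i\<in>Basis. (p y \<bullet> i) *\<^sub>R B y i) has_derivative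
     (\<lambda>v. \<Sum>i\<in>Basis. (p x \<bullet> i) *\<^sub>R B' v i + (p' v \<bullet> i) *\<^sub>R B x i)) (at x)"
    by (intro has_derivative_sum has_derivative_scaleR has_derivative_inner_left assms)
  moreover have "(\<Sum>i\<in>Basis. (p x \<bullet> i) *\<^sub>R B' v i + (p' v \<bullet> i) *\<^sub>R B x i) = B' v (p x) + B x (p' v)"
      for v
    by (simp add: sum.distrib linear_expand[OF assms(3)[OF assms(2)], of "p' v", symmetric]
       linear_expand[OF linear_family_derivative_linear[of S x B B' v, OF assms(1-4)], of "p x",
           symmetric])
  ultimately have "((\<lambda>y. \<Sum>i\<in>Basis. (p y \<bullet> i) *\<^sub>R B y i) has_derivative
      (\<lambda>v. B' v (p x) + B x (p' v))) (at x)"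
    by simp
  then show ?thesis
    by (rule has_derivative_transform_within_open[OF _ assms(1,2)])
      (simp add: linear_expand[OF assms(3), symmetric])
qed

lemma has_derivative_bilinear_family:
  fixes B :: "'a::real_normed_vector \<Rightarrow> 'b::euclidean_space \<Rightarrow> 'd::euclidean_space \<Rightarrow>
      'c::real_normed_vector"
  assumes "open S" "x \<in> S" "\<And>y. y \<in> S \<Longrightarrow> bilinear (B y)"
    "\<And>u w. ((\<lambda>y. B y u w) has_derivative (\<lambda>v. B' v u w)) (at x)"
    "(p has_derivative p') (at x)" "(q has_derivative q') (at x)"
  shows "((\<lambda>y. B y (p y) (q y)) has_derivative
     (\<lambda>v. B' v (p x) (q x) + B x (p' v) (q x) + B x (p x) (q' v))) (at x)"
proof (rule has_derivative_linear_family[where B="\<lambda>y. B y (p y)"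
      and B'="\<lambda>v u. B' v (p x) u + B x (p' v) u"])
  show "((\<lambda>y. B y (p y) u) has_derivative (\<lambda>v. B' v (p x) u + B x (p' v) u)) (at x)" for u
    by (rule has_derivative_linear_family[where B="\<lambda>y v. B y v u" and B'="\<lambda>v w. B' v w u"])
      (use assms in \<open>auto simp: bilinear_def\<close>)
qed (use assms in \<open>auto simp: bilinear_def\<close>)

section \<open>Symmetry of second derivatives\<close>

text \<open>The mean value theorem in direction \<open>u\<close> turns the second difference into a first difference
  of \<open>f' y u\<close>. The second difference is symmetric in \<open>u\<close> and \<open>v\<close>, so its limit is too.\<close>

lemma second_difference_tendsto:
  fixes f :: "'a::euclidean_space \<Rightarrow> real"
  assumes "open S" "x \<in> S" "\<And>y. y \<in> S \<Longrightarrow> (f has_derivative f' y) (at y)"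
    "((\<lambda>y. f' y u) has_derivative L) (at x)"
  shows "((\<lambda>t. (f (x + t *\<^sub>R u + t *\<^sub>R v) - f (x + t *\<^sub>R u) - f (x + t *\<^sub>R v) +
      f x) / t\<^sup>2) \<longlongrightarrow> L v) (at_right 0)"
proof (rule tendstoI)
  fix e :: real assume e: "e > 0"
  interpret L: bounded_linear L using assms(4) by (rule has_derivative_bounded_linear)
  define M where "M = 2 * norm u + norm v + 1"
  have M: "M > 0" unfolding M_def by (simp add: add_nonneg_pos)
  obtain d where d: "d > 0" "\<And>y. norm (y - x) < d \<Longrightarrow>
      norm (f' y u - f' x u - L (y - x)) \<le> e / (2 * M) * norm (y - x)"
    using assms(4) e M unfolding has_derivative_at_alt
    by (metis divide_pos_pos mult_pos_pos zero_less_numeral)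
  obtain r where r: "r > 0" "ball x r \<subseteq> S" using assms(1,2) open_contains_ball by blast
  define d' where "d' = min d r / M"
  have d': "d' > 0" unfolding d'_def using d r M by simp
  have main: "dist ((f (x + t *\<^sub>R u + t *\<^sub>R v) - f (x + t *\<^sub>R u) - f (x + t *\<^sub>R v) +
      f x) / t\<^sup>2) (L v) < e"
    if t: "0 < t" "t < d'" for t
  proof -
    have tM: "t * M < min d r" using t M unfolding d'_def by (simp add: field_simps)
    have nrm: "norm (s *\<^sub>R u + t *\<^sub>R v) \<le> t * (norm u + norm v)" "norm (s *\<^sub>R u) \<le> t * norm u"
      if "0 \<le> s" "s \<le> t" for s
    proof -
      show *: "norm (s *\<^sub>R u) \<le> t * norm u" using that by (simp add: mult_right_mono)
      show "norm (s *\<^sub>R u + t *\<^sub>R v) \<le> t * (norm u + norm v)"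
        using norm_triangle_ineq[of "s *\<^sub>R u" "t *\<^sub>R v"] * t by (simp add: distrib_left)
    qed
    have "0 \<le> t * norm u" "0 \<le> t * norm v" using t by simp_all
    then have le: "t * (norm u + norm v) < min d r" "t * norm u < min d r"
      using t tM unfolding M_def distrib_left by linarith+
    have inS: "x + s *\<^sub>R u + t *\<^sub>R v \<in> S" "x + s *\<^sub>R u \<in> S" if "0 \<le> s" "s \<le> t" for s
      using nrm[OF that] le r(2) by (auto simp: dist_norm subset_iff norm_minus_commute add.assoc)
    define \<phi> where "\<phi> s = f (x + s *\<^sub>R u + t *\<^sub>R v) - f (x + s *\<^sub>R u)" for s
    have der: "(\<phi> has_derivative (\<lambda>h. f' (x + s *\<^sub>R u + t *\<^sub>R v) (h *\<^sub>R u) - f' (x +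
        s *\<^sub>R u) (h *\<^sub>R u))) (at s)"
      if "0 \<le> s" "s \<le> t" for s
      unfolding \<phi>_def
      by (intro has_derivative_diff has_derivative_compose[OF _ assms(3)] inS that)
         (auto intro!: derivative_eq_intros)
    have "\<exists>s\<in>{0<..<t}. \<phi> t - \<phi> 0 =
        f' (x + s *\<^sub>R u + t *\<^sub>R v) ((t - 0) *\<^sub>R u) - f' (x + s *\<^sub>R u) ((t - 0) *\<^sub>R u)"
      by (rule mvt_simple[OF t(1), of \<phi> "\<lambda>s h. f' (x + s *\<^sub>R u + t *\<^sub>R v) (h *\<^sub>R u) - f' (x +
          s *\<^sub>R u) (h *\<^sub>R u)"])
        (rule has_derivative_at_withinI, rule der, auto)
    then obtain s where s: "0 < s" "s < t" "\<phi> t - \<phi> 0 =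
        f' (x + s *\<^sub>R u + t *\<^sub>R v) ((t - 0) *\<^sub>R u) - f' (x + s *\<^sub>R u) ((t - 0) *\<^sub>R u)"
      by auto
    have s': "0 \<le> s" "s \<le> t" using s by auto
    define p where "p = f' (x + s *\<^sub>R u + t *\<^sub>R v) u"
    define q where "q = f' (x + s *\<^sub>R u) u"
    have "\<phi> t - \<phi> 0 = t * (p - q)"
      unfolding s(3) p_def q_def
      using assms(3)[OF inS(1)[OF s'], THEN has_derivative_linear] assms(3)[OF inS(2)[OF s'], THEN
          has_derivative_linear]
      by (simp add: linear_cmul right_diff_distrib)
    then have Delta: "f (x + t *\<^sub>R u + t *\<^sub>R v) - f (x + t *\<^sub>R u) - f (x + t *\<^sub>R v) + f x = t * (p - q)"
      unfolding \<phi>_def by simp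
    have eM: "0 \<le> e / (2*M)" using e M by simp
    have 1: "\<bar>p - f' x u - L (s *\<^sub>R u + t *\<^sub>R v)\<bar> \<le> e / (2*M) * (t * (norm u + norm v))"
    proof (rule order_trans)
      show "\<bar>p - f' x u - L (s *\<^sub>R u + t *\<^sub>R v)\<bar> \<le> e / (2*M) * norm (s *\<^sub>R u + t *\<^sub>R v)"
        using d(2)[of "x + (s *\<^sub>R u + t *\<^sub>R v)"] nrm(1)[OF s'] le unfolding p_def
            by (simp add: add.assoc)
    qed (rule mult_left_mono[OF nrm(1)[OF s'] eM])
    have 2: "\<bar>q - f' x u - L (s *\<^sub>R u)\<bar> \<le> e / (2*M) * (t * norm u)"
    proof (rule order_trans)
      show "\<bar>q - f' x u - L (s *\<^sub>R u)\<bar> \<le> e / (2*M) * norm (s *\<^sub>R u)"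
        using d(2)[of "x + s *\<^sub>R u"] nrm(2)[OF s'] le unfolding q_def by simp
    qed (rule mult_left_mono[OF nrm(2)[OF s'] eM])
    have "\<bar>(p - q) - t * L v\<bar> \<le> e / (2*M) * (t * (norm u + norm v)) + e / (2*M) * (t * norm u)"
      using 1 2 by (simp add: L.add L.scaleR)
    also have "\<dots> = e / (2*M) * (t * (norm u + norm v) + t * norm u)"
      by (rule distrib_left[symmetric])
    also have "\<dots> = e / (2*M) * (t * (M - 1))"
    proof -
      have "t * (norm u + norm v) + t * norm u = t * (M - 1)"
        unfolding M_def by (simp add: algebra_simps)
      then show ?thesis by (simp only:)
    qed
    also have "\<dots> < e * t"
    proof -
      have "t * (M - 1) < 2 * M * t" using M t by (simp add: algebra_simps add_strict_increasing)
      then have "e / (2*M) * (t * (M - 1)) < e / (2*M) * (2 * M * t)"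
        using e M by (intro mult_strict_left_mono) auto
      then show ?thesis using M by simp
    qed
    finally have "\<bar>(p - q) / t - L v\<bar> < e"
      using t by (simp add: field_simps abs_if split: if_splits)
    then show ?thesis unfolding Delta dist_real_def using t by (simp add: power2_eq_square)
  qed
  show "\<forall>\<^sub>F t in at_right 0. dist ((f (x + t *\<^sub>R u + t *\<^sub>R v) - f (x + t *\<^sub>R u) - f (x + t *\<^sub>R v) +
      f x) / t\<^sup>2) (L v) < e"
    unfolding eventually_at_right_field using d' main by auto
qed

lemma symmetric_second_derivative:
  fixes f :: "'a::euclidean_space \<Rightarrow> 'b::euclidean_space"
  assumes "open S" "smooth_on S f" "x \<in> S"
  shows "frechet_derivative (\<lambda>y. frechet_derivative f (at y) u) (at x) v =
         frechet_derivative (\<lambda>y. frechet_derivative f (at y) v) (at x) u"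
proof (rule euclidean_eqI)
  fix i :: 'b assume "i \<in> Basis"
  let ?f = "\<lambda>y. f y \<bullet> i"
  have 1: "(?f has_derivative (\<lambda>h. frechet_derivative f (at y) h \<bullet> i)) (at y)" if "y \<in> S" for y
    by (rule has_derivative_inner_left, rule smooth_on_has_derivative[OF assms(2) that])
  have 2: "((\<lambda>y. frechet_derivative f (at y) w \<bullet> i) has_derivative
     (\<lambda>h. frechet_derivative (\<lambda>y. frechet_derivative f (at y) w) (at x) h \<bullet> i)) (at x)" for w
    by (rule has_derivative_inner_left, rule smooth_on_has_derivative[OF smooth_on_frechet[OF assms(2)]
        assms(3)])
  have "((\<lambda>t. (?f (x + t *\<^sub>R v + t *\<^sub>R u) - ?f (x + t *\<^sub>R v) - ?f (x + t *\<^sub>R u) + ?f x) / t\<^sup>2) \<longlongrightarrow>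
     frechet_derivative (\<lambda>y. frechet_derivative f (at y) v) (at x) u \<bullet> i) (at_right 0)"
    by (rule second_difference_tendsto[OF assms(1,3) 1 2])
  moreover have "?f (x + t *\<^sub>R v + t *\<^sub>R u) - ?f (x + t *\<^sub>R v) - ?f (x + t *\<^sub>R u) + ?f x =
      ?f (x + t *\<^sub>R u + t *\<^sub>R v) - ?f (x + t *\<^sub>R u) - ?f (x + t *\<^sub>R v) + ?f x" for t
    by (simp add: add_ac)
  ultimately have "((\<lambda>t. (?f (x + t *\<^sub>R u + t *\<^sub>R v) - ?f (x + t *\<^sub>R u) - ?f (x + t *\<^sub>R v) +
      ?f x) / t\<^sup>2) \<longlongrightarrow>
     frechet_derivative (\<lambda>y. frechet_derivative f (at y) v) (at x) u \<bullet> i) (at_right 0)"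
    by simp
  with second_difference_tendsto[OF assms(1,3) 1 2[of u], of v]
  show "frechet_derivative (\<lambda>y. frechet_derivative f (at y) u) (at x) v \<bullet> i =
        frechet_derivative (\<lambda>y. frechet_derivative f (at y) v) (at x) u \<bullet> i"
    using tendsto_unique[of "at_right (0::real)"] by fastforce
qed

section \<open>Primitives of closed one-forms\<close>

text \<open>The primitive is the integral along the segments from a base point. By closedness,
  differentiating under the integral sign gives the integral of the derivative of \<open>t * \<eta> (p y t)
  v\<close> in \<open>t\<close>.\<close>

lemma closed_form_primitive:
  fixes \<eta> :: "'a::euclidean_space \<Rightarrow> 'a \<Rightarrow> real"
  assumes U: "open U" "convex U" and lin: "\<And>y. y \<in> U \<Longrightarrow> linear (\<eta> y)"
    and sm: "\<And>u. smooth_on U (\<lambda>y. \<eta> y u)"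
    and closed: "\<And>y u v. y \<in> U \<Longrightarrow> frechet_derivative (\<lambda>y. \<eta> y u) (at y) v =
        frechet_derivative (\<lambda>y. \<eta> y v) (at y) u"
  shows "\<exists>s. \<forall>y\<in>U. (s has_derivative \<eta> y) (at y)"
proof (cases "U = {}")
  case False
  then obtain y0 where y0: "y0 \<in> U" by blast
  define D where "D y v u = frechet_derivative (\<lambda>y. \<eta> y u) (at y) v" for y v u
  have dD: "((\<lambda>y. \<eta> y u) has_derivative (\<lambda>v. D y v u)) (at y)" if "y \<in> U" for y u
    unfolding D_def using smooth_on_has_derivative[OF sm that] by simp
  have Dl1: "linear (\<lambda>v. D y v u)" if "y \<in> U" for y u using has_derivative_linear[OF dD[OF that]] .
  have Dl2: "linear (\<lambda>u. D y v u)" if "y \<in> U" for y v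
    by (rule linear_family_derivative_linear[of U y \<eta>, OF U(1) that lin dD[OF that]])
  define p where "p y t = y0 + t *\<^sub>R (y - y0)" for y and t :: real
  have pU: "p y t \<in> U" if "y \<in> U" "t \<in> {0..1}" for y t
  proof -
    have "p y t = (1 - t) *\<^sub>R y0 + t *\<^sub>R y" unfolding p_def by (simp add: algebra_simps)
    then show ?thesis using convexD[OF U(2) y0 that(1), of "1 - t" t] that(2) by simp
  qed
  define f where "f y t = \<eta> (p y t) (y - y0)" for y t
  define L where "L y t v = t * D (p y t) v (y - y0) + \<eta> (p y t) v" for y t v
  have Ll: "linear (L y t)" if "y \<in> U" "t \<in> {0..1}" for y t
    unfolding L_def
    by (rule linearI) (simp_all add: linear_add[OF Dl1[OF pU[OF that]]] linear_add[OF lin[OF pU[OF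
        that]]]
       linear_cmul[OF Dl1[OF pU[OF that]]] linear_cmul[OF lin[OF pU[OF that]]] algebra_simps)
  have Lb: "blinfun_apply (Blinfun (L y t)) = L y t" if "y \<in> U" "t \<in> {0..1}" for y t
    using Ll[OF that] by (intro bounded_linear_Blinfun_apply) (simp add: linear_conv_bounded_linear)
  have cp: "continuous_on (U \<times> {0..1}) (\<lambda>z. p (fst z) (snd z))"
    unfolding p_def by (intro continuous_intros)
  have cpU: "(\<lambda>z. p (fst z) (snd z)) ` (U \<times> {0..1}) \<subseteq> U" using pU by auto
  have c\<eta>: "continuous_on (U \<times> {0..1}) (\<lambda>z. \<eta> (p (fst z) (snd z)) u)" for u
    by (rule continuous_on_compose2[OF smooth_on_continuous[OF sm] cp cpU])
  have cD: "continuous_on (U \<times> {0..1}) (\<lambda>z. D (p (fst z) (snd z)) v u)" for u v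
    unfolding D_def by (rule continuous_on_compose2[OF smooth_on_continuous[OF smooth_on_frechet[OF sm]]
        cp cpU])
  have cL: "continuous_on (U \<times> {0..1}) (\<lambda>z. L (fst z) (snd z) v)" for v
  proof -
    have "continuous_on (U \<times> {0..1}) (\<lambda>z. snd z * (\<Sum>i\<in>Basis. ((fst z -
        y0) \<bullet> i) *\<^sub>R D (p (fst z) (snd z)) v i) + \<eta> (p (fst z) (snd z)) v)"
      by (intro continuous_intros c\<eta> cD)
    then show ?thesis
    proof (rule continuous_on_eq)
      fix z assume "z \<in> U \<times> {0..1 :: real}"
      then have pz: "p (fst z) (snd z) \<in> U" using pU[of "fst z" "snd z"] by (simp add: mem_Times_iff)
      show "snd z * (\<Sum>i\<in>Basis. ((fst z - y0) \<bullet> i) *\<^sub>R D (p (fst z) (snd z)) v i) +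
          \<eta> (p (fst z) (snd z)) v = L (fst z) (snd z) v"
        unfolding L_def by (subst linear_expand[OF Dl2[OF pz], of v "fst z -
            y0", symmetric]) (rule refl)
    qed
  qed
  have fint: "f y integrable_on cbox 0 1" if y: "y \<in> U" for y
  proof (rule integrable_continuous)
    have "continuous_on {0..1} (\<lambda>t. p y t)" unfolding p_def by (intro continuous_intros)
    then have "continuous_on {0..1} (\<lambda>t. \<eta> (p y t) (y - y0))"
      by (rule continuous_on_compose2[OF smooth_on_continuous[OF sm]]) (use pU[OF y] in auto)
    then show "continuous_on (cbox 0 1) (f y)" unfolding f_def by simp
  qed
  have der: "((\<lambda>y. integral (cbox 0 1) (f y)) has_derivative \<eta> y) (at y)" if y: "y \<in> U" for y
  proof -
    have "((\<lambda>y. integral (cbox 0 1) (f y)) has_derivative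
        blinfun_apply (integral (cbox 0 1) (\<lambda>t. Blinfun (L y t)))) (at y within U)"
    proof (rule leibniz_rule[OF _ fint _ y U(2)])
      fix z and t :: real assume z: "z \<in> U" and t: "t \<in> cbox 0 1"
      have t': "t \<in> {0..1}" using t by simp
      have "((\<lambda>y. \<eta> (p y t) (y - y0)) has_derivative
          (\<lambda>v. D (p z t) (t *\<^sub>R v) (z - y0) + \<eta> (p z t) v)) (at z)"
      proof (rule has_derivative_linear_family[where B="\<lambda>y. \<eta> (p y t)" and B'="\<lambda>v u. D (p z t) (t *\<^sub>R v)
          u", OF U(1) z])
        show "linear (\<eta> (p y t))" if "y \<in> U" for y by (rule lin[OF pU[OF that t']])
        show "((\<lambda>y. \<eta> (p y t) u) has_derivative (\<lambda>v. D (p z t) (t *\<^sub>R v) u)) (at z)" for u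
          by (rule has_derivative_compose[where f="\<lambda>y. p y t" and x=z, OF _ dD[OF pU[OF z t']]])
             (auto simp: p_def intro!: derivative_eq_intros)
      qed (auto intro!: derivative_eq_intros)
      then have "((\<lambda>y. f y t) has_derivative L z t) (at z)"
        unfolding f_def L_def by (simp add: linear_cmul[OF Dl1[OF pU[OF z t']]])
      then show "((\<lambda>y. f y t) has_derivative blinfun_apply (Blinfun (L z t))) (at z within U)"
        unfolding Lb[OF z t'] by (rule has_derivative_at_withinI)
    next
      have "continuous_on (U \<times> {0..1}) (\<lambda>z. Blinfun (L (fst z) (snd z)))"
      proof (rule continuous_on_blinfun_componentwise)
        fix i :: 'a
        show "continuous_on (U \<times> {0..1}) (\<lambda>z. blinfun_apply (Blinfun (L (fst z) (snd z))) i)"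
          by (rule continuous_on_eq[OF cL[of i]]) (auto simp: Lb)
      qed
      then show "continuous_on (U \<times> cbox 0 1) (\<lambda>(y, t). Blinfun (L y t))" by (simp add: split_beta')
    qed
    then have d: "((\<lambda>y. integral (cbox 0 1) (f y)) has_derivative
        blinfun_apply (integral (cbox 0 1) (\<lambda>t. Blinfun (L y t)))) (at y)"
      using at_within_open[OF y U(1)] by simp
    have "blinfun_apply (integral (cbox 0 1) (\<lambda>t. Blinfun (L y t))) v = \<eta> y v" for v
    proof -
      have cB: "continuous_on {0..1} (\<lambda>t. Blinfun (L y t))"
      proof (rule continuous_on_blinfun_componentwise)
        fix i :: 'a
        have "continuous_on {0..1} (\<lambda>t. L y t i)"
        proof -
          have "continuous_on {0..1} (\<lambda>t. (y, t :: real))" by (intro continuous_intros)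
          from continuous_on_compose2[OF cL[of i] this] y show ?thesis by auto
        qed
        then show "continuous_on {0..1} (\<lambda>t. blinfun_apply (Blinfun (L y t)) i)"
          by (rule continuous_on_eq) (simp add: Lb y)
      qed
      have "blinfun_apply (integral (cbox 0 1) (\<lambda>t. Blinfun (L y t))) v =
          integral (cbox 0 1) (\<lambda>t. blinfun_apply (Blinfun (L y t)) v)"
        using cB by (intro blinfun_apply_integral integrable_continuous) simp
      also have "\<dots> = integral {0..1} (\<lambda>t. L y t v)"
        by (rule trans[OF integral_cong[where g="\<lambda>t. L y t v"]]) (auto simp: Lb y)
      also have "\<dots> = 1 * \<eta> (p y 1) v - 0 * \<eta> (p y 0) v"
      proof (rule integral_unique, rule fundamental_theorem_of_calculus)
        fix t :: real assume t: "t \<in> {0..1}"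
        have "((\<lambda>t. \<eta> (p y t) v) has_derivative (\<lambda>h. D (p y t) (h *\<^sub>R (y - y0)) v)) (at t)"
          by (rule has_derivative_compose[where f="\<lambda>t. p y t" and x=t, OF _ dD[OF pU[OF y t]]])
             (auto simp: p_def intro!: derivative_eq_intros)
        then have "((\<lambda>t. \<eta> (p y t) v) has_vector_derivative D (p y t) (y - y0) v) (at t)"
          unfolding has_vector_derivative_def by (simp add: linear_cmul[OF Dl1[OF pU[OF y t]]])
        also have "D (p y t) (y - y0) v = D (p y t) v (y - y0)"
          unfolding D_def by (rule closed[OF pU[OF y t]])
        finally have "((\<lambda>t. t * \<eta> (p y t) v) has_vector_derivative t * D (p y t) v (y - y0) + 1 *
            \<eta> (p y t) v) (at t)"
          by (intro has_vector_derivative_mult has_vector_derivative_id)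
        then show "((\<lambda>t. t * \<eta> (p y t) v) has_vector_derivative L y t v) (at t within {0..1})"
          unfolding L_def by (simp add: has_vector_derivative_at_within)
      qed simp
      also have "\<dots> = \<eta> y v" by (simp add: p_def)
      finally show ?thesis .
    qed
    then have "blinfun_apply (integral (cbox 0 1) (\<lambda>t. Blinfun (L y t))) = \<eta> y" by blast
    with d show ?thesis by simp
  qed
  then show ?thesis by blast
qed simp

section \<open>Positive definite forms and orthonormal frames\<close>

definition pd_form :: "('v::euclidean_space \<Rightarrow> 'v \<Rightarrow> real) \<Rightarrow> bool" where
  "pd_form B \<longleftrightarrow> bilinear B \<and> (\<forall>u w. B u w = B w u) \<and> (\<forall>u. u \<noteq> 0 \<longrightarrow> B u u > 0)"

lemma pd_formD:
  assumes "pd_form B"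
  shows "bilinear B" "B u w = B w u" "u \<noteq> 0 \<Longrightarrow> B u u > 0" "linear (B u)" "linear (\<lambda>u. B u w)"
    "B (u + v) w = B u w + B v w" "B w (u + v) = B w u + B w v"
    "B (u - v) w = B u w - B v w" "B w (u - v) = B w u - B w v"
    "B (- u) w = - B u w" "B w (- u) = - B w u"
    "B (c *\<^sub>R u) w = c * B u w" "B w (c *\<^sub>R u) = c * B w u"
    "B 0 w = 0" "B w 0 = 0"
  using assms unfolding pd_form_def
  by (auto simp: bilinear_ladd bilinear_radd bilinear_lsub bilinear_rsub bilinear_lneg bilinear_rneg
      bilinear_lmul bilinear_rmul bilinear_lzero bilinear_rzero bilinear_def)

lemmas pd_form_simps = pd_formD(6-15)

lemma pd_form_eqI:
  assumes "pd_form B" "\<And>z. B u z = B w z"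
  shows "u = w"
proof (rule ccontr)
  assume "u \<noteq> w"
  then have "B (u - w) (u - w) > 0" using pd_formD(3)[OF assms(1)] by simp
  then show False using assms(2)[of "u - w"] by (simp add: pd_formD(8)[OF assms(1)])
qed

text \<open>The values of \<open>B w\<close> on the basis depend linearly and, by definiteness, injectively on \<open>w\<close>;
  an injective endomorphism is surjective.\<close>

lemma pd_form_riesz:
  assumes B: "pd_form B" and l: "linear l"
  shows "\<exists>!w. \<forall>z. B w z = l z"
proof -
  define T where "T w = (\<Sum>i\<in>Basis. B w i *\<^sub>R i)" for w
  have Ti: "T w \<bullet> i = B w i" if "i \<in> Basis" for w i
    unfolding T_def using that by simp
  have "linear T"
    unfolding T_def
    by (rule linearI) (simp_all add: pd_form_simps[OF B] sum.distrib scaleR_left_distrib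
        scaleR_sum_right)
  moreover have "inj T"
  proof (subst linear_injective_0[OF \<open>linear T\<close>], intro allI impI)
    fix w assume "T w = 0"
    then have 0: "B w i = 0" if "i \<in> Basis" for i using Ti[OF that, of w] by simp
    have "B w z = B 0 z" for z
      by (subst linear_expand[OF pd_formD(4)[OF B]]) (simp add: 0 pd_form_simps[OF B])
    then show "w = 0" by (rule pd_form_eqI[OF B])
  qed
  ultimately have "surj T" by (rule linear_injective_imp_surjective) simp
  then obtain w where w: "T w = (\<Sum>i\<in>Basis. l i *\<^sub>R i)" by (metis surjD)
  have "B w i = l i" if "i \<in> Basis" for i
    using Ti[OF that, of w] that unfolding w by simp
  then have "B w z = l z" for z
    by (subst linear_expand[OF pd_formD(4)[OF B]], subst linear_expand[OF l]) simp
  then show ?thesis using pd_form_eqI[OF B] by metis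
qed

lemma orthonormal_independent:
  assumes B: "pd_form B" and ef: "B e e = 1" "B f f = 1" "B e f = 0"
  shows "e \<noteq> f" "independent {e, f}"
proof -
  have fe: "B f e = 0" using ef(3) pd_formD(2)[OF B] by metis
  show ne: "e \<noteq> f" using ef by auto
  show "independent {e, f}"
  proof (rule independent_if_scalars_zero)
    fix c x assume s: "(\<Sum>x\<in>{e, f}. c x *\<^sub>R x) = 0" and x: "x \<in> {e, f}"
    have "c e *\<^sub>R e + c f *\<^sub>R f = 0" using s ne by simp
    then have "B e (c e *\<^sub>R e + c f *\<^sub>R f) = 0" "B f (c e *\<^sub>R e + c f *\<^sub>R f) = 0"
      by (simp_all add: pd_form_simps[OF B])
    then have "c e = 0" "c f = 0" by (simp_all add: pd_formD(7,13)[OF B] ef fe)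
    then show "c x = 0" using x by auto
  qed simp
qed

text \<open>In the plane two independent vectors span.\<close>

lemma orthonormal_expand:
  fixes B :: "real^2 \<Rightarrow> real^2 \<Rightarrow> real"
  assumes B: "pd_form B" and ef: "B e e = 1" "B f f = 1" "B e f = 0"
  shows "v = B e v *\<^sub>R e + B f v *\<^sub>R f"
proof -
  have fe: "B f e = 0" using ef(3) pd_formD(2)[OF B] by metis
  note ne = orthonormal_independent(1)[OF B ef]
  have "independent {e, f}" by (rule orthonormal_independent(2)[OF B ef])
  then have "v \<in> span {e, f}"
    using card_ge_dim_independent[of "{e, f}" "UNIV :: (real^2) set"] ne by auto
  then obtain a b where v: "v = a *\<^sub>R e + b *\<^sub>R f"
    by (auto simp: span_breakdown_eq eq_diff_eq) (metis add.commute diff_add_cancel)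
  show ?thesis unfolding v by (simp add: pd_formD(7,13)[OF B] ef fe)
qed

text \<open>Gram-Schmidt, applied to the standard basis, consists of smooth operations.\<close>

lemma smooth_orthonormal_frame:
  fixes B :: "'x::euclidean_space \<Rightarrow> real^2 \<Rightarrow> real^2 \<Rightarrow> real"
  assumes S: "open S" and B: "\<And>x. x \<in> S \<Longrightarrow> pd_form (B x)" and sm: "\<And>u w. smooth_on S (\<lambda>x. B x u w)"
  obtains E F where "smooth_on S E" "smooth_on S F"
    "\<And>x. x \<in> S \<Longrightarrow> B x (E x) (E x) = 1" "\<And>x. x \<in> S \<Longrightarrow> B x (F x) (F x) = 1"
    "\<And>x. x \<in> S \<Longrightarrow> B x (E x) (F x) = 0"
proof -
  define e f where "e = (axis 1 1 :: real^2)" and "f = (axis 2 1 :: real^2)"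
  have ne: "f - c *\<^sub>R e \<noteq> 0" "e \<noteq> 0" for c
    unfolding e_def f_def by (auto simp: vec_eq_iff axis_def forall_2)
  have smB: "smooth_on S p \<Longrightarrow> smooth_on S q \<Longrightarrow> smooth_on S (\<lambda>x. B x (p x) (q x))" for p q
    by (rule smooth_on_bilinear_family[OF S]) (use B sm pd_formD(1) in auto)
  define E where "E x = inverse (sqrt (B x e e)) *\<^sub>R e" for x
  define H where "H x = f - B x (E x) f *\<^sub>R E x" for x
  define F where "F x = inverse (sqrt (B x (H x) (H x))) *\<^sub>R H x" for x
  have H0: "H x \<noteq> 0" for x
    unfolding H_def E_def using ne(1)[of "B x (inverse (sqrt (B x e e)) *\<^sub>R e) f *
        inverse (sqrt (B x e e))"]
    by simp
  have smE: "smooth_on S E" unfolding E_def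
    by (intro smooth_intros S smooth_on_inverse_sqrt smB) (use B ne pd_formD(3) in auto)
  have smH: "smooth_on S H" unfolding H_def by (intro smooth_intros S smB smE)
  have smF: "smooth_on S F" unfolding F_def
    by (intro smooth_intros S smooth_on_inverse_sqrt smB smH) (use B H0 pd_formD(3) in auto)
  have EE: "B x (E x) (E x) = 1" if x: "x \<in> S" for x
  proof -
    have "B x e e > 0" using pd_formD(3)[OF B[OF x] ne(2)] .
    then show ?thesis unfolding E_def
      by (simp add: pd_form_simps[OF B[OF x]] field_simps)
  qed
  have "B x (E x) (H x) = 0" if x: "x \<in> S" for x
    unfolding H_def using EE[OF x] by (simp add: pd_formD(9,13)[OF B[OF x]])
  then have EF: "B x (E x) (F x) = 0" if x: "x \<in> S" for x
    unfolding F_def using x by (simp add: pd_formD(13)[OF B[OF x]])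
  have FF: "B x (F x) (F x) = 1" if x: "x \<in> S" for x
  proof -
    have "B x (H x) (H x) > 0" using pd_formD(3)[OF B[OF x] H0] .
    then show ?thesis unfolding F_def
      by (simp add: pd_formD(12,13)[OF B[OF x]] field_simps)
  qed
  show ?thesis using that[OF smE smF EE FF EF] .
qed

section \<open>The Levi-Civita connection of a metric on an open set\<close>

definition riem_metric :: "'e::euclidean_space set \<Rightarrow> ('e \<Rightarrow> 'e \<Rightarrow> 'e \<Rightarrow> real) \<Rightarrow> bool" where
  "riem_metric X G \<longleftrightarrow> open X \<and> (\<forall>x\<in>X. pd_form (G x)) \<and> (\<forall>u w. smooth_on X (\<lambda>x. G x u w))"

text \<open>The direction of differentiation comes first.\<close>

definition dmetric :: "('e::euclidean_space \<Rightarrow> 'e \<Rightarrow> 'e \<Rightarrow> real) \<Rightarrow> 'e \<Rightarrow> 'e \<Rightarrow> 'e \<Rightarrow> 'e \<Rightarrow> real" where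
  "dmetric G x z u w = frechet_derivative (\<lambda>y. G y u w) (at x) z"

text \<open>The Christoffel symbols are formulated for families of forms on open subsets of Euclidean
  spaces, so that they apply both to the base and to its tangent bundle.\<close>

definition chr :: "('e::euclidean_space \<Rightarrow> 'e \<Rightarrow> 'e \<Rightarrow> real) \<Rightarrow> 'e \<Rightarrow> 'e \<Rightarrow> 'e \<Rightarrow> 'e" where
  "chr G x u v = (THE w. \<forall>z. 2 * G x w z = dmetric G x u v z + dmetric G x v u z - dmetric G x z u v)"

definition curv :: "('e::euclidean_space \<Rightarrow> 'e \<Rightarrow> 'e \<Rightarrow> real) \<Rightarrow> 'e \<Rightarrow> 'e \<Rightarrow> 'e \<Rightarrow> 'e \<Rightarrow> 'e" where
  "curv G x u v w = frechet_derivative (\<lambda>y. chr G y v w) (at x) u -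
     frechet_derivative (\<lambda>y. chr G y u w) (at x) v +
     chr G x u (chr G x v w) - chr G x v (chr G x u w)"

context
  fixes X :: "'e::euclidean_space set" and G
  assumes XG: "riem_metric X G"
begin

lemma open_X: "open X" using XG by (simp add: riem_metric_def)
lemma pd_G: "x \<in> X \<Longrightarrow> pd_form (G x)" using XG by (simp add: riem_metric_def)
lemma smooth_G: "smooth_on X (\<lambda>x. G x u w)" using XG by (simp add: riem_metric_def)
lemmas G_simps = pd_form_simps[OF pd_G]

lemma dmetric_has_derivative:
  "x \<in> X \<Longrightarrow> ((\<lambda>y. G y u w) has_derivative (\<lambda>z. dmetric G x z u w)) (at x)"
  unfolding dmetric_def using smooth_on_has_derivative[OF smooth_G] by simp

text \<open>Linearity of the partial derivatives in all arguments makes the Koszul formula a linear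
  functional of its last argument, to which \<open>pd_form_riesz\<close> applies.\<close>

lemma dmetric_linear:
  assumes "x \<in> X"
  shows "linear (\<lambda>z. dmetric G x z u w)" "linear (\<lambda>u. dmetric G x z u w)"
      "linear (\<lambda>w. dmetric G x z u w)"
  using has_derivative_linear[OF dmetric_has_derivative[OF assms]]
    linear_family_derivative_linear[OF open_X assms, of "\<lambda>x u. G x u w" "\<lambda>z u. dmetric G x z u w"]
    linear_family_derivative_linear[OF open_X assms, of "\<lambda>x. G x u" "\<lambda>z. dmetric G x z u"]
    dmetric_has_derivative[OF assms] pd_formD(4,5)[OF pd_G]
  by blast+

lemma dmetric_sym: "x \<in> X \<Longrightarrow> dmetric G x z u w = dmetric G x z w u"
  unfolding dmetric_def
  by (subst frechet_derivative_cong_open[OF open_X, of x "\<lambda>y. G y u w" "\<lambda>y. G y w u"])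
    (use pd_formD(2)[OF pd_G] in auto)

lemma chr_koszul:
  assumes x: "x \<in> X"
  shows "2 * G x (chr G x u v) z = dmetric G x u v z + dmetric G x v u z - dmetric G x z u v"
proof -
  note lin = dmetric_linear[OF x]
  have "linear (\<lambda>z. (dmetric G x u v z + dmetric G x v u z - dmetric G x z u v) / 2)"
    by (rule linearI)
      (simp_all add: linear_add[OF lin(3)] linear_add[OF lin(1)] linear_cmul[OF lin(3)] linear_cmul[OF
          lin(1)] algebra_simps add_divide_distrib diff_divide_distrib)
  from pd_form_riesz[OF pd_G[OF x] this]
  have "\<exists>!w. \<forall>z. 2 * G x w z = dmetric G x u v z + dmetric G x v u z - dmetric G x z u v"
    by (simp add: field_simps)
  from theI'[OF this] show ?thesis unfolding chr_def by blast
qed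

lemma chr_unique:
  assumes "x \<in> X" "\<And>z. 2 * G x w z = dmetric G x u v z + dmetric G x v u z - dmetric G x z u v"
  shows "chr G x u v = w"
proof (rule pd_form_eqI[OF pd_G[OF assms(1)]])
  show "G x (chr G x u v) z = G x w z" for z
    using assms(2)[of z] chr_koszul[OF assms(1), of u v z] by simp
qed

lemma chr_sym: "x \<in> X \<Longrightarrow> chr G x u v = chr G x v u"
  by (rule chr_unique) (simp_all add: chr_koszul dmetric_sym)

lemma chr_bilinear:
  assumes x: "x \<in> X"
  shows "bilinear (chr G x)"
proof -
  note lin = dmetric_linear[OF x]
  have 1: "linear (chr G x u)" for u
  proof (rule linearI)
    fix v w :: 'e and c :: real
    show "chr G x u (v + w) = chr G x u v + chr G x u w"
      by (rule chr_unique[OF x]) (simp add: G_simps x distrib_left chr_koszul linear_add[OF lin(1)]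
          linear_add[OF lin(2)] linear_add[OF lin(3)])
    show "chr G x u (c *\<^sub>R v) = c *\<^sub>R chr G x u v"
      by (rule chr_unique[OF x]) (simp add: G_simps x mult.left_commute[of 2] chr_koszul linear_cmul[OF
          lin(1)]
          linear_cmul[OF lin(2)] linear_cmul[OF lin(3)] algebra_simps)
  qed
  moreover have "(\<lambda>u. chr G x u v) = chr G x v" for v using chr_sym[OF x] by auto
  ultimately show ?thesis unfolding bilinear_def by simp
qed

lemma chr_linear: "x \<in> X \<Longrightarrow> linear (chr G x u)" "x \<in> X \<Longrightarrow> linear (\<lambda>u. chr G x u v)"
  using chr_bilinear unfolding bilinear_def by auto

lemma metric_compatible:
  assumes x: "x \<in> X"
  shows "dmetric G x z u w = G x (chr G x z u) w + G x u (chr G x z w)"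
  using chr_koszul[OF x, of z u w] chr_koszul[OF x, of z w u] pd_formD(2)[OF pd_G[OF x], of u "chr G x z
      w"]
    dmetric_sym[OF x]
  by (simp add: dmetric_sym[OF x, of z w u] dmetric_sym[OF x, of u z w] dmetric_sym[OF x, of w z u])

text \<open>The Leibniz rule for fields \<open>p\<close> and \<open>q\<close> along a map \<open>f\<close>: the vector \<open>p' v + chr G (f y) (f'
  v) (p y)\<close> is the covariant derivative of \<open>p\<close> in direction \<open>v\<close>.\<close>

lemma G_has_derivative:
  assumes "f y \<in> X" "(f has_derivative f') (at y)" "(p has_derivative p') (at y)"
      "(q has_derivative q') (at y)"
  shows "((\<lambda>y. G (f y) (p y) (q y)) has_derivative
    (\<lambda>v. G (f y) (p' v + chr G (f y) (f' v) (p y)) (q y) + G (f y) (p y) (q' v +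
        chr G (f y) (f' v) (q y)))) (at y)"
proof -
  have cont: "isCont f y" using assms(2) by (rule has_derivative_continuous)
  obtain U where U: "open U" "y \<in> U" "f ` U \<subseteq> X"
  proof -
    have "\<exists>s. open s \<and> y \<in> s \<and> (\<forall>z\<in>s. f z \<in> X)"
      using cont[unfolded continuous_at_open, rule_format, of X] open_X assms(1) by simp
    then show ?thesis using that by blast
  qed
  have "((\<lambda>y. G (f y) (p y) (q y)) has_derivative
     (\<lambda>v. dmetric G (f y) (f' v) (p y) (q y) + G (f y) (p' v) (q y) + G (f y) (p y) (q' v))) (at y)"
  proof (rule has_derivative_bilinear_family[OF U(1,2)])
    show "bilinear (G (f z))" if "z \<in> U" for z using that U pd_G pd_formD(1) by blast
    show "((\<lambda>y. G (f y) u w) has_derivative (\<lambda>v. dmetric G (f y) (f' v) u w)) (at y)" for u w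
      by (rule has_derivative_compose[OF assms(2) dmetric_has_derivative[OF assms(1)]])
  qed fact+
  then show ?thesis
    by (rule has_derivative_eq_rhs)
      (simp add: fun_eq_iff metric_compatible[OF assms(1)] G_simps[OF assms(1)])
qed

end

text \<open>Differentiating the isometry equation adds the second derivative of the map to each term of
  the Koszul formula. As the second derivative is symmetric, only its value on the first two
  arguments survives.\<close>

lemma chr_transform:
  fixes \<tau> :: "'e::euclidean_space \<Rightarrow> 'e"
  assumes XG: "riem_metric X G" and YH: "riem_metric Y H"
    and U: "open U" "U \<subseteq> X" "x \<in> U" and tau: "smooth_on U \<tau>" "\<tau> ` U \<subseteq> Y"
    and iso: "\<And>y u w. y \<in> U \<Longrightarrow> G y u w = H (\<tau> y) (frechet_derivative \<tau> (at y) u) (frechet_derivative \<tau>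
        (at y) w)"
    and surj: "surj (frechet_derivative \<tau> (at x))"
  shows "frechet_derivative \<tau> (at x) (chr G x u v) =
     frechet_derivative (\<lambda>y. frechet_derivative \<tau> (at y) v) (at x) u +
     chr H (\<tau> x) (frechet_derivative \<tau> (at x) u) (frechet_derivative \<tau> (at x) v)"
proof (rule pd_form_eqI)
  define D where "D = (\<lambda>y. frechet_derivative \<tau> (at y))"
  define DD where "DD u v = frechet_derivative (\<lambda>y. D y v) (at x) u" for u v
  have xX: "x \<in> X" and tY: "\<tau> x \<in> Y" using U tau(2) by auto
  show pd: "pd_form (H (\<tau> x))" by (rule pd_G[OF YH tY])
  note Hs = G_simps[OF YH tY]
  have DD_sym: "DD u v = DD v u" for u v
    unfolding DD_def D_def by (rule symmetric_second_derivative[OF U(1) tau(1) U(3)])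
  have derD: "((\<lambda>y. D y v) has_derivative (\<lambda>u. DD u v)) (at x)" for v
    unfolding DD_def D_def
    using smooth_on_has_derivative[OF smooth_on_frechet[OF tau(1)] U(3)] by simp
  have dert: "(\<tau> has_derivative D x) (at x)"
    unfolding D_def by (rule smooth_on_has_derivative[OF tau(1) U(3)])
  have dG: "dmetric G x z u w = H (\<tau> x) (DD z u + chr H (\<tau> x) (D x z) (D x u)) (D x w)
      + H (\<tau> x) (D x u) (DD z w + chr H (\<tau> x) (D x z) (D x w))" for z u w
  proof -
    have "((\<lambda>y. H (\<tau> y) (D y u) (D y w)) has_derivative (\<lambda>z. dmetric G x z u w)) (at x)"
      by (rule has_derivative_transform_within_open[OF dmetric_has_derivative[OF XG xX] U(1,3)])
        (simp add: iso D_def)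
    from has_derivative_unique[OF this G_has_derivative[OF YH tY dert derD derD]]
    show ?thesis by metis
  qed
  fix z
  obtain z' where z: "z = D x z'" using surj unfolding D_def by (metis surjD)
  have "2 * G x (chr G x u v) z' = 2 * H (\<tau> x) (DD u v + chr H (\<tau> x) (D x u) (D x v)) z"
    unfolding chr_koszul[OF XG xX] dG
    by (simp add: Hs z DD_sym[of z' v] DD_sym[of z' u] DD_sym[of v u] chr_sym[OF YH tY, of "D x z'"]
        chr_sym[OF YH tY, of "D x v" "D x u"] pd_formD(2)[OF pd, of "D x v"] pd_formD(2)[OF pd, of "D x
            u"] pd_formD(2)[OF pd, of "D x z'"])
  then have "G x (chr G x u v) z' = H (\<tau> x) (DD u v + chr H (\<tau> x) (D x u) (D x v)) z" by simp
  then show "H (\<tau> x) (frechet_derivative \<tau> (at x) (chr G x u v)) z = H (\<tau> x)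
     (frechet_derivative (\<lambda>y. frechet_derivative \<tau> (at y) v) (at x) u +
      chr H (\<tau> x) (frechet_derivative \<tau> (at x) u) (frechet_derivative \<tau> (at x) v)) z"
    unfolding iso[OF U(3)] z DD_def D_def .
qed

section \<open>Curvature of a metric on an open subset of the plane\<close>

definition dchr :: "('e::euclidean_space \<Rightarrow> 'e \<Rightarrow> 'e \<Rightarrow> real) \<Rightarrow> 'e \<Rightarrow> 'e \<Rightarrow> 'e \<Rightarrow> 'e \<Rightarrow> 'e" where
  "dchr G x z u v = frechet_derivative (\<lambda>y. chr G y u v) (at x) z"

definition const_curv :: "('e::euclidean_space) set \<Rightarrow> ('e \<Rightarrow> 'e \<Rightarrow> 'e \<Rightarrow> real) \<Rightarrow> real \<Rightarrow> bool" where
  "const_curv X G K \<longleftrightarrow> (\<forall>x\<in>X. \<forall>u v. u \<noteq> v \<and> independent {u, v} \<longrightarrow>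
     G x (curv G x u v v) u / (G x u u * G x v v - (G x u v)\<^sup>2) = K)"

context
  fixes X :: "(real^2) set" and G
  assumes XG: "riem_metric X G"
begin

lemma pointwise_orthonormal:
  assumes "x \<in> X"
  obtains e f where "G x e e = 1" "G x f f = 1" "G x e f = 0"
    "\<And>v. v = G x e v *\<^sub>R e + G x f v *\<^sub>R f"
proof -
  obtain E F where *: "\<And>x. x \<in> X \<Longrightarrow> G x (E x) (E x) = 1" "\<And>x. x \<in> X \<Longrightarrow> G x (F x) (F x) = 1"
    "\<And>x. x \<in> X \<Longrightarrow> G x (E x) (F x) = 0"
    by (rule smooth_orthonormal_frame[OF open_X[OF XG], of G])
      (use pd_G[OF XG] smooth_G[OF XG] in blast)+
  show ?thesis
    by (rule that[OF *[OF assms]], rule orthonormal_expand[OF pd_G[OF XG assms] *[OF assms]])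
qed

text \<open>The Koszul formula gives the components of the Christoffel symbols in a smooth orthonormal
  frame.\<close>

lemma smooth_chr: "smooth_on X (\<lambda>x. chr G x u v)"
proof -
  note oX = open_X[OF XG]
  obtain E F where EF: "smooth_on X E" "smooth_on X F"
    "\<And>x. x \<in> X \<Longrightarrow> G x (E x) (E x) = 1" "\<And>x. x \<in> X \<Longrightarrow> G x (F x) (F x) = 1"
    "\<And>x. x \<in> X \<Longrightarrow> G x (E x) (F x) = 0"
    using smooth_orthonormal_frame[OF oX, of G] pd_G[OF XG] smooth_G[OF XG] by metis
  have sd: "smooth_on X (\<lambda>x. dmetric G x z u w)" for z u w
    unfolding dmetric_def by (rule smooth_on_frechet[OF smooth_G[OF XG]])
  have "smooth_on X (\<lambda>x. dmetric G x u v (p x))" "smooth_on X (\<lambda>x. dmetric G x (p x) u v)"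
    if "smooth_on X p" for p u v
    by (rule smooth_on_linear_family[OF oX _ _ that, of "\<lambda>x. dmetric G x u v"],
        rule dmetric_linear[OF XG], assumption, rule sd)
       (rule smooth_on_linear_family[OF oX _ _ that, of "\<lambda>x z. dmetric G x z u v"],
        rule dmetric_linear[OF XG], assumption, rule sd)
  then have k: "smooth_on X (\<lambda>x. (dmetric G x u v (p x) + dmetric G x v u (p x) -
      dmetric G x (p x) u v) * (1/2))"
    if "smooth_on X p" for p
    using that oX by (intro smooth_intros) auto
  show ?thesis
  proof (rule smooth_on_cong[OF oX])
    show "smooth_on X (\<lambda>x.
       ((dmetric G x u v (E x) + dmetric G x v u (E x) - dmetric G x (E x) u v) * (1/2)) *\<^sub>R E x +
       ((dmetric G x u v (F x) + dmetric G x v u (F x) - dmetric G x (F x) u v) * (1/2)) *\<^sub>R F x)"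
      by (intro smooth_on_add smooth_on_scaleR oX k EF)
    fix x assume x: "x \<in> X"
    note pd = pd_G[OF XG x]
    show "((dmetric G x u v (E x) + dmetric G x v u (E x) - dmetric G x (E x) u v) * (1/2)) *\<^sub>R E x +
       ((dmetric G x u v (F x) + dmetric G x v u (F x) - dmetric G x (F x) u v) * (1/2)) *\<^sub>R F x =
           chr G x u v"
      using orthonormal_expand[OF pd EF(3-5)[OF x], of "chr G x u v"]
      by (simp add: chr_koszul[OF XG x, symmetric] pd_formD(2)[OF pd, of _ "chr G x u v"])
  qed
qed

lemma chr_has_derivative:
  "x \<in> X \<Longrightarrow> ((\<lambda>y. chr G y u v) has_derivative (\<lambda>z. dchr G x z u v)) (at x)"
  unfolding dchr_def using smooth_on_has_derivative[OF smooth_chr] by simp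

lemma dchr_linear:
  assumes "x \<in> X"
  shows "linear (\<lambda>z. dchr G x z u w)" "linear (\<lambda>u. dchr G x z u w)" "linear (\<lambda>w. dchr G x z u w)"
  using has_derivative_linear[OF chr_has_derivative[OF assms]]
    linear_family_derivative_linear[OF open_X[OF XG] assms, of "\<lambda>x u. chr G x u w"
        "\<lambda>z u. dchr G x z u w"]
    linear_family_derivative_linear[OF open_X[OF XG] assms, of "\<lambda>x. chr G x u" "\<lambda>z. dchr G x z u"]
    chr_has_derivative[OF assms] chr_linear[OF XG]
  by blast+

lemma dchr_sym: "x \<in> X \<Longrightarrow> dchr G x z u w = dchr G x z w u"
  unfolding dchr_def
  by (subst frechet_derivative_cong_open[OF open_X[OF XG], of x "\<lambda>y. chr G y u w" "\<lambda>y. chr G y w u"])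
    (use chr_sym[OF XG] in auto)

lemmas chr_simps = linear_add[OF chr_linear(1)[OF XG]] linear_add[OF chr_linear(2)[OF XG]]
  linear_diff[OF chr_linear(1)[OF XG]] linear_diff[OF chr_linear(2)[OF XG]]
  linear_cmul[OF chr_linear(1)[OF XG]] linear_cmul[OF chr_linear(2)[OF XG]]

lemma curv_alt: "curv G x u v w = dchr G x u v w - dchr G x v u w +
     chr G x u (chr G x v w) - chr G x v (chr G x u w)"
  unfolding curv_def dchr_def by simp

lemma curv_linear:
  assumes x: "x \<in> X"
  shows "linear (\<lambda>u. curv G x u v w)" "linear (\<lambda>v. curv G x u v w)" "linear (\<lambda>w. curv G x u v w)"
  unfolding curv_alt
  by (rule linearI;
      simp add: chr_simps[OF x] linear_add[OF dchr_linear(1)[OF x]] linear_add[OF dchr_linear(2)[OF x]]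
      linear_add[OF dchr_linear(3)[OF x]] linear_cmul[OF dchr_linear(1)[OF x]] linear_cmul[OF
          dchr_linear(2)[OF x]]
      linear_cmul[OF dchr_linear(3)[OF x]] scaleR_diff_right scaleR_add_right)+

lemma curv_skew: "curv G x u v w = - curv G x v u w"
  unfolding curv_alt by simp

text \<open>The second derivatives of \<open>G y w w'\<close> commute. Written with covariant derivatives, their
  commutator consists of the two curvature terms.\<close>

lemma curv_skew_adjoint:
  assumes x: "x \<in> X"
  shows "G x (curv G x u v w) w' = - G x w (curv G x u v w')"
proof -
  note Gs = G_simps[OF XG x]
  have "frechet_derivative (\<lambda>y. dmetric G y v w w') (at x) u =
     G x (dchr G x u v w + chr G x u (chr G x v w)) w' + G x (chr G x v w) (chr G x u w') +
     (G x (chr G x u w) (chr G x v w') + G x w (dchr G x u v w' + chr G x u (chr G x v w')))" for u v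
  proof -
    have "((\<lambda>y. G y (chr G y v w) w' + G y w (chr G y v w')) has_derivative
      (\<lambda>u. (G x (dchr G x u v w + chr G x u (chr G x v w)) w' + G x (chr G x v w) (0 + chr G x u w')) +
     (G x (0 + chr G x u w) (chr G x v w') + G x w (dchr G x u v w' +
         chr G x u (chr G x v w'))))) (at x)"
      by (intro has_derivative_add G_has_derivative[where f="\<lambda>y. y" and y=x, OF XG x]
          has_derivative_ident has_derivative_const
          chr_has_derivative x)
    then have "((\<lambda>y. dmetric G y v w w') has_derivative
      (\<lambda>u. (G x (dchr G x u v w + chr G x u (chr G x v w)) w' + G x (chr G x v w) (0 + chr G x u w')) +
     (G x (0 + chr G x u w) (chr G x v w') + G x w (dchr G x u v w' +
         chr G x u (chr G x v w'))))) (at x)"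
      by (rule has_derivative_transform_within_open[OF _ open_X[OF XG] x])
        (simp add: metric_compatible[OF XG])
    from frechet_derivative_at[OF this, symmetric] show ?thesis by simp
  qed
  moreover have "frechet_derivative (\<lambda>y. dmetric G y v w w') (at x) u =
      frechet_derivative (\<lambda>y. dmetric G y u w w') (at x) v"
    unfolding dmetric_def by (rule symmetric_second_derivative[OF open_X[OF XG] smooth_G[OF XG] x])
  ultimately show ?thesis unfolding curv_alt by (simp add: Gs)
qed

text \<open>In the plane, \<open>G x (curv G x p q w) z\<close> is alternating in \<open>p\<close>, \<open>q\<close> and in \<open>w\<close>, \<open>z\<close>, so it is
  determined by one value, which is a sectional curvature.\<close>

lemma const_curv_formula:
  assumes x: "x \<in> X" and K: "const_curv X G K"
  shows "G x (curv G x p q w) z = K * (G x q w * G x p z - G x p w * G x q z)"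
proof -
  obtain e f where ef: "G x e e = 1" "G x f f = 1" "G x e f = 0"
    and ex: "\<And>v. v = G x e v *\<^sub>R e + G x f v *\<^sub>R f"
    using pointwise_orthonormal[OF x] by blast
  note Gs = G_simps[OF XG x] and pd = pd_G[OF XG x]
  have fe: "G x f e = 0" using ef(3) pd_formD(2)[OF pd] by metis
  have R: "G x (curv G x e f f) e = K"
  proof -
    note ne = orthonormal_independent(1)[OF pd ef]
    have "independent {e, f}" by (rule orthonormal_independent(2)[OF pd ef])
    then have "G x (curv G x e f f) e / (G x e e * G x f f - (G x e f)\<^sup>2) = K"
      using K x ne unfolding const_curv_def by blast
    then show ?thesis by (simp add: ef)
  qed
  define S where "S w z = G x (curv G x e f w) z" for w z
  have S0: "S w z = - S z w" for w z
    unfolding S_def using curv_skew_adjoint[OF x] pd_formD(2)[OF pd] by metis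
  have S1: "S e e = 0" "S f f = 0" "S f e = K" "S e f = - K"
    using S0[of e e] S0[of f f] S0[of e f] R by (auto simp: S_def)
  have Slin: "S (a *\<^sub>R e + b *\<^sub>R f) (c *\<^sub>R e + d *\<^sub>R f) = K * (b * c - a * d)" for a b c d
  proof -
    have "S (a *\<^sub>R e + b *\<^sub>R f) (c *\<^sub>R e + d *\<^sub>R f) =
       a * c * S e e + a * d * S e f + b * c * S f e + b * d * S f f"
      unfolding S_def by (simp add: linear_add[OF curv_linear(3)[OF x]] linear_cmul[OF curv_linear(3)[OF
          x]] Gs algebra_simps)
    then show ?thesis unfolding S1 by (simp add: algebra_simps)
  qed
  have c0: "curv G x u u w = 0" for u w unfolding curv_alt by simp
  have curv: "curv G x (a *\<^sub>R e + b *\<^sub>R f) (c *\<^sub>R e + d *\<^sub>R f) w = (a * d - b * c) *\<^sub>R curv G x e f w"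
      for a b c d w
    by (simp add: linear_add[OF curv_linear(1)[OF x]] linear_cmul[OF curv_linear(1)[OF x]]
       linear_add[OF curv_linear(2)[OF x]] linear_cmul[OF curv_linear(2)[OF x]] c0 curv_skew[of x f e]
           algebra_simps)
  obtain p1 p2 q1 q2 w1 w2 z1 z2 where *: "p = p1 *\<^sub>R e + p2 *\<^sub>R f" "q = q1 *\<^sub>R e + q2 *\<^sub>R f"
    "w = w1 *\<^sub>R e + w2 *\<^sub>R f" "z = z1 *\<^sub>R e + z2 *\<^sub>R f"
    using ex by blast
  have Gc: "G x (a *\<^sub>R e + b *\<^sub>R f) (c *\<^sub>R e + d *\<^sub>R f) = a * c + b * d" for a b c d
    by (simp add: Gs ef fe)
  have "G x (curv G x p q w) z = (p1 * q2 - p2 * q1) * S w z"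
    unfolding *(1,2) curv S_def by (simp add: Gs)
  also have "S w z = K * (w2 * z1 - w1 * z2)" unfolding *(3,4) by (rule Slin)
  finally show ?thesis unfolding * Gc by (simp add: algebra_simps)
qed

end

section \<open>The Sasaki metric over an open subset of the plane\<close>

text \<open>The connection map in coordinates: a point of the tangent bundle is a pair \<open>y = (x, \<xi>)\<close>.\<close>

definition vert :: "('e::euclidean_space \<Rightarrow> 'e \<Rightarrow> 'e \<Rightarrow> real) \<Rightarrow> 'e \<times> 'e \<Rightarrow> 'e \<times> 'e \<Rightarrow> 'e" where
  "vert G y U = snd U + chr G (fst y) (snd y) (fst U)"

definition sas :: "('e::euclidean_space \<Rightarrow> 'e \<Rightarrow> 'e \<Rightarrow> real) \<Rightarrow> 'e \<times> 'e \<Rightarrow> 'e \<times> 'e \<Rightarrow> 'e \<times> 'e \<Rightarrow> real" where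
  "sas G y U V = G (fst y) (fst U) (fst V) + G (fst y) (vert G y U) (vert G y V)"

text \<open>The covariant derivative, in direction \<open>U\<close>, of the vertical part of the constant vector
  field \<open>V\<close>.\<close>

definition dvert :: "('e::euclidean_space \<Rightarrow> 'e \<Rightarrow> 'e \<Rightarrow> real) \<Rightarrow> 'e \<times> 'e \<Rightarrow> 'e \<times> 'e \<Rightarrow> 'e \<times> 'e \<Rightarrow> 'e" where
  "dvert G y U V = dchr G (fst y) (fst U) (snd y) (fst V) + chr G (fst y) (snd U) (fst V) +
     chr G (fst y) (fst U) (vert G y V)"

context
  fixes X :: "(real^2) set" and G
  assumes XG: "riem_metric X G"
begin

lemma vert_linear: "fst y \<in> X \<Longrightarrow> linear (vert G y)"
  unfolding vert_def
  by (rule linearI) (simp_all add: linear_add[OF chr_linear(1)[OF XG]] linear_cmul[OF chr_linear(1)[OF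
      XG]] scaleR_add_right)

lemma sas_pd_form:
  assumes y: "fst y \<in> X"
  shows "pd_form (sas G y)"
  unfolding pd_form_def
proof (intro conjI allI impI)
  note pd = pd_G[OF XG y]
  note v = linear_add[OF vert_linear[OF y]] linear_cmul[OF vert_linear[OF y]]
  show "bilinear (sas G y)"
    unfolding bilinear_def sas_def
    by (intro conjI allI linearI) (simp_all add: v pd_form_simps[OF pd] algebra_simps)
  show "sas G y u w = sas G y w u" for u w
    unfolding sas_def using pd_formD(2)[OF pd] by metis
  fix u :: "(real^2) \<times> (real^2)" assume u: "u \<noteq> 0"
  have nn: "G (fst y) w w \<ge> 0" for w
    using pd_formD(3)[OF pd, of w] by (cases "w = 0") (auto simp: pd_form_simps[OF pd])
  show "sas G y u u > 0"
  proof (cases "fst u = 0")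
    case True
    then have "snd u \<noteq> 0" using u by (auto simp: prod_eq_iff)
    moreover have "vert G y u = snd u" unfolding vert_def True
      using linear_0[OF chr_linear(1)[OF XG y]] by simp
    ultimately show ?thesis
      unfolding sas_def using pd_formD(3)[OF pd] nn by (metis add_nonneg_pos)
  next
    case False
    then show ?thesis unfolding sas_def using pd_formD(3)[OF pd] nn by (metis add_pos_nonneg)
  qed
qed

lemma sas_riem_metric: "riem_metric (X \<times> UNIV) (sas G)"
  unfolding riem_metric_def
proof (intro conjI ballI allI)
  note oX = open_X[OF XG]
  show o: "open (X \<times> (UNIV :: (real^2) set))" using oX by (intro open_Times) auto
  show "pd_form (sas G y)" if "y \<in> X \<times> UNIV" for y using sas_pd_form that by auto
  fix U V :: "(real^2) \<times> (real^2)"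
  have f: "smooth_on (X \<times> (UNIV :: (real^2) set)) fst" and s: "smooth_on (X \<times> (UNIV :: (real^2) set))
      snd"
    using o by (auto intro: smooth_on_linear bounded_linear_fst bounded_linear_snd)
  have c: "smooth_on (X \<times> (UNIV :: (real^2) set)) (\<lambda>y. chr G (fst y) u v)"
     and g: "smooth_on (X \<times> (UNIV :: (real^2) set)) (\<lambda>y. G (fst y) u v)" for u v
    by (rule smooth_on_compose[OF o oX f]; use smooth_chr[OF XG] smooth_G[OF XG] in auto)+
  have "smooth_on (X \<times> (UNIV :: (real^2) set)) (\<lambda>y. chr G (fst y) (snd y) v)" for v
    by (rule smooth_on_linear_family[OF o _ c s]) (use chr_linear(2)[OF XG] in auto)
  then have v: "smooth_on (X \<times> (UNIV :: (real^2) set)) (\<lambda>y. vert G y U)" for U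
    unfolding vert_def using o by (intro smooth_intros) auto
  show "smooth_on (X \<times> UNIV) (\<lambda>x. sas G x U V)"
    unfolding sas_def
    by (intro smooth_on_add o g smooth_on_bilinear_family[OF o _ g v v])
      (use pd_formD(1)[OF pd_G[OF XG]] in auto)
qed

lemma vert_has_derivative:
  assumes y: "fst y \<in> X"
  shows "((\<lambda>y. vert G y V) has_derivative (\<lambda>U. dchr G (fst y) (fst U) (snd y) (fst V) +
      chr G (fst y) (snd U) (fst V))) (at y)"
proof -
  have o: "open (X \<times> (UNIV :: (real^2) set))" using open_X[OF XG] by (intro open_Times) auto
  have "((\<lambda>y. snd V + chr G (fst y) (snd y) (fst V)) has_derivative
    (\<lambda>U. 0 + (dchr G (fst y) (fst U) (snd y) (fst V) + chr G (fst y) (snd U) (fst V)))) (at y)"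
  proof (intro has_derivative_add has_derivative_const)
    show "((\<lambda>y. chr G (fst y) (snd y) (fst V)) has_derivative
       (\<lambda>U. dchr G (fst y) (fst U) (snd y) (fst V) + chr G (fst y) (snd U) (fst V))) (at y)"
    proof (rule has_derivative_linear_family[OF o, where B="\<lambda>y u. chr G (fst y) u (fst V)" and B'="\<lambda>U u.
        dchr G (fst y) (fst U) u (fst V)"])
      show "((\<lambda>y. chr G (fst y) u (fst V)) has_derivative
          (\<lambda>v. dchr G (fst y) (fst v) u (fst V))) (at y)" for u
        by (rule has_derivative_compose[where f=fst and x=y, OF _ chr_has_derivative[OF XG y]])
          (auto intro!: derivative_eq_intros)
    qed (use y chr_linear(2)[OF XG] in \<open>auto intro!: derivative_eq_intros simp: mem_Times_iff\<close>)
  qed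
  then show ?thesis unfolding vert_def by simp
qed

lemma dmetric_sas:
  assumes y: "fst y \<in> X"
  shows "dmetric (sas G) y U V Z =
    G (fst y) (chr G (fst y) (fst U) (fst V)) (fst Z) +
        G (fst y) (fst V) (chr G (fst y) (fst U) (fst Z)) +
    (G (fst y) (dvert G y U V) (vert G y Z) + G (fst y) (vert G y V) (dvert G y U Z))"
proof -
  have f: "(fst has_derivative fst) (at y)" by (auto intro!: derivative_eq_intros)
  have "((\<lambda>y. sas G y V Z) has_derivative (\<lambda>U.
    (G (fst y) (0 + chr G (fst y) (fst U) (fst V)) (fst Z) + G (fst y) (fst V) (0 +
        chr G (fst y) (fst U) (fst Z))) +
    (G (fst y) (dvert G y U V) (vert G y Z) + G (fst y) (vert G y V) (dvert G y U Z)))) (at y)"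
    unfolding sas_def dvert_def
    by (intro has_derivative_add G_has_derivative[where f=fst and y=y, OF XG y f] has_derivative_const
        vert_has_derivative y)
  from frechet_derivative_at[OF this, symmetric] show ?thesis unfolding dmetric_def by simp
qed

text \<open>Constant vector fields commute, so exchanging them costs only a curvature term.\<close>

lemma dvert_skew:
  assumes y: "fst y \<in> X"
  shows "dvert G y U V - dvert G y V U = curv G (fst y) (fst U) (fst V) (snd y)"
  unfolding dvert_def vert_def curv_alt[OF XG]
  using chr_sym[OF XG y] dchr_sym[OF XG y]
  by (simp add: linear_add[OF chr_linear(1)[OF XG y]] chr_sym[OF XG y, of "snd y"]
    dchr_sym[OF XG y, of "fst U" "snd y"] dchr_sym[OF XG y, of "fst V" "snd y"]
    chr_sym[OF XG y, of "snd U"] chr_sym[OF XG y, of "snd V"])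

text \<open>After \<open>dmetric_sas\<close> the Koszul formula contains only covariant derivatives. The derivatives
  of the horizontal parts are symmetric and those of the vertical parts are exchanged by
  \<open>dvert_skew\<close>; the curvature terms are what remains.\<close>

lemma sas_chr:
  assumes y: "fst y \<in> X"
  shows "sas G y (chr (sas G) y U V) Z =
    G (fst y) (chr G (fst y) (fst U) (fst V)) (fst Z) +
    G (fst y) (dvert G y U V - (1/2) *\<^sub>R curv G (fst y) (fst U) (fst V) (snd y)) (vert G y Z) +
    (G (fst y) (vert G y V) (curv G (fst y) (fst U) (fst Z) (snd y)) +
     G (fst y) (vert G y U) (curv G (fst y) (fst V) (fst Z) (snd y))) / 2"
proof -
  have yy: "y \<in> X \<times> UNIV" using y by (simp add: mem_Times_iff)
  note Gs = G_simps[OF XG y] and sym = pd_formD(2)[OF pd_G[OF XG y]]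
  have "2 * sas G y (chr (sas G) y U V) Z =
    2 * G (fst y) (chr G (fst y) (fst U) (fst V)) (fst Z) +
    G (fst y) (2 *\<^sub>R dvert G y U V - curv G (fst y) (fst U) (fst V) (snd y)) (vert G y Z) +
    (G (fst y) (vert G y V) (curv G (fst y) (fst U) (fst Z) (snd y)) +
     G (fst y) (vert G y U) (curv G (fst y) (fst V) (fst Z) (snd y)))"
    unfolding chr_koszul[OF sas_riem_metric yy] dmetric_sas[OF y] dvert_skew[OF y, symmetric]
    by (simp add: Gs chr_sym[OF XG y, of "fst V" "fst U"] chr_sym[OF XG y, of "fst Z"]
       sym[of "chr G (fst y) (fst U) (fst Z)"] sym[of "dvert G y Z U"] sym[of "dvert G y Z V"])
  then show ?thesis unfolding Gs by (simp add: field_simps)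
qed

end

section \<open>Charts, tangent vectors and metrics on a surface\<close>

definition cimg :: "('a, 'e) chart \<Rightarrow> 'e set" where
  "cimg c = chart_map c ` chart_dom c"

definition overlap :: "('a, 'e) chart \<Rightarrow> ('a, 'e) chart \<Rightarrow> 'e set" where
  "overlap c d = chart_map c ` (chart_dom c \<inter> chart_dom d)"

definition transition :: "('a, 'e) chart \<Rightarrow> ('a, 'e) chart \<Rightarrow> 'e \<Rightarrow> 'e" where
  "transition c d = chart_map d \<circ> chart_inv c"

abbreviation dtrans :: "('a, 'e::euclidean_space) chart \<Rightarrow> ('a, 'e) chart \<Rightarrow> 'e \<Rightarrow> 'e \<Rightarrow> 'e" where
  "dtrans c d x \<equiv> frechet_derivative (transition c d) (at x)"

lemma chr_cong:
  assumes "open X" "x \<in> X" "\<And>y. y \<in> X \<Longrightarrow> G y = H y"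
  shows "chr G x = chr H x"
proof -
  have "dmetric G x = dmetric H x"
    unfolding dmetric_def
    by (intro ext) (subst frechet_derivative_cong_open[OF assms(1,2), of "\<lambda>y. G y u w" "\<lambda>y. H y u w"
        for u w]; simp add: assms(3))
  then show ?thesis unfolding chr_def[abs_def] using assms(2,3) by simp
qed

lemma christoffel_eq_chr: "christoffel A g c = chr (metric_in A g c)"
  unfolding christoffel_def[abs_def] chr_def[abs_def] dmetric_def ..

lemma curvature_eq_curv: "curvature_tensor A g c = curv (metric_in A g c)"
  unfolding curvature_tensor_def[abs_def] curv_def[abs_def] christoffel_eq_chr ..

lemma chart_inv_in: "x \<in> cimg c \<Longrightarrow> chart_inv c x \<in> chart_dom c"
  unfolding chart_inv_def cimg_def by (rule inv_into_into)

lemma chart_map_inv: "x \<in> cimg c \<Longrightarrow> chart_map c (chart_inv c x) = x"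
  unfolding chart_inv_def cimg_def by (rule f_inv_into_f)

lemma overlap_mem: "p \<in> chart_dom c \<Longrightarrow> p \<in> chart_dom d \<Longrightarrow> chart_map c p \<in> overlap c d"
  unfolding overlap_def by auto

lemma cimg_mem: "p \<in> chart_dom c \<Longrightarrow> chart_map c p \<in> cimg c"
  unfolding cimg_def by auto

lemma overlap_subset: "overlap c d \<subseteq> cimg c" unfolding overlap_def cimg_def by auto

lemma coord_vec_eq:
  "coord_vec A c p u = (\<lambda>d. if d \<in> A \<and> p \<in> chart_dom d then dtrans c d (chart_map c p) u else 0)"
  unfolding coord_vec_def transition_def ..

lemma tangent_space_iff:
  "v \<in> tangent_space A p \<longleftrightarrow> (\<forall>c. \<not> (c \<in> A \<and> p \<in> chart_dom c) \<longrightarrow> v c = 0) \<and>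
         (\<forall>c\<in>A. \<forall>d\<in>A. p \<in> chart_dom c \<inter> chart_dom d \<longrightarrow> v d = dtrans c d (chart_map c p) (v c))"
  unfolding tangent_space_def transition_def by simp

lemma tchart_dom: "Q \<in> chart_dom (tangent_chart A c) \<longleftrightarrow> fst Q \<in> chart_dom c \<and>
    snd Q \<in> tangent_space A (fst Q)"
  unfolding tangent_chart_def by (cases Q) simp

lemma tchart_map: "chart_map (tangent_chart A c) Q = (chart_map c (fst Q), snd Q c)"
  unfolding tangent_chart_def by (cases Q) simp

definition ddtrans :: "('a, 'e::euclidean_space) chart \<Rightarrow> ('a, 'e) chart \<Rightarrow> 'e \<Rightarrow> 'e \<Rightarrow> 'e \<Rightarrow> 'e" where
  "ddtrans c d x u v = frechet_derivative (\<lambda>y. dtrans c d y v) (at x) u"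

context
  fixes A :: "('a, 'e::euclidean_space) chart set"
  assumes A: "smooth_atlas A"
begin

lemma chart_inj: "c \<in> A \<Longrightarrow> inj_on (chart_map c) (chart_dom c)"
  using A by (simp add: smooth_atlas_def)

lemma open_cimg: "c \<in> A \<Longrightarrow> open (cimg c)"
  using A by (simp add: smooth_atlas_def cimg_def)

lemma open_overlap: "c \<in> A \<Longrightarrow> d \<in> A \<Longrightarrow> open (overlap c d)"
  using A by (simp add: smooth_atlas_def overlap_def)

lemma smooth_trans: "c \<in> A \<Longrightarrow> d \<in> A \<Longrightarrow> smooth_on (overlap c d) (transition c d)"
  using A by (simp add: smooth_atlas_def overlap_def transition_def)

lemma chart_inv_map: "c \<in> A \<Longrightarrow> p \<in> chart_dom c \<Longrightarrow> chart_inv c (chart_map c p) = p"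
  unfolding chart_inv_def using chart_inj by (simp add: inv_into_f_f)

lemma overlap_iff: "c \<in> A \<Longrightarrow> x \<in> overlap c d \<longleftrightarrow> x \<in> cimg c \<and> chart_inv c x \<in> chart_dom d"
  using chart_map_inv[of x c] chart_inv_in[of x c] chart_inv_map[of c]
  unfolding overlap_def cimg_def by (auto simp: image_iff intro!: bexI[of _ "chart_inv c x"])

lemma transition_map: "c \<in> A \<Longrightarrow> p \<in> chart_dom c \<Longrightarrow> transition c d (chart_map c p) = chart_map d p"
  unfolding transition_def by (simp add: chart_inv_map)

lemma transition_in: "c \<in> A \<Longrightarrow> x \<in> overlap c d \<Longrightarrow> transition c d x \<in> overlap d c"
  unfolding overlap_def by (auto simp: transition_map)

lemma dtrans_has_derivative:
  "c \<in> A \<Longrightarrow> d \<in> A \<Longrightarrow> x \<in> overlap c d \<Longrightarrow> (transition c d has_derivative dtrans c d x) (at x)"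
  using smooth_on_has_derivative[OF smooth_trans] by blast

lemma dtrans_linear: "c \<in> A \<Longrightarrow> d \<in> A \<Longrightarrow> x \<in> overlap c d \<Longrightarrow> linear (dtrans c d x)"
  using has_derivative_linear[OF dtrans_has_derivative] by blast

lemma dtrans_id:
  assumes "c \<in> A" "x \<in> cimg c"
  shows "dtrans c c x u = u"
proof -
  have "(transition c c has_derivative (\<lambda>u. u)) (at x)"
    by (rule has_derivative_transform_within_open[OF has_derivative_ident open_cimg[OF assms(1)]
        assms(2)])
      (simp add: transition_def chart_map_inv)
  from frechet_derivative_at[OF this] show ?thesis by metis
qed

lemma dtrans_cocycle:
  assumes c: "c \<in> A" "d \<in> A" "e \<in> A" and p: "p \<in> chart_dom c" "p \<in> chart_dom d" "p \<in> chart_dom e"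
  shows "dtrans d e (chart_map d p) (dtrans c d (chart_map c p) u) = dtrans c e (chart_map c p) u"
proof -
  have x: "chart_map c p \<in> overlap c d \<inter> overlap c e" using p by (simp add: overlap_mem)
  have 1: "(transition c d has_derivative dtrans c d (chart_map c p)) (at (chart_map c p))"
    using c x by (simp add: dtrans_has_derivative)
  have 2: "(transition d e has_derivative dtrans d e (chart_map d p)) (at (transition c d (chart_map c
      p)))"
    using dtrans_has_derivative[OF c(2,3)] overlap_mem[OF p(2,3)] transition_map[OF c(1) p(1)] by simp
  have "(transition c e has_derivative (\<lambda>u. dtrans d e (chart_map d p) (dtrans c d (chart_map c p) u)))
      (at (chart_map c p))"
  proof (rule has_derivative_transform_within_open[OF has_derivative_compose[OF 1 2]])
    show "open (overlap c d \<inter> overlap c e)" using open_overlap c by blast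
    show "chart_map c p \<in> overlap c d \<inter> overlap c e" by (rule x)
    show "transition d e (transition c d y) = transition c e y" if y: "y \<in> overlap c d \<inter> overlap c e"
        for y
    proof -
      obtain q where "q \<in> chart_dom c" "q \<in> chart_dom d" "y = chart_map c q"
        using y unfolding overlap_def by auto
      then show ?thesis using c by (simp add: transition_map)
    qed
  qed
  from frechet_derivative_at[OF this] show ?thesis by metis
qed

lemma dtrans_surj:
  assumes c: "c \<in> A" "d \<in> A" and x: "x \<in> overlap c d"
  shows "surj (dtrans c d x)"
proof -
  obtain p where p: "p \<in> chart_dom c" "p \<in> chart_dom d" "x = chart_map c p"
    using x unfolding overlap_def by auto
  have "dtrans c d x (dtrans d c (chart_map d p) u) = u" for u
    unfolding p(3) using dtrans_cocycle[OF c(2,1,2) p(2,1,2)] dtrans_id[OF c(2) cimg_mem[OF p(2)]]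
        by simp
  then show ?thesis by (rule surjI)
qed

lemma coord_vec_tangent: "c \<in> A \<Longrightarrow> p \<in> chart_dom c \<Longrightarrow> coord_vec A c p u \<in> tangent_space A p"
  unfolding tangent_space_iff coord_vec_eq by (auto simp: dtrans_cocycle)

lemma coord_vec_self: "c \<in> A \<Longrightarrow> p \<in> chart_dom c \<Longrightarrow> coord_vec A c p u c = u"
  unfolding coord_vec_eq by (simp add: dtrans_id cimg_mem)

lemma tangent_space_eqI:
  assumes "v \<in> tangent_space A p" "w \<in> tangent_space A p" "c \<in> A" "p \<in> chart_dom c" "v c = w c"
  shows "v = w"
proof
  fix d
  show "v d = w d"
  proof (cases "d \<in> A \<and> p \<in> chart_dom d")
    case True
    then have "v d = dtrans c d (chart_map c p) (v c)" "w d = dtrans c d (chart_map c p) (w c)"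
      using assms(1-4) unfolding tangent_space_iff by blast+
    then show ?thesis using assms(5) by simp
  next
    case False
    then have "v d = 0" "w d = 0" using assms(1,2) unfolding tangent_space_iff by blast+
    then show ?thesis by simp
  qed
qed

lemma coord_vec_change:
  "c \<in> A \<Longrightarrow> d \<in> A \<Longrightarrow> p \<in> chart_dom c \<Longrightarrow> p \<in> chart_dom d \<Longrightarrow>
    coord_vec A d p (dtrans c d (chart_map c p) u) = coord_vec A c p u"
  by (rule tangent_space_eqI[OF coord_vec_tangent coord_vec_tangent, of d p c d])
    (auto simp: coord_vec_self, simp add: coord_vec_eq)

lemma metric_in_eq:
  "c \<in> A \<Longrightarrow> p \<in> chart_dom c \<Longrightarrow>
    metric_in A g c (chart_map c p) u w = g p (coord_vec A c p u) (coord_vec A c p w)"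
  unfolding metric_in_def by (simp add: chart_inv_map)

lemma metric_in_change:
  assumes "c \<in> A" "d \<in> A" "x \<in> overlap c d"
  shows "metric_in A g c x u w = metric_in A g d (transition c d x) (dtrans c d x u) (dtrans c d x w)"
proof -
  obtain p where p: "p \<in> chart_dom c" "p \<in> chart_dom d" "x = chart_map c p"
    using assms(3) unfolding overlap_def by auto
  show ?thesis unfolding p(3) transition_map[OF assms(1) p(1)]
    using assms p(1,2) by (simp add: metric_in_eq coord_vec_change)
qed

lemma tchart_inj:
  assumes "c \<in> A"
  shows "inj_on (chart_map (tangent_chart A c)) (chart_dom (tangent_chart A c))"
proof (rule inj_onI)
  fix P Q assume P: "P \<in> chart_dom (tangent_chart A c)" and Q: "Q \<in> chart_dom (tangent_chart A c)"
    and eq: "chart_map (tangent_chart A c) P = chart_map (tangent_chart A c) Q"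
  have 1: "fst P = fst Q" using eq P Q chart_inj[OF assms] unfolding tchart_map tchart_dom
      by (auto dest: inj_onD)
  then have "snd P = snd Q"
    using eq P Q tangent_space_eqI[of "snd P" "fst P" "snd Q" c] assms unfolding tchart_map tchart_dom
        by auto
  with 1 show "P = Q" by (simp add: prod_eq_iff)
qed

lemma tchart_inv:
  assumes "c \<in> A" "p \<in> chart_dom c"
  shows "chart_inv (tangent_chart A c) (chart_map c p, \<xi>) = (p, coord_vec A c p \<xi>)"
proof -
  have "(p, coord_vec A c p \<xi>) \<in> chart_dom (tangent_chart A c)"
    using assms by (simp add: tchart_dom coord_vec_tangent)
  moreover have "chart_map (tangent_chart A c) (p, coord_vec A c p \<xi>) = (chart_map c p, \<xi>)"
    using assms by (simp add: tchart_map coord_vec_self)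
  ultimately show ?thesis unfolding chart_inv_def using tchart_inj[OF assms(1)] by (metis inv_into_f_f)
qed

lemma tchart_trans:
  assumes "c \<in> A" "d \<in> A" "fst y \<in> overlap c d"
  shows "transition (tangent_chart A c) (tangent_chart A d) y =
      (transition c d (fst y), dtrans c d (fst y) (snd y))"
proof -
  obtain p where p: "p \<in> chart_dom c" "p \<in> chart_dom d" "fst y = chart_map c p"
    using assms(3) unfolding overlap_def by auto
  have "chart_inv (tangent_chart A c) y = (p, coord_vec A c p (snd y))"
    using tchart_inv[OF assms(1) p(1), of "snd y"] by (simp add: p(3)[symmetric])
  then show ?thesis using assms p by (simp add: transition_def tchart_map chart_inv_map coord_vec_eq)
qed

lemma ddtrans_has_derivative:
  "c \<in> A \<Longrightarrow> d \<in> A \<Longrightarrow> x \<in> overlap c d \<Longrightarrow> ((\<lambda>y. dtrans c d y v) has_derivative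
      (\<lambda>u. ddtrans c d x u v)) (at x)"
  unfolding ddtrans_def using smooth_on_has_derivative[OF smooth_on_frechet[OF smooth_trans]] by simp

text \<open>The second component of a coordinate change of the tangent bundle is linear in the fibre
  with coefficients that depend on the base point, hence the second derivative.\<close>

lemma dtchart_trans:
  assumes c: "c \<in> A" "d \<in> A" and y: "fst y \<in> overlap c d"
  shows "dtrans (tangent_chart A c) (tangent_chart A d) y U =
    (dtrans c d (fst y) (fst U), ddtrans c d (fst y) (fst U) (snd y) + dtrans c d (fst y) (snd U))"
proof -
  have o: "open (overlap c d \<times> (UNIV :: 'e set))" using open_overlap[OF c] by (intro open_Times) auto
  have yo: "y \<in> overlap c d \<times> UNIV" using y by (simp add: mem_Times_iff)
  have f: "(fst has_derivative fst) (at y)" "(snd has_derivative snd) (at y)"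
    by (auto intro!: derivative_eq_intros)
  have 1: "((\<lambda>y. transition c d (fst y)) has_derivative (\<lambda>U. dtrans c d (fst y) (fst U))) (at y)"
    by (rule has_derivative_compose[where f=fst and x=y, OF f(1) dtrans_has_derivative[OF c y]])
  have 2: "((\<lambda>y. dtrans c d (fst y) (snd y)) has_derivative
     (\<lambda>U. ddtrans c d (fst y) (fst U) (snd y) + dtrans c d (fst y) (snd U))) (at y)"
  proof (rule has_derivative_linear_family[OF o yo _ _ f(2)])
    show "linear (dtrans c d (fst z))" if "z \<in> overlap c d \<times> UNIV" for z
      using that dtrans_linear[OF c] by auto
    show "((\<lambda>y. dtrans c d (fst y) u) has_derivative (\<lambda>v. ddtrans c d (fst y) (fst v) u)) (at y)" for u
      by (rule has_derivative_compose[where f=fst and x=y, OF f(1) ddtrans_has_derivative[OF c y]])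
  qed
  have "(transition (tangent_chart A c) (tangent_chart A d) has_derivative
     (\<lambda>U. (dtrans c d (fst y) (fst U), ddtrans c d (fst y) (fst U) (snd y) +
         dtrans c d (fst y) (snd U)))) (at y)"
    by (rule has_derivative_transform_within_open[OF has_derivative_Pair[OF 1 2] o yo])
      (simp add: tchart_trans[OF c] mem_Times_iff)
  from fun_cong[OF frechet_derivative_at[OF this], of U] show ?thesis by (rule sym)
qed

end

section \<open>The Sasaki metric in induced charts\<close>

context
  fixes A :: "('a, real^2) chart set" and g :: "('a, real^2) metric_tensor"
  assumes Ag: "riemannian_manifold A g"
begin

lemma A_atlas: "smooth_atlas A" using Ag by (simp add: riemannian_manifold_def)

lemma chart_riem_metric: "c \<in> A \<Longrightarrow> riem_metric (cimg c) (metric_in A g c)"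
  using Ag open_cimg[OF A_atlas] unfolding riemannian_manifold_def riem_metric_def pd_form_def cimg_def
      by blast

lemma chart_const_curv: "constant_curvature A g K \<Longrightarrow> c \<in> A \<Longrightarrow> const_curv (cimg c) (metric_in A g c) K"
  unfolding constant_curvature_def const_curv_def cimg_def sectional_curvature_def curvature_eq_curv
      by simp

text \<open>Two coordinate expressions of one metric are isometric under the coordinate change.\<close>

lemma christoffel_change:
  assumes c: "c \<in> A" "d \<in> A" and x: "x \<in> overlap c d"
  shows "dtrans c d x (chr (metric_in A g c) x u v) =
     ddtrans c d x u v + chr (metric_in A g d) (transition c d x) (dtrans c d x u) (dtrans c d x v)"
  unfolding ddtrans_def
proof (rule chr_transform[OF chart_riem_metric[OF c(1)] chart_riem_metric[OF c(2)]
        open_overlap[OF A_atlas c] overlap_subset x smooth_trans[OF A_atlas c]])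
  show "transition c d ` overlap c d \<subseteq> cimg d"
  proof
    fix y assume "y \<in> transition c d ` overlap c d"
    then obtain z where "z \<in> overlap c d" "y = transition c d z" by auto
    then show "y \<in> cimg d"
      using transition_in[OF A_atlas c(1), of z d] overlap_subset[of d c] by auto
  qed
qed (rule metric_in_change[OF A_atlas c], assumption, rule dtrans_surj[OF A_atlas c x])

text \<open>The metric is evaluated on whole families of components, so the components of the horizontal
  and of the vertical part have to be compared in all charts. For the vertical part the second
  derivative of the coordinate change, which enters through \<open>dtchart_trans\<close>, cancels with the one
  in \<open>christoffel_change\<close>.\<close>

lemma sasaki_in_chart:
  assumes c: "c \<in> A" and y: "fst y \<in> cimg c"
  shows "metric_in (tangent_bundle A) (sasaki A g) (tangent_chart A c) y = sas (metric_in A g c) y"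
proof (intro ext)
  fix U V :: "(real^2) \<times> (real^2)"
  obtain p where p: "p \<in> chart_dom c" "fst y = chart_map c p" using y unfolding cimg_def by auto
  define Q where "Q = (p, coord_vec A c p (snd y))"
  have inv: "chart_inv (tangent_chart A c) y = Q"
    using tchart_inv[OF A_atlas c p(1), of "snd y"] by (simp add: p(2)[symmetric] Q_def)
  have Qc: "chart_map (tangent_chart A c) Q = y"
    unfolding Q_def tchart_map using c p by (simp add: coord_vec_self[OF A_atlas] prod_eq_iff)
  define X where "X U = coord_vec (tangent_bundle A) (tangent_chart A c) Q U" for U
  have X: "X U (tangent_chart A d) =
     (dtrans c d (fst y) (fst U), ddtrans c d (fst y) (fst U) (snd y) + dtrans c d (fst y) (snd U))"
    if d: "d \<in> A" "p \<in> chart_dom d" for d U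
  proof -
    have "tangent_chart A d \<in> tangent_bundle A" using d by (simp add: tangent_bundle_def)
    moreover have "Q \<in> chart_dom (tangent_chart A d)"
      using d c p by (simp add: tchart_dom Q_def coord_vec_tangent[OF A_atlas])
    ultimately have "X U (tangent_chart A d) = dtrans (tangent_chart A c) (tangent_chart A d) y U"
      unfolding X_def coord_vec_def Qc transition_def by simp
    also have "fst y \<in> overlap c d" unfolding p(2) using overlap_mem[OF p(1) d(2)] .
    note dtchart_trans[OF A_atlas c d(1) this]
    finally show ?thesis .
  qed
  have proj: "proj_star A Q (X U) = coord_vec A c p (fst U)" for U
    unfolding proj_star_def coord_vec_eq by (auto simp: Q_def X p(2))
  have conn: "connection_map A g Q (X U) = coord_vec A c p (vert (metric_in A g c) y U)" for U
  proof
    fix d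
    show "connection_map A g Q (X U) d = coord_vec A c p (vert (metric_in A g c) y U) d"
    proof (cases "d \<in> A \<and> p \<in> chart_dom d")
      case True
      then have o: "fst y \<in> overlap c d" unfolding p(2) using overlap_mem[OF p(1)] by blast
      have ddsym: "ddtrans c d (fst y) (fst U) (snd y) = ddtrans c d (fst y) (snd y) (fst U)"
        unfolding ddtrans_def using True c o
        by (intro symmetric_second_derivative[OF open_overlap[OF A_atlas] smooth_trans[OF A_atlas]])
            auto
      have tr: "chart_map d p = transition c d (fst y)" unfolding p(2)
          using transition_map[OF A_atlas c p(1)] by simp
      have vd: "coord_vec A c p (snd y) d = dtrans c d (fst y) (snd y)"
        using True by (simp add: coord_vec_eq p(2))
      have "connection_map A g Q (X U) d = ddtrans c d (fst y) (fst U) (snd y) +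
          dtrans c d (fst y) (snd U) +
         chr (metric_in A g d) (transition c d (fst y)) (dtrans c d (fst y) (snd y)) (dtrans c d (fst y)
             (fst U))"
        using True unfolding connection_map_def
            by (simp add: X) (simp add: Q_def tr vd christoffel_eq_chr)
      also have "\<dots> = dtrans c d (fst y) (snd U) +
          dtrans c d (fst y) (chr (metric_in A g c) (fst y) (snd y) (fst U))"
        using christoffel_change[OF c _ o, of "snd y" "fst U"] True ddsym by simp
      also have "\<dots> = dtrans c d (fst y) (vert (metric_in A g c) y U)"
        unfolding vert_def using linear_add[OF dtrans_linear[OF A_atlas c _ o]] True by simp
      finally show ?thesis using True by (simp add: coord_vec_eq p(2))
    qed (auto simp: connection_map_def coord_vec_eq Q_def)
  qed
  have "metric_in (tangent_bundle A) (sasaki A g) (tangent_chart A c) y U V = sasaki A g Q (X U) (X V)"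
    unfolding metric_in_def inv X_def ..
  also have "\<dots> = sas (metric_in A g c) y U V"
    unfolding sasaki_def proj conn sas_def
    by (simp add: Q_def p(2) metric_in_eq[OF A_atlas c p(1)])
  finally show "metric_in (tangent_bundle A) (sasaki A g) (tangent_chart A c) y U V =
      sas (metric_in A g c) y U V" .
qed

lemma sasaki_christoffel:
  assumes c: "c \<in> A" and y: "fst y \<in> cimg c"
  shows "christoffel (tangent_bundle A) (sasaki A g) (tangent_chart A c) y =
      chr (sas (metric_in A g c)) y"
  unfolding christoffel_eq_chr
proof (rule chr_cong)
  show "open (cimg c \<times> (UNIV :: (real^2) set))" using open_cimg[OF A_atlas c] by (intro open_Times) auto
qed (use y sasaki_in_chart[OF c] in \<open>auto simp: mem_Times_iff\<close>)

end

text \<open>The description by \<open>THE\<close> denotes the normal component of \<open>w\<close>, because the pulled back inner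
  product on the domain of \<open>L\<close> yields an orthogonal projection to the range of \<open>L\<close>.\<close>

lemma tangent_of_zero_normal_part:
  fixes L :: "'f::euclidean_space \<Rightarrow> 'e::euclidean_space"
  assumes B: "pd_form B" and L: "linear L" "inj L"
    and 0: "(THE n. w - n \<in> range L \<and> (\<forall>z. B n (L z) = 0)) = 0"
  shows "\<exists>u. w = L u"
proof -
  have "pd_form (\<lambda>u v. B (L u) (L v))"
    unfolding pd_form_def bilinear_def
  proof (intro conjI allI impI linearI)
    show "B (L u) (L u) > 0" if "u \<noteq> 0" for u
      using that pd_formD(3)[OF B] L by (metis linear_injective_0)
  qed (simp_all add: linear_add[OF L(1)] linear_cmul[OF L(1)] pd_form_simps[OF B] pd_formD(2)[OF B])
  moreover have "linear (\<lambda>z. B w (L z))"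
    by (rule linearI) (simp_all add: linear_add[OF L(1)] linear_cmul[OF L(1)] pd_form_simps[OF B])
  ultimately obtain u where u: "\<And>z. B (L u) (L z) = B w (L z)" using pd_form_riesz by blast
  have "(THE n. w - n \<in> range L \<and> (\<forall>z. B n (L z) = 0)) = w - L u"
  proof (rule the_equality)
    show "w - (w - L u) \<in> range L \<and> (\<forall>z. B (w - L u) (L z) = 0)"
      by (simp add: pd_form_simps[OF B] u)
    fix n assume n: "w - n \<in> range L \<and> (\<forall>z. B n (L z) = 0)"
    then obtain v where v: "w - n = L v" by auto
    then have "n = w - L v" by (simp add: algebra_simps)
    then have "B (L v) (L z) = B (L u) (L z)" for z using n by (simp add: pd_form_simps[OF B] u)
    then have "B (L v - L u) (L v - L u) = 0"
      by (simp add: pd_form_simps[OF B])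
    then have "L v - L u = 0" using pd_formD(3)[OF B] by (metis less_irrefl)
    then show "n = w - L u" using \<open>n = w - L v\<close> by simp
  qed
  then show ?thesis using 0 by (metis eq_iff_diff_eq_0)
qed

section \<open>Totally geodesic surfaces in an orthonormal frame\<close>

text \<open>A local parametrisation of a totally geodesic surface in the tangent bundle: the ambient
  covariant derivatives of the coordinate fields are tangent.\<close>

definition tg_immersion ::
    "(real^2) set \<Rightarrow> (real^2 \<Rightarrow> real^2 \<Rightarrow> real^2 \<Rightarrow> real) \<Rightarrow> (real^2) set \<Rightarrow> (real^2 \<Rightarrow> (real^2) \<times> (real^2)) \<Rightarrow>
        bool" where
  "tg_immersion X G W r \<longleftrightarrow> riem_metric X G \<and> open W \<and> smooth_on W r \<and> r ` W \<subseteq> X \<times> UNIV \<and>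
     (\<forall>y\<in>W. inj (frechet_derivative r (at y))) \<and>
     (\<forall>y\<in>W. \<forall>u v. \<exists>w. frechet_derivative r (at y) w =
        frechet_derivative (\<lambda>y'. frechet_derivative r (at y') u) (at y) v +
        chr (sas G) (r y) (frechet_derivative r (at y) v) (frechet_derivative r (at y) u))"

text \<open>The equations of a totally geodesic surface. The linear maps \<open>a y\<close> and \<open>b y\<close> are the
  horizontal and the vertical part of the differential and \<open>\<xi>\<close> is the position in the fibre, all
  expressed as complex numbers in an orthonormal frame of the base with connection form \<open>\<phi>\<close>; the
  vectors \<open>\<Lambda> y u v\<close> are the Christoffel symbols of the surface. The terms with \<open>K\<close> are the
  curvature terms of \<open>sas_chr\<close>: the curvature operator of \<open>p\<close> and \<open>q\<close> is multiplication by \<open>- \<i> *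
  K * Im (cnj p * q)\<close>.\<close>

definition tg_system ::
    "(real^2) set \<Rightarrow> real \<Rightarrow> (real^2 \<Rightarrow> real^2 \<Rightarrow> complex) \<Rightarrow> (real^2 \<Rightarrow> real^2 \<Rightarrow> complex) \<Rightarrow> (real^2 \<Rightarrow>
        complex) \<Rightarrow>
     (real^2 \<Rightarrow> real^2 \<Rightarrow> real) \<Rightarrow> (real^2 \<Rightarrow> real^2 \<Rightarrow> real^2 \<Rightarrow> real^2) \<Rightarrow> bool" where
  "tg_system W K a b \<xi> \<phi> \<Lambda> \<longleftrightarrow> open W \<and>
     (\<forall>u. smooth_on W (\<lambda>y. a y u)) \<and> (\<forall>u. smooth_on W (\<lambda>y. b y u)) \<and> smooth_on W \<xi> \<and>
     (\<forall>y\<in>W. linear (a y) \<and> linear (b y) \<and> (\<forall>u. a y u = 0 \<and> b y u = 0 \<longrightarrow> u = 0) \<and>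
       (\<forall>u v. \<Lambda> y u v = \<Lambda> y v u) \<and>
       (\<forall>u. ((\<lambda>y. a y u) has_derivative (\<lambda>v. a y (\<Lambda> y u v)
          + \<i> * of_real (K / 2 * Im (cnj (\<xi> y) * b y u)) * a y v
          + \<i> * of_real (K / 2 * Im (cnj (\<xi> y) * b y v)) * a y u - \<i> * of_real (\<phi> y v) *
              a y u)) (at y)) \<and>
       (\<forall>u. ((\<lambda>y. b y u) has_derivative (\<lambda>v. b y (\<Lambda> y u v)
          - \<i> * of_real (K / 2 * Im (cnj (a y v) * a y u)) * \<xi> y - \<i> * of_real (\<phi> y v) *
              b y u)) (at y)) \<and>
       (\<xi> has_derivative (\<lambda>v. b y v - \<i> * of_real (\<phi> y v) * \<xi> y)) (at y))"

definition frame_comp :: "(real^2 \<Rightarrow> real^2 \<Rightarrow> real^2 \<Rightarrow> real) \<Rightarrow> (real^2 \<Rightarrow> real^2) \<Rightarrow> (real^2 \<Rightarrow> real^2) \<Rightarrow>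
    real^2 \<Rightarrow> real^2 \<Rightarrow> complex"
  where "frame_comp G E F x p = Complex (G x p (E x)) (G x p (F x))"

definition orthonormal_frame where
  "orthonormal_frame X G E F \<longleftrightarrow> smooth_on X E \<and> smooth_on X F \<and>
     (\<forall>x\<in>X. G x (E x) (E x) = 1 \<and> G x (F x) (F x) = 1 \<and> G x (E x) (F x) = 0)"
  for G :: "real^2 \<Rightarrow> real^2 \<Rightarrow> real^2 \<Rightarrow> real"

lemma has_derivative_Complex:
  assumes "(p has_derivative p') (at y)" "(q has_derivative q') (at y)"
  shows "((\<lambda>y. Complex (p y) (q y)) has_derivative (\<lambda>v. Complex (p' v) (q' v))) (at y)"
proof -
  have "((\<lambda>y. of_real (p y) + \<i> * of_real (q y)) has_derivative
      (\<lambda>v. of_real (p' v) + \<i> * of_real (q' v))) (at y)"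
    by (intro has_derivative_add has_derivative_of_real has_derivative_mult_right assms)
  then show ?thesis by (simp add: Complex_eq)
qed

lemma smooth_horizontal_vertical:
  assumes tg: "tg_immersion X G W r"
  shows "smooth_on W (\<lambda>y. fst (frechet_derivative r (at y) u))"
    "smooth_on W (\<lambda>y. vert G (r y) (frechet_derivative r (at y) u))"
proof -
  have XG: "riem_metric X G" and W: "open W" and r: "smooth_on W r" and rX: "\<And>y. y \<in> W \<Longrightarrow> fst (r y) \<in> X"
    using tg unfolding tg_immersion_def by auto
  have smD: "smooth_on W (\<lambda>y. frechet_derivative r (at y) u)" by (rule smooth_on_frechet[OF r])
  show smh: "smooth_on W (\<lambda>y. fst (frechet_derivative r (at y) u))" by (rule smooth_on_fst[OF W smD])
  have smx: "smooth_on W (\<lambda>y. fst (r y))" by (rule smooth_on_fst[OF W r])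
  have xW: "(\<lambda>y. fst (r y)) ` W \<subseteq> X" using rX by auto
  have "smooth_on W (\<lambda>y. chr G (fst (r y)) (snd (r y)) (fst (frechet_derivative r (at y) u)))"
  proof (rule smooth_on_bilinear_family[OF W, where B="\<lambda>y. chr G (fst (r y))" and p="\<lambda>y. snd (r y)"])
    show "bilinear (chr G (fst (r y)))" if "y \<in> W" for y by (rule chr_bilinear[OF XG rX[OF that]])
    show "smooth_on W (\<lambda>y. chr G (fst (r y)) p q)" for p q
      by (rule smooth_on_compose[OF W open_X[OF XG] smx smooth_chr[OF XG] xW])
  qed (rule smooth_on_snd[OF W r], rule smh)
  then show "smooth_on W (\<lambda>y. vert G (r y) (frechet_derivative r (at y) u))"
    unfolding vert_def by (intro smooth_on_add smooth_on_snd W smD)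
qed

context
  fixes X :: "(real^2) set" and G E F
  assumes XG: "riem_metric X G" and EF: "orthonormal_frame X G E F"
begin

lemma frame_metric:
  assumes x: "x \<in> X"
  shows "G x p q = Re (frame_comp G E F x p) * Re (frame_comp G E F x q) +
     Im (frame_comp G E F x p) * Im (frame_comp G E F x q)"
proof -
  have e: "G x (E x) (E x) = 1" "G x (F x) (F x) = 1" "G x (E x) (F x) = 0"
    using EF x by (auto simp: orthonormal_frame_def)
  have fe: "G x (F x) (E x) = 0" using e(3) pd_formD(2)[OF pd_G[OF XG x]] by metis
  have "G x p q = G x (G x (E x) p *\<^sub>R E x + G x (F x) p *\<^sub>R F x) (G x (E x) q *\<^sub>R E x +
      G x (F x) q *\<^sub>R F x)"
    using orthonormal_expand[OF pd_G[OF XG x] e] by metis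
  also have "\<dots> = G x (E x) p * G x (E x) q + G x (F x) p * G x (F x) q"
    by (simp add: G_simps[OF XG x] e fe)
  finally show ?thesis
    unfolding frame_comp_def by (simp add: pd_formD(2)[OF pd_G[OF XG x], of _ "E x"] pd_formD(2)[OF
        pd_G[OF XG x], of _ "F x"])
qed

lemma frame_comp_frame:
  assumes x: "x \<in> X"
  shows "frame_comp G E F x (E x) = 1" "frame_comp G E F x (F x) = \<i>"
  using EF x pd_formD(2)[OF pd_G[OF XG x], of "F x" "E x"]
  unfolding frame_comp_def orthonormal_frame_def by (auto simp: complex_eq_iff)

lemma frame_comp_linear:
  assumes x: "x \<in> X"
  shows "linear (frame_comp G E F x)"
  unfolding frame_comp_def
  by (rule linearI) (simp_all add: G_simps[OF XG x] complex_eq_iff)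

lemma frame_comp_inj:
  assumes x: "x \<in> X" and "frame_comp G E F x p = 0"
  shows "p = 0"
  using frame_metric[OF x, of p p] assms(2) pd_formD(3)[OF pd_G[OF XG x], of p] by auto

text \<open>The angular velocity of the frame in direction \<open>z\<close>.\<close>

definition conn_form :: "real^2 \<Rightarrow> real^2 \<Rightarrow> real" where
  "conn_form x z = G x (frechet_derivative E (at x) z + chr G x z (E x)) (F x)"

text \<open>The derivative of an orthonormal frame is a rotation, whose angular velocity is the
  connection form.\<close>

lemma frame_comp_has_derivative:
  assumes x: "f y \<in> X" "(f has_derivative f') (at y)" and p: "(p has_derivative p') (at y)"
  shows "((\<lambda>y. frame_comp G E F (f y) (p y)) has_derivative
     (\<lambda>v. frame_comp G E F (f y) (p' v + chr G (f y) (f' v) (p y)) -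
       \<i> * of_real (conn_form (f y) (f' v)) * frame_comp G E F (f y) (p y))) (at y)"
proof -
  let ?x = "f y"
  note Gs = G_simps[OF XG x(1)] and sym = pd_formD(2)[OF pd_G[OF XG x(1)]]
  have e: "G x (E x) (E x) = 1" "G x (F x) (F x) = 1" "G x (E x) (F x) = 0" if "x \<in> X" for x
    using EF that by (auto simp: orthonormal_frame_def)
  define dE where "dE z = frechet_derivative E (at ?x) z + chr G ?x z (E ?x)" for z
  define dF where "dF z = frechet_derivative F (at ?x) z + chr G ?x z (F ?x)" for z
  have Eder: "(E has_derivative frechet_derivative E (at ?x)) (at ?x)"
    and Fder: "(F has_derivative frechet_derivative F (at ?x)) (at ?x)"
    using EF x by (auto simp: orthonormal_frame_def intro: smooth_on_has_derivative)
  have const: "L z = 0" if "(h has_derivative L) (at ?x)" "\<And>x. x \<in> X \<Longrightarrow> h x = c" for h L z and c :: real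
  proof -
    have "(h has_derivative (\<lambda>z. 0)) (at ?x)"
      by (rule has_derivative_transform_within_open[OF has_derivative_const[of c] open_X[OF XG] x(1)])
        (simp add: that(2))
    from has_derivative_unique[OF this that(1)] show ?thesis by metis
  qed
  note der = G_has_derivative[where f="\<lambda>y. y" and y="?x", OF XG x(1) has_derivative_ident]
  have EE: "G ?x (dE z) (E ?x) + G ?x (E ?x) (dE z) = 0" for z
    unfolding dE_def by (rule const[OF der[OF Eder Eder] e(1)])
  have FF: "G ?x (dF z) (F ?x) + G ?x (F ?x) (dF z) = 0" for z
    unfolding dF_def by (rule const[OF der[OF Fder Fder] e(2)])
  have EF0: "G ?x (dE z) (F ?x) + G ?x (E ?x) (dF z) = 0" for z
    unfolding dE_def dF_def by (rule const[OF der[OF Eder Fder] e(3)])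
  have dEf: "frame_comp G E F ?x (dE z) = \<i> * of_real (conn_form ?x z)" for z
    using EE[of z] sym[of "dE z" "E ?x"] unfolding frame_comp_def conn_form_def dE_def[symmetric]
    by (simp add: complex_eq_iff)
  have dFf: "frame_comp G E F ?x (dF z) = - of_real (conn_form ?x z)" for z
    using FF[of z] EF0[of z] sym[of "dF z" "E ?x"] sym[of "dF z" "F ?x"]
    unfolding frame_comp_def conn_form_def dE_def[symmetric]
    by (simp add: complex_eq_iff)
  have dEy: "((\<lambda>y. E (f y)) has_derivative (\<lambda>v. frechet_derivative E (at ?x) (f' v))) (at y)"
    by (rule has_derivative_compose[OF x(2) Eder])
  have dFy: "((\<lambda>y. F (f y)) has_derivative (\<lambda>v. frechet_derivative F (at ?x) (f' v))) (at y)"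
    by (rule has_derivative_compose[OF x(2) Fder])
  have "((\<lambda>y. frame_comp G E F (f y) (p y)) has_derivative
    (\<lambda>v. Complex (G ?x (p' v + chr G ?x (f' v) (p y)) (E ?x) + G ?x (p y) (dE (f' v)))
         (G ?x (p' v + chr G ?x (f' v) (p y)) (F ?x) + G ?x (p y) (dF (f' v))))) (at y)"
    unfolding frame_comp_def dE_def dF_def
    by (intro has_derivative_Complex G_has_derivative[where f=f and y=y, OF XG x p] dEy dFy)
  then show ?thesis
    by (rule has_derivative_eq_rhs)
      (simp add: fun_eq_iff complex_eq_iff frame_metric[OF x(1), of "p y"] dEf dFf, simp add:
          frame_comp_def)
qed

lemma smooth_frame_comp:
  assumes "open W" "smooth_on W f" "f ` W \<subseteq> X" "smooth_on W p"
  shows "smooth_on W (\<lambda>y. frame_comp G E F (f y) (p y))"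
proof -
  have sE: "smooth_on W (\<lambda>y. E (f y))" "smooth_on W (\<lambda>y. F (f y))"
    using EF by (auto simp: orthonormal_frame_def intro!: smooth_on_compose[OF assms(1) open_X[OF XG]
        assms(2) _ assms(3)])
  have Gq: "smooth_on W (\<lambda>y. G (f y) (p y) (q y))" if "smooth_on W q" for q
  proof (rule smooth_on_bilinear_family[OF assms(1) _ _ assms(4) that])
    show "bilinear (G (f y))" if "y \<in> W" for y using that assms(3) pd_formD(1)[OF pd_G[OF XG]] by blast
    show "smooth_on W (\<lambda>x. G (f x) u w)" for u w
      by (rule smooth_on_compose[OF assms(1) open_X[OF XG] assms(2) smooth_G[OF XG] assms(3)])
  qed
  have "smooth_on W (\<lambda>y. G (f y) (p y) (E (f y)) *\<^sub>R 1 + G (f y) (p y) (F (f y)) *\<^sub>R \<i>)"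
    by (intro smooth_on_add smooth_on_scaleR smooth_on_const assms(1) sE Gq)
  moreover have "(\<lambda>y. G (f y) (p y) (E (f y)) *\<^sub>R 1 + G (f y) (p y) (F (f y)) *\<^sub>R \<i>) =
     (\<lambda>y. frame_comp G E F (f y) (p y))"
    by (auto simp: frame_comp_def complex_eq_iff)
  ultimately show ?thesis by simp
qed

text \<open>The tangency condition is tested against vectors \<open>Z\<close> with prescribed horizontal and vertical
  part. The two choices in which one part vanishes separate the equations for \<open>a\<close> and for \<open>b\<close>, and
  there \<open>sas_chr\<close> and \<open>const_curv_formula\<close> give the right-hand sides.\<close>

lemma tg_immersion_system:
  assumes tg: "tg_immersion X G W r" and K: "const_curv X G K"
  defines "D \<equiv> \<lambda>y. frechet_derivative r (at y)"
  defines "a \<equiv> \<lambda>y u. frame_comp G E F (fst (r y)) (fst (D y u))"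
    and "b \<equiv> \<lambda>y u. frame_comp G E F (fst (r y)) (vert G (r y) (D y u))"
    and "\<xi> \<equiv> \<lambda>y. frame_comp G E F (fst (r y)) (snd (r y))"
  shows "\<exists>\<Lambda>. tg_system W K a b \<xi> (\<lambda>y v. conn_form (fst (r y)) (fst (D y v))) \<Lambda>"
proof -
  have rX: "fst (r y) \<in> X" and Dinj: "inj (D y)" if "y \<in> W" for y
    using tg that unfolding tg_immersion_def D_def by auto
  have W: "open W" and r: "smooth_on W r" using tg unfolding tg_immersion_def by auto
  define DD where "DD y u v = frechet_derivative (\<lambda>y'. D y' u) (at y) v" for y u v
  have derD: "((\<lambda>y. D y u) has_derivative (\<lambda>v. DD y u v)) (at y)" if "y \<in> W" for y u
    unfolding DD_def D_def using smooth_on_has_derivative[OF smooth_on_frechet[OF r] that] by simp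
  have derr: "(r has_derivative D y) (at y)" if "y \<in> W" for y
    unfolding D_def by (rule smooth_on_has_derivative[OF r that])
  have linD: "linear (D y)" if "y \<in> W" for y using has_derivative_linear[OF derr[OF that]] .
  define \<Lambda> where "\<Lambda> y u v = (SOME w. D y w = DD y u v + chr (sas G) (r y) (D y v) (D y u))" for y u v
  have \<Lambda>: "D y (\<Lambda> y u v) = DD y u v + chr (sas G) (r y) (D y v) (D y u)" if "y \<in> W" for y u v
  proof -
    have "\<exists>w. D y w = DD y u v + chr (sas G) (r y) (D y v) (D y u)"
      using tg that unfolding tg_immersion_def D_def DD_def by blast
    then show ?thesis unfolding \<Lambda>_def by (rule someI_ex)
  qed
  have \<Lambda>sym: "\<Lambda> y u v = \<Lambda> y v u" if y: "y \<in> W" for y u v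
  proof (rule injD[OF Dinj[OF y]])
    have "r y \<in> X \<times> UNIV" using rX[OF y] by (simp add: mem_Times_iff)
    moreover have "DD y u v = DD y v u"
      unfolding DD_def D_def by (rule symmetric_second_derivative[OF W r y])
    ultimately show "D y (\<Lambda> y u v) = D y (\<Lambda> y v u)"
      unfolding \<Lambda>[OF y] using chr_sym[OF sas_riem_metric[OF XG]] by simp
  qed
  define x where "x y = fst (r y)" for y
  define hor where "hor y u = fst (D y u)" for y u
  define ver where "ver y u = vert G (r y) (D y u)" for y u
  have derx: "(x has_derivative (\<lambda>v. hor y v)) (at y)" if "y \<in> W" for y
    unfolding x_def hor_def by (rule has_derivative_fst[OF derr[OF that]])
  have derh: "((\<lambda>y. hor y u) has_derivative (\<lambda>v. fst (DD y u v))) (at y)" if "y \<in> W" for y u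
    unfolding hor_def by (rule has_derivative_fst[OF derD[OF that]])
  have ders: "((\<lambda>y. snd (r y)) has_derivative (\<lambda>v. snd (D y v))) (at y)" if "y \<in> W" for y
    by (rule has_derivative_snd[OF derr[OF that]])
  have xX: "x y \<in> X" if "y \<in> W" for y using rX[OF that] by (simp add: x_def)
  have derv: "((\<lambda>y. ver y u) has_derivative (\<lambda>v. vert G (r y) (DD y u v) +
      (dchr G (x y) (hor y v) (snd (r y)) (hor y u) + chr G (x y) (snd (D y v)) (hor y u)))) (at y)"
    if y: "y \<in> W" for y u
  proof -
    have "((\<lambda>y. vert G (r y) (D y u)) has_derivative (\<lambda>v.
       (dchr G (x y) (hor y v) (snd (r y)) (fst (D y u)) + chr G (x y) (snd (D y v)) (fst (D y u))) +
       vert G (r y) (DD y u v))) (at y)"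
    proof (rule has_derivative_linear_family[OF W y, where B="\<lambda>y. vert G (r y)" and
         B'="\<lambda>v V. dchr G (x y) (hor y v) (snd (r y)) (fst V) + chr G (x y) (snd (D y v)) (fst V)"])
      show "linear (vert G (r z))" if "z \<in> W" for z by (rule vert_linear[OF XG rX[OF that]])
      show "((\<lambda>y. vert G (r y) V) has_derivative
          (\<lambda>v. dchr G (x y) (hor y v) (snd (r y)) (fst V) +
          chr G (x y) (snd (D y v)) (fst V))) (at y)" for V
        unfolding x_def hor_def
        by (rule has_derivative_compose[OF derr[OF y] vert_has_derivative[OF XG rX[OF y]]])
      show "((\<lambda>y. D y u) has_derivative (\<lambda>v. DD y u v)) (at y)" by (rule derD[OF y])
    qed
    then show ?thesis unfolding ver_def hor_def by (simp add: add_ac)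
  qed
  have main: "G (x y) (hor y (\<Lambda> y u v)) z + G (x y) (ver y (\<Lambda> y u v)) w =
      G (x y) (fst (DD y u v) + chr G (x y) (hor y v) (hor y u)) z +
      G (x y) (vert G (r y) (DD y u v) + dvert G (r y) (D y v) (D y u) -
           (1/2) *\<^sub>R curv G (x y) (hor y v) (hor y u) (snd (r y))) w +
      (G (x y) (ver y u) (curv G (x y) (hor y v) z (snd (r y))) +
       G (x y) (ver y v) (curv G (x y) (hor y u) z (snd (r y)))) / 2"
    if y: "y \<in> W" for y u v z w
  proof -
    \<comment> \<open>\<open>Z\<close> has horizontal part \<open>z\<close> and vertical part \<open>w\<close>.\<close>
    define Z where "Z = (z, w - chr G (x y) (snd (r y)) z)"
    have Z: "fst Z = z" "vert G (r y) Z = w" unfolding Z_def vert_def x_def by auto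
    note sp = pd_form_simps[OF sas_pd_form[OF XG rX[OF y]]]
    have "sas G (r y) (D y (\<Lambda> y u v)) Z = sas G (r y) (DD y u v) Z +
        sas G (r y) (chr (sas G) (r y) (D y v) (D y u)) Z"
      unfolding \<Lambda>[OF y] by (rule sp)
    then show ?thesis
      unfolding sas_chr[OF XG rX[OF y]] unfolding sas_def Z
      by (simp add: hor_def ver_def x_def G_simps[OF XG rX[OF y]])
  qed
  define h where "h y p = frame_comp G E F (x y) p" for y p
  have hG: "G (x y) p q = Re (h y p) * Re (h y q) + Im (h y p) * Im (h y q)" if "y \<in> W" for y p q
    unfolding h_def by (rule frame_metric[OF xX[OF that]])
  have hE: "h y (E (x y)) = 1" "h y (F (x y)) = \<i>" if "y \<in> W" for y
    unfolding h_def by (rule frame_comp_frame[OF xX[OF that]])+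
  have hlin: "linear (h y)" if "y \<in> W" for y
    using frame_comp_linear[OF xX[OF that]] by (simp add: h_def[abs_def])
  have h0: "h y 0 = 0" if "y \<in> W" for y using linear_0[OF hlin[OF that]] .
  have curvf: "G (x y) (curv G (x y) p q w) z =
      K * (G (x y) q w * G (x y) p z - G (x y) p w * G (x y) q z)"
    if "y \<in> W" for y p q w z by (rule const_curv_formula[OF XG xX[OF that] K])
  have curvf': "G (x y) z (curv G (x y) p q w) =
      K * (G (x y) q w * G (x y) p z - G (x y) p w * G (x y) q z)"
    if "y \<in> W" for y p q w z using curvf[OF that] pd_formD(2)[OF pd_G[OF XG xX[OF that]]] by metis
  have a_eq: "a y u = h y (hor y u)" and b_eq: "b y u = h y (ver y u)" and \<xi>_eq: "\<xi> y = h y (snd (r y))"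
      for y u
    unfolding a_def b_def \<xi>_def h_def hor_def ver_def x_def by simp_all
  have horcov: "h y (fst (DD y u v) + chr G (x y) (hor y v) (hor y u)) = a y (\<Lambda> y u v)
          + \<i> * of_real (K / 2 * Im (cnj (\<xi> y) * b y u)) * a y v
          + \<i> * of_real (K / 2 * Im (cnj (\<xi> y) * b y v)) * a y u" if y: "y \<in> W" for y u v
    using main[OF y, of u v "E (x y)" 0] main[OF y, of u v "F (x y)" 0]
    unfolding curvf'[OF y] unfolding hG[OF y] hE[OF y] a_eq b_eq \<xi>_eq
    by (simp add: complex_eq_iff h0[OF y] field_simps)
  have curv0: "curv G (x y) p 0 w = 0" if "y \<in> W" for y p w
    using linear_0[OF curv_linear(2)[OF XG xX[OF that]]] .
  have vercov: "h y (vert G (r y) (DD y u v) + dvert G (r y) (D y v) (D y u)) = b y (\<Lambda> y u v)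
          - \<i> * of_real (K / 2 * Im (cnj (a y v) * a y u)) * \<xi> y" if y: "y \<in> W" for y u v
    using main[OF y, of u v 0 "E (x y)"] main[OF y, of u v 0 "F (x y)"]
    unfolding curv0[OF y] G_simps[OF XG xX[OF y]] curvf[OF y] unfolding hG[OF y] hE[OF y] a_eq b_eq \<xi>_eq
    by (simp add: complex_eq_iff h0[OF y] linear_add[OF hlin[OF y]] field_simps)
  have smx: "smooth_on W x" unfolding x_def by (rule smooth_on_fst[OF W r])
  have xW: "x ` W \<subseteq> X" using xX by auto
  have smD: "smooth_on W (\<lambda>y. D y u)" for u unfolding D_def by (rule smooth_on_frechet[OF r])
  have smver: "smooth_on W (\<lambda>y. ver y u)" for u
    unfolding ver_def D_def by (rule smooth_horizontal_vertical(2)[OF tg])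
  have "tg_system W K a b \<xi> (\<lambda>y v. conn_form (fst (r y)) (fst (D y v))) \<Lambda>"
    unfolding tg_system_def
  proof (intro conjI ballI allI impI W)
    show "smooth_on W (\<lambda>y. a y u)" for u
      unfolding a_eq h_def hor_def by (intro smooth_frame_comp W smx xW smooth_on_fst smD)
    show "smooth_on W (\<lambda>y. b y u)" for u
      unfolding b_eq h_def by (intro smooth_frame_comp W smx xW smver)
    show "smooth_on W \<xi>"
      unfolding \<xi>_def x_def[symmetric] by (intro smooth_frame_comp W smx xW smooth_on_snd r)
    fix y assume y: "y \<in> W"
    have vlin: "linear (vert G (r y))" by (rule vert_linear[OF XG rX[OF y]])
    show "linear (a y)" unfolding a_eq hor_def
      by (rule linearI) (simp_all add: linear_add[OF hlin[OF y]] linear_cmul[OF hlin[OF y]]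
          linear_add[OF linD[OF y]] linear_cmul[OF linD[OF y]])
    show "linear (b y)" unfolding b_eq ver_def
      by (rule linearI) (simp_all add: linear_add[OF hlin[OF y]] linear_cmul[OF hlin[OF y]]
          linear_add[OF linD[OF y]] linear_cmul[OF linD[OF y]]
         linear_add[OF vlin] linear_cmul[OF vlin])
    show "\<Lambda> y u v = \<Lambda> y v u" for u v by (rule \<Lambda>sym[OF y])
    show "u = 0" if "a y u = 0 \<and> b y u = 0" for u
    proof -
      have "hor y u = 0" "ver y u = 0"
        using that frame_comp_inj[OF xX[OF y]] unfolding a_eq b_eq h_def by auto
      then have "D y u = 0"
        using linear_0[OF chr_linear(1)[OF XG rX[OF y]]]
        unfolding hor_def ver_def vert_def by (simp add: prod_eq_iff)
      then show "u = 0" using Dinj[OF y] linD[OF y] by (metis linear_injective_0)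
    qed
    note der = frame_comp_has_derivative[where f=x and y=y, OF xX[OF y] derx[OF y]]
    show "((\<lambda>y. a y u) has_derivative (\<lambda>v. a y (\<Lambda> y u v)
          + \<i> * of_real (K / 2 * Im (cnj (\<xi> y) * b y u)) * a y v
          + \<i> * of_real (K / 2 * Im (cnj (\<xi> y) * b y v)) * a y u - \<i> *
              of_real (conn_form (fst (r y)) (fst (D y v))) * a y u)) (at y)" for u
      using der[OF derh[OF y], of u]
      unfolding h_def[symmetric] horcov[OF y] a_eq[symmetric] unfolding x_def hor_def .
    show "((\<lambda>y. b y u) has_derivative (\<lambda>v. b y (\<Lambda> y u v)
          - \<i> * of_real (K / 2 * Im (cnj (a y v) * a y u)) * \<xi> y - \<i> *
              of_real (conn_form (fst (r y)) (fst (D y v))) * b y u)) (at y)" for u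
    proof -
      have eq: "vert G (r y) (DD y u v) +
         (dchr G (x y) (hor y v) (snd (r y)) (hor y u) + chr G (x y) (snd (D y v)) (hor y u)) +
         chr G (x y) (hor y v) (ver y u) = vert G (r y) (DD y u v) +
             dvert G (r y) (D y v) (D y u)" for v
        unfolding dvert_def x_def hor_def ver_def by simp
      show ?thesis
        using der[OF derv[OF y], of u]
        unfolding h_def[symmetric] eq vercov[OF y] b_eq[symmetric] unfolding x_def hor_def .
    qed
    show "(\<xi> has_derivative (\<lambda>v. b y v - \<i> * of_real (conn_form (fst (r y)) (fst (D y v))) *
        \<xi> y)) (at y)"
    proof -
      have eq: "snd (D y v) + chr G (x y) (hor y v) (snd (r y)) = ver y v" for v
        unfolding ver_def vert_def x_def hor_def using chr_sym[OF XG rX[OF y]] by simp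
      show ?thesis
        using der[OF ders[OF y]]
        unfolding h_def[symmetric] eq b_eq[symmetric] \<xi>_eq[symmetric] unfolding x_def hor_def .
    qed
  qed
  then show ?thesis by blast
qed

end

section \<open>Classification of the pointwise types\<close>

lemma derivative_zero_of_constant:
  assumes "open U" "y \<in> U" "(f has_derivative f') (at y)" "\<And>z. z \<in> U \<Longrightarrow> f z = c"
  shows "f' v = 0"
proof -
  have "(f has_derivative (\<lambda>z. 0)) (at y)"
    by (rule has_derivative_transform_within_open[OF has_derivative_const[of c] assms(1,2)])
      (simp add: assms(4))
  from has_derivative_unique[OF this assms(3)] show ?thesis by metis
qed

lemma has_derivative_Re_cnj:
  assumes "(P has_derivative P') (at y)" "(Q has_derivative Q') (at y)"
  shows "((\<lambda>y. Re (cnj (P y) * Q y)) has_derivative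
      (\<lambda>v. Re (cnj (P' v) * Q y) + Re (cnj (P y) * Q' v))) (at y)"
  by (rule has_derivative_eq_rhs, rule bounded_linear.has_derivative[OF bounded_linear_Re],
      rule has_derivative_mult, rule bounded_linear.has_derivative[OF bounded_linear_cnj], (rule
          assms)+)
    (simp add: fun_eq_iff)

lemma has_derivative_Im_cnj:
  assumes "(P has_derivative P') (at y)" "(Q has_derivative Q') (at y)"
  shows "((\<lambda>y. Im (cnj (P y) * Q y)) has_derivative
      (\<lambda>v. Im (cnj (P' v) * Q y) + Im (cnj (P y) * Q' v))) (at y)"
  by (rule has_derivative_eq_rhs, rule bounded_linear.has_derivative[OF bounded_linear_Im],
      rule has_derivative_mult, rule bounded_linear.has_derivative[OF bounded_linear_cnj], (rule
          assms)+)
    (simp add: fun_eq_iff)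

lemma smooth_on_Re_cnj:
  assumes "open S" "smooth_on S P" "smooth_on S Q"
  shows "smooth_on S (\<lambda>y. Re (cnj (P y) * Q y))" "smooth_on S (\<lambda>y. Im (cnj (P y) * Q y))"
  by (intro smooth_on_bounded_linear[OF assms(1) bounded_linear_Re] smooth_on_bounded_linear[OF assms(1)
      bounded_linear_Im]
      smooth_on_mult smooth_on_bounded_linear[OF assms(1) bounded_linear_cnj] assms)+

text \<open>The same equations in a moving frame \<open>f1\<close>, \<open>f2\<close> of the surface that is orthonormal for the
  induced metric: \<open>a1\<close>, \<open>a2\<close>, \<open>b1\<close>, \<open>b2\<close> are the values of \<open>a\<close> and \<open>b\<close> on the frame, \<open>\<eta>1\<close>, \<open>\<eta>2\<close> is
  the dual coframe and \<open>\<psi>\<close> the connection form of the frame.\<close>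

definition tg_frame where
  "tg_frame W K a1 a2 b1 b2 \<xi> \<eta>1 \<eta>2 \<phi> \<psi> \<Lambda> \<longleftrightarrow> open W \<and>
    smooth_on W a1 \<and> smooth_on W a2 \<and> smooth_on W b1 \<and> smooth_on W b2 \<and> smooth_on W \<xi> \<and>
    (\<forall>y\<in>W.
      (\<forall>u v. \<Lambda> y u v = \<Lambda> y v u) \<and>
      (\<exists>f1 f2. \<eta>1 y f1 = 1 \<and> \<eta>2 y f1 = 0 \<and> \<eta>1 y f2 = 0 \<and> \<eta>2 y f2 = 1) \<and>
      Re (cnj (a1 y) * a1 y) + Re (cnj (b1 y) * b1 y) = 1 \<and>
      Re (cnj (a2 y) * a2 y) + Re (cnj (b2 y) * b2 y) = 1 \<and>
      Re (cnj (a1 y) * a2 y) + Re (cnj (b1 y) * b2 y) = 0 \<and>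
      (a1 has_derivative (\<lambda>v. of_real (\<psi> y v) * a2 y
         + \<i> * of_real (K / 2 * Im (cnj (\<xi> y) * b1 y)) * (of_real (\<eta>1 y v) * a1 y + of_real (\<eta>2 y v) *
             a2 y)
         + \<i> * of_real (K / 2 * (\<eta>1 y v * Im (cnj (\<xi> y) * b1 y) + \<eta>2 y v * Im (cnj (\<xi> y) * b2 y))) *
             a1 y
         - \<i> * of_real (\<phi> y v) * a1 y)) (at y) \<and>
      (a2 has_derivative (\<lambda>v. - of_real (\<psi> y v) * a1 y
         + \<i> * of_real (K / 2 * Im (cnj (\<xi> y) * b2 y)) * (of_real (\<eta>1 y v) * a1 y + of_real (\<eta>2 y v) *
             a2 y)
         + \<i> * of_real (K / 2 * (\<eta>1 y v * Im (cnj (\<xi> y) * b1 y) + \<eta>2 y v * Im (cnj (\<xi> y) * b2 y))) *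
             a2 y
         - \<i> * of_real (\<phi> y v) * a2 y)) (at y) \<and>
      (b1 has_derivative (\<lambda>v. of_real (\<psi> y v) * b2 y
         + \<i> * of_real (K / 2 * (\<eta>2 y v * Im (cnj (a1 y) * a2 y))) * \<xi> y - \<i> * of_real (\<phi> y v) *
             b1 y)) (at y) \<and>
      (b2 has_derivative (\<lambda>v. - of_real (\<psi> y v) * b1 y
         - \<i> * of_real (K / 2 * (\<eta>1 y v * Im (cnj (a1 y) * a2 y))) * \<xi> y - \<i> * of_real (\<phi> y v) *
             b2 y)) (at y) \<and>
      (\<xi> has_derivative (\<lambda>v. of_real (\<eta>1 y v) * b1 y + of_real (\<eta>2 y v) * b2 y - \<i> * of_real (\<phi> y v) *
          \<xi> y)) (at y) \<and>
      (\<forall>u. ((\<lambda>y. \<eta>1 y u) has_derivative (\<lambda>v. \<psi> y v * \<eta>2 y u + \<eta>1 y (\<Lambda> y u v))) (at y)) \<and>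
      (\<forall>u. ((\<lambda>y. \<eta>2 y u) has_derivative (\<lambda>v. - \<psi> y v * \<eta>1 y u + \<eta>2 y (\<Lambda> y u v))) (at y)))"
  for W :: "(real^2) set" and \<Lambda> :: "real^2 \<Rightarrow> real^2 \<Rightarrow> real^2 \<Rightarrow> real^2"

text \<open>In the derivative of the induced metric \<open>h\<close> the curvature terms of \<open>a\<close> and \<open>b\<close> cancel, so
  \<open>h\<close> is parallel for \<open>\<Lambda>\<close> and the covariant derivative of an orthonormal frame is a rotation.\<close>

lemma tg_system_frame:
  assumes tg: "tg_system W K a b \<xi> \<phi> \<Lambda>"
  obtains f1 f2 \<eta>1 \<eta>2 \<psi> where
    "tg_frame W K (\<lambda>y. a y (f1 y)) (\<lambda>y. a y (f2 y)) (\<lambda>y. b y (f1 y)) (\<lambda>y. b y (f2 y)) \<xi> \<eta>1 \<eta>2 \<phi> \<psi> \<Lambda>"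
    "\<And>y u. y \<in> W \<Longrightarrow> u = \<eta>1 y u *\<^sub>R f1 y + \<eta>2 y u *\<^sub>R f2 y"
proof -
  have W: "open W" and sa: "\<And>u. smooth_on W (\<lambda>y. a y u)" and sb: "\<And>u. smooth_on W (\<lambda>y. b y u)" and sx:
      "smooth_on W \<xi>"
    using tg by (auto simp: tg_system_def)
  have la: "linear (a y)" and lb: "linear (b y)" and inj: "a y u = 0 \<Longrightarrow> b y u = 0 \<Longrightarrow> u = 0"
    and Lsym: "\<Lambda> y u v = \<Lambda> y v u"
    and da: "((\<lambda>y. a y u) has_derivative (\<lambda>v. a y (\<Lambda> y u v)
          + \<i> * of_real (K / 2 * Im (cnj (\<xi> y) * b y u)) * a y v
          + \<i> * of_real (K / 2 * Im (cnj (\<xi> y) * b y v)) * a y u - \<i> * of_real (\<phi> y v) * a y u)) (at y)"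
    and db: "((\<lambda>y. b y u) has_derivative (\<lambda>v. b y (\<Lambda> y u v)
          - \<i> * of_real (K / 2 * Im (cnj (a y v) * a y u)) * \<xi> y - \<i> * of_real (\<phi> y v) * b y u)) (at y)"
    and dx: "(\<xi> has_derivative (\<lambda>v. b y v - \<i> * of_real (\<phi> y v) * \<xi> y)) (at y)"
    if "y \<in> W" for y u v
    using tg that unfolding tg_system_def by blast+
  define h where "h y u v = Re (cnj (a y u) * a y v) + Re (cnj (b y u) * b y v)" for y u v
  have pd: "pd_form (h y)" if y: "y \<in> W" for y
    unfolding pd_form_def bilinear_def
  proof (intro conjI allI impI linearI)
    fix u :: "real^2" assume "u \<noteq> 0"
    then have "a y u \<noteq> 0 \<or> b y u \<noteq> 0" using inj[OF y] by blast
    then have "(cmod (a y u))\<^sup>2 + (cmod (b y u))\<^sup>2 > 0"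
      by (metis add_nonneg_pos add_pos_nonneg norm_ge_zero zero_le_power zero_less_norm_iff
          zero_less_power)
    then show "h y u u > 0" unfolding h_def cmod_power2 by (simp add: power2_eq_square)
  qed (simp_all add: h_def linear_add[OF la[OF y]] linear_add[OF lb[OF y]] linear_cmul[OF la[OF y]]
      linear_cmul[OF lb[OF y]]
       algebra_simps)
  have sh: "smooth_on W (\<lambda>y. h y u v)" for u v
    unfolding h_def by (intro smooth_on_add W smooth_on_Re_cnj sa sb)
  obtain f1 f2 where f: "smooth_on W f1" "smooth_on W f2"
    "\<And>y. y \<in> W \<Longrightarrow> h y (f1 y) (f1 y) = 1" "\<And>y. y \<in> W \<Longrightarrow> h y (f2 y) (f2 y) = 1"
    "\<And>y. y \<in> W \<Longrightarrow> h y (f1 y) (f2 y) = 0"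
    using smooth_orthonormal_frame[OF W pd sh] by blast
  have dap: "((\<lambda>y. a y (p y)) has_derivative (\<lambda>v. a y (p' v + \<Lambda> y (p y) v)
          + \<i> * of_real (K / 2 * Im (cnj (\<xi> y) * b y (p y))) * a y v
          + \<i> * of_real (K / 2 * Im (cnj (\<xi> y) * b y v)) * a y (p y) - \<i> * of_real (\<phi> y v) *
              a y (p y))) (at y)"
    if y: "y \<in> W" and p: "(p has_derivative p') (at y)" for y p p'
    by (rule has_derivative_eq_rhs[OF has_derivative_linear_family[where B=a, OF W y la da[OF y] p]])
      (simp_all add: linear_add[OF la[OF y]] fun_eq_iff)
  have dbp: "((\<lambda>y. b y (p y)) has_derivative (\<lambda>v. b y (p' v + \<Lambda> y (p y) v)
          - \<i> * of_real (K / 2 * Im (cnj (a y v) * a y (p y))) * \<xi> y - \<i> * of_real (\<phi> y v) *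
              b y (p y))) (at y)"
    if y: "y \<in> W" and p: "(p has_derivative p') (at y)" for y p p'
    by (rule has_derivative_eq_rhs[OF has_derivative_linear_family[where B=b, OF W y lb db[OF y] p]])
      (simp_all add: linear_add[OF lb[OF y]] fun_eq_iff)
  have dh: "((\<lambda>y. h y (p y) (q y)) has_derivative
      (\<lambda>v. h y (p' v + \<Lambda> y (p y) v) (q y) + h y (p y) (q' v + \<Lambda> y (q y) v))) (at y)"
    if y: "y \<in> W" and p: "(p has_derivative p') (at y)" and q: "(q has_derivative q') (at y)"
        for y p p' q q'
    unfolding h_def
    by (rule has_derivative_eq_rhs[OF has_derivative_add[OF has_derivative_Re_cnj[OF dap[OF y p] dap[OF
        y q]]
         has_derivative_Re_cnj[OF dbp[OF y p] dbp[OF y q]]]])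
      (simp add: fun_eq_iff field_simps)
  define f1' where "f1' y = frechet_derivative f1 (at y)" for y
  define f2' where "f2' y = frechet_derivative f2 (at y)" for y
  have df: "(f1 has_derivative f1' y) (at y)" "(f2 has_derivative f2' y) (at y)" if "y \<in> W" for y
    unfolding f1'_def f2'_def using f(1,2) that by (auto intro: smooth_on_has_derivative)
  \<comment> \<open>The covariant derivatives of the frame fields.\<close>
  define n1 where "n1 y v = f1' y v + \<Lambda> y (f1 y) v" for y v
  define n2 where "n2 y v = f2' y v + \<Lambda> y (f2 y) v" for y v
  define \<psi> where "\<psi> y v = h y (n1 y v) (f2 y)" for y v
  define \<eta>1 where "\<eta>1 y v = h y (f1 y) v" for y v
  define \<eta>2 where "\<eta>2 y v = h y (f2 y) v" for y v
  have ex: "u = \<eta>1 y u *\<^sub>R f1 y + \<eta>2 y u *\<^sub>R f2 y" if "y \<in> W" for y u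
    unfolding \<eta>1_def \<eta>2_def by (rule orthonormal_expand[OF pd[OF that] f(3-5)[OF that]])
  have n1: "n1 y v = \<psi> y v *\<^sub>R f2 y" and n2: "n2 y v = - \<psi> y v *\<^sub>R f1 y" if y: "y \<in> W" for y v
  proof -
    note sym = pd_formD(2)[OF pd[OF y]]
    have 1: "h y (n1 y v) (f1 y) + h y (f1 y) (n1 y v) = 0"
      unfolding n1_def by (rule derivative_zero_of_constant[OF W y dh[OF y df(1)[OF y] df(1)[OF y]]])
          (rule f)
    have 2: "h y (n2 y v) (f2 y) + h y (f2 y) (n2 y v) = 0"
      unfolding n2_def by (rule derivative_zero_of_constant[OF W y dh[OF y df(2)[OF y] df(2)[OF y]]])
          (rule f)
    have 3: "h y (n1 y v) (f2 y) + h y (f1 y) (n2 y v) = 0"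
      unfolding n1_def n2_def by (rule derivative_zero_of_constant[OF W y dh[OF y df(1)[OF y] df(2)[OF
          y]]]) (rule f)
    show "n1 y v = \<psi> y v *\<^sub>R f2 y"
      using ex[OF y, of "n1 y v"] 1 sym[of "n1 y v" "f1 y"] sym[of "n1 y v" "f2 y"]
      unfolding \<eta>1_def \<eta>2_def \<psi>_def by simp
    show "n2 y v = - \<psi> y v *\<^sub>R f1 y"
    proof (subst ex[OF y, of "n2 y v"])
      have "h y (f1 y) (n2 y v) = - \<psi> y v" "h y (f2 y) (n2 y v) = 0"
        using 2 3 sym[of "n2 y v" "f2 y"] unfolding \<psi>_def by auto
      then show "\<eta>1 y (n2 y v) *\<^sub>R f1 y + \<eta>2 y (n2 y v) *\<^sub>R f2 y = - \<psi> y v *\<^sub>R f1 y"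
        unfolding \<eta>1_def \<eta>2_def by simp
    qed
  qed
  have av: "a y v = of_real (\<eta>1 y v) * a y (f1 y) + of_real (\<eta>2 y v) * a y (f2 y)"
    and bv: "b y v = of_real (\<eta>1 y v) * b y (f1 y) + of_real (\<eta>2 y v) * b y (f2 y)" if y: "y \<in> W"
        for y v
    using arg_cong[OF ex[OF y, of v], of "a y"] arg_cong[OF ex[OF y, of v], of "b y"]
    by (simp_all add: linear_add[OF la[OF y]] linear_cmul[OF la[OF y]] linear_add[OF lb[OF y]]
        linear_cmul[OF lb[OF y]]
        scaleR_conv_of_real[where 'a=complex])
  have bx: "Im (cnj (\<xi> y) * b y v) = \<eta>1 y v * Im (cnj (\<xi> y) * b y (f1 y)) + \<eta>2 y v * Im (cnj (\<xi> y) *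
      b y (f2 y))"
    and ax1: "Im (cnj (a y v) * a y (f1 y)) = - (\<eta>2 y v * Im (cnj (a y (f1 y)) * a y (f2 y)))"
    and ax2: "Im (cnj (a y v) * a y (f2 y)) = \<eta>1 y v * Im (cnj (a y (f1 y)) * a y (f2 y))"
    if y: "y \<in> W" for y v
    using av[OF y, of v] bv[OF y, of v] by (simp_all add: algebra_simps)
    have nn: "f1' y v + \<Lambda> y (f1 y) v = \<psi> y v *\<^sub>R f2 y" "f2' y v + \<Lambda> y (f2 y) v = - \<psi> y v *\<^sub>R f1 y"
        if y: "y \<in> W" for y v
      using n1[OF y] n2[OF y] by (auto simp: n1_def n2_def)
    have A1: "((\<lambda>y. a y (f1 y)) has_derivative (\<lambda>v. of_real (\<psi> y v) * a y (f2 y)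
         + \<i> * of_real (K / 2 * Im (cnj (\<xi> y) * b y (f1 y))) * (of_real (\<eta>1 y v) * a y (f1 y) +
             of_real (\<eta>2 y v) * a y (f2 y))
         + \<i> * of_real (K / 2 * (\<eta>1 y v * Im (cnj (\<xi> y) * b y (f1 y)) + \<eta>2 y v * Im (cnj (\<xi> y) *
             b y (f2 y)))) * a y (f1 y)
         - \<i> * of_real (\<phi> y v) * a y (f1 y))) (at y)" if y: "y \<in> W" for y
      unfolding bx[OF y, symmetric] av[OF y, symmetric]
      by (rule has_derivative_eq_rhs[OF dap[OF y df(1)[OF y]]])
        (simp only: fun_eq_iff nn[OF y] linear_cmul[OF la[OF y]] linear_cmul[OF lb[OF y]]
            scaleR_conv_of_real[where 'a=complex] of_real_minus, simp)
    have A2: "((\<lambda>y. a y (f2 y)) has_derivative (\<lambda>v. - of_real (\<psi> y v) * a y (f1 y)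
         + \<i> * of_real (K / 2 * Im (cnj (\<xi> y) * b y (f2 y))) * (of_real (\<eta>1 y v) * a y (f1 y) +
             of_real (\<eta>2 y v) * a y (f2 y))
         + \<i> * of_real (K / 2 * (\<eta>1 y v * Im (cnj (\<xi> y) * b y (f1 y)) + \<eta>2 y v * Im (cnj (\<xi> y) *
             b y (f2 y)))) * a y (f2 y)
         - \<i> * of_real (\<phi> y v) * a y (f2 y))) (at y)" if y: "y \<in> W" for y
      unfolding bx[OF y, symmetric] av[OF y, symmetric]
      by (rule has_derivative_eq_rhs[OF dap[OF y df(2)[OF y]]])
        (simp only: fun_eq_iff nn[OF y] linear_cmul[OF la[OF y]] linear_cmul[OF lb[OF y]]
            scaleR_conv_of_real[where 'a=complex] of_real_minus, simp)
    have B1: "((\<lambda>y. b y (f1 y)) has_derivative (\<lambda>v. of_real (\<psi> y v) * b y (f2 y)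
         + \<i> * of_real (K / 2 * (\<eta>2 y v * Im (cnj (a y (f1 y)) * a y (f2 y)))) * \<xi> y - \<i> *
             of_real (\<phi> y v) * b y (f1 y))) (at y)" if y: "y \<in> W" for y
      by (rule has_derivative_eq_rhs[OF dbp[OF y df(1)[OF y]]])
        (rule ext, subst ax1[OF y], simp add: nn[OF y] linear_cmul[OF lb[OF y]] linear_neg[OF lb[OF y]]
            scaleR_conv_of_real[where 'a=complex])
    have B2: "((\<lambda>y. b y (f2 y)) has_derivative (\<lambda>v. - of_real (\<psi> y v) * b y (f1 y)
         - \<i> * of_real (K / 2 * (\<eta>1 y v * Im (cnj (a y (f1 y)) * a y (f2 y)))) * \<xi> y - \<i> *
             of_real (\<phi> y v) * b y (f2 y))) (at y)" if y: "y \<in> W" for y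
      by (rule has_derivative_eq_rhs[OF dbp[OF y df(2)[OF y]]])
        (rule ext, subst ax2[OF y], simp add: nn[OF y] linear_cmul[OF lb[OF y]] linear_neg[OF lb[OF y]]
            scaleR_conv_of_real[where 'a=complex])
    have X1: "(\<xi> has_derivative (\<lambda>v. of_real (\<eta>1 y v) * b y (f1 y) + of_real (\<eta>2 y v) * b y (f2 y) - \<i> *
        of_real (\<phi> y v) * \<xi> y)) (at y)" if y: "y \<in> W" for y
      using dx[OF y] unfolding bv[OF y, symmetric] .
    have H1: "((\<lambda>y. \<eta>1 y u) has_derivative (\<lambda>v. \<psi> y v * \<eta>2 y u + \<eta>1 y (\<Lambda> y u v))) (at y)" if y: "y \<in> W"
        for y u
      unfolding \<eta>1_def \<eta>2_def
      by (rule has_derivative_eq_rhs[OF dh[OF y df(1)[OF y] has_derivative_const]])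
        (simp add: nn[OF y] pd_form_simps[OF pd[OF y]] fun_eq_iff)
    have H2: "((\<lambda>y. \<eta>2 y u) has_derivative (\<lambda>v. - \<psi> y v * \<eta>1 y u + \<eta>2 y (\<Lambda> y u v))) (at y)"
        if y: "y \<in> W" for y u
      unfolding \<eta>1_def \<eta>2_def
      by (rule has_derivative_eq_rhs[OF dh[OF y df(2)[OF y] has_derivative_const]])
        (simp add: nn[OF y] pd_form_simps[OF pd[OF y]] fun_eq_iff)
  have S: "smooth_on W (\<lambda>y. a y (f1 y))" "smooth_on W (\<lambda>y. a y (f2 y))"
      "smooth_on W (\<lambda>y. b y (f1 y))" "smooth_on W (\<lambda>y. b y (f2 y))"
    by (rule smooth_on_linear_family[where B=a, OF W la sa] smooth_on_linear_family[where B=b, OF W lb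
        sb]; (assumption | rule f))+
  have F: "\<exists>f1 f2. \<eta>1 y f1 = 1 \<and> \<eta>2 y f1 = 0 \<and> \<eta>1 y f2 = 0 \<and> \<eta>2 y f2 = 1" if y: "y \<in> W" for y
    unfolding \<eta>1_def \<eta>2_def using f(3-5)[OF y] pd_formD(2)[OF pd[OF y]] by metis
  have O: "Re (cnj (a y (f1 y)) * a y (f1 y)) + Re (cnj (b y (f1 y)) * b y (f1 y)) = 1"
      "Re (cnj (a y (f2 y)) * a y (f2 y)) + Re (cnj (b y (f2 y)) * b y (f2 y)) = 1"
      "Re (cnj (a y (f1 y)) * a y (f2 y)) + Re (cnj (b y (f1 y)) * b y (f2 y)) = 0" if y: "y \<in> W" for y
    using f(3-5)[OF y] unfolding h_def by auto
  have "tg_frame W K (\<lambda>y. a y (f1 y)) (\<lambda>y. a y (f2 y)) (\<lambda>y. b y (f1 y)) (\<lambda>y. b y (f2 y)) \<xi> \<eta>1 \<eta>2 \<phi> \<psi> \<Lambda>"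
    unfolding tg_frame_def
    by (intro conjI ballI allI W sx S F O A1 A2 B1 B2 X1 H1 H2 Lsym)
  from that[OF this ex] show ?thesis .
qed

context
  fixes W K a1 a2 b1 b2 \<xi> \<eta>1 \<eta>2 \<phi> \<psi> \<Lambda>
  assumes tg: "tg_frame W K a1 a2 b1 b2 \<xi> \<eta>1 \<eta>2 \<phi> \<psi> \<Lambda>" and K0: "K \<noteq> 0"
begin

text \<open>The invariants of the surface: \<open>\<theta>1\<close> and \<open>\<theta>2\<close> are the components of half the gradient of \<open>\<rho>\<close>,
  the \<open>\<beta>\<close> are those of the Killing one-form, \<open>\<alpha>\<close> and \<open>\<delta>\<close> are the determinants of the horizontal
  and of the vertical part, and the \<open>A\<close> are the coefficients of the form that the base metric
  induces.\<close>

definition \<rho> where "\<rho> y = Re (cnj (\<xi> y) * \<xi> y)"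
definition \<theta>1 where "\<theta>1 y = Re (cnj (\<xi> y) * b1 y)"
definition \<theta>2 where "\<theta>2 y = Re (cnj (\<xi> y) * b2 y)"
definition \<beta>1 where "\<beta>1 y = Im (cnj (\<xi> y) * b1 y)"
definition \<beta>2 where "\<beta>2 y = Im (cnj (\<xi> y) * b2 y)"
definition \<alpha> where "\<alpha> y = Im (cnj (a1 y) * a2 y)"
definition \<delta> where "\<delta> y = Im (cnj (b1 y) * b2 y)"
definition A11 where "A11 y = Re (cnj (a1 y) * a1 y)"
definition A12 where "A12 y = Re (cnj (a1 y) * a2 y)"
definition A22 where "A22 y = Re (cnj (a2 y) * a2 y)"
definition \<sigma> where "\<sigma> y = \<delta> y - K / 2 * \<alpha> y * \<rho> y"

lemmas scalar_defs = \<rho>_def \<theta>1_def \<theta>2_def \<beta>1_def \<beta>2_def \<alpha>_def \<delta>_def A11_def A12_def A22_def \<sigma>_def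

lemma W_open: "open W" using tg by (simp add: tg_frame_def)

lemma frame_smooth: "smooth_on W a1" "smooth_on W a2" "smooth_on W b1" "smooth_on W b2" "smooth_on W \<xi>"
  using tg by (simp_all add: tg_frame_def)

lemma frame_vectors:
  assumes "y \<in> W"
  obtains f1 f2 where "\<eta>1 y f1 = 1" "\<eta>2 y f1 = 0" "\<eta>1 y f2 = 0" "\<eta>2 y f2 = 1"
  using tg assms unfolding tg_frame_def by blast

lemma B_eq:
  assumes "y \<in> W"
  shows "Re (cnj (b1 y) * b1 y) = 1 - A11 y" "Re (cnj (b2 y) * b2 y) = 1 - A22 y"
      "Re (cnj (b1 y) * b2 y) = - A12 y"
    "Re (cnj (b2 y) * b1 y) = - A12 y"
  using tg assms unfolding tg_frame_def A11_def A12_def A22_def by (force simp: algebra_simps)+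

lemma frame_derivs:
  assumes "y \<in> W"
  shows "(a1 has_derivative (\<lambda>v. of_real (\<psi> y v) * a2 y
         + \<i> * of_real (K / 2 * \<beta>1 y) * (of_real (\<eta>1 y v) * a1 y + of_real (\<eta>2 y v) * a2 y)
         + \<i> * of_real (K / 2 * (\<eta>1 y v * \<beta>1 y + \<eta>2 y v * \<beta>2 y)) * a1 y
         - \<i> * of_real (\<phi> y v) * a1 y)) (at y)"
    "(a2 has_derivative (\<lambda>v. - of_real (\<psi> y v) * a1 y
         + \<i> * of_real (K / 2 * \<beta>2 y) * (of_real (\<eta>1 y v) * a1 y + of_real (\<eta>2 y v) * a2 y)
         + \<i> * of_real (K / 2 * (\<eta>1 y v * \<beta>1 y + \<eta>2 y v * \<beta>2 y)) * a2 y
         - \<i> * of_real (\<phi> y v) * a2 y)) (at y)"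
    "(b1 has_derivative (\<lambda>v. of_real (\<psi> y v) * b2 y
         + \<i> * of_real (K / 2 * (\<eta>2 y v * \<alpha> y)) * \<xi> y - \<i> * of_real (\<phi> y v) * b1 y)) (at y)"
    "(b2 has_derivative (\<lambda>v. - of_real (\<psi> y v) * b1 y
         - \<i> * of_real (K / 2 * (\<eta>1 y v * \<alpha> y)) * \<xi> y - \<i> * of_real (\<phi> y v) * b2 y)) (at y)"
    "(\<xi> has_derivative (\<lambda>v. of_real (\<eta>1 y v) * b1 y + of_real (\<eta>2 y v) * b2 y - \<i> * of_real (\<phi> y v) *
        \<xi> y)) (at y)"
  using tg assms unfolding tg_frame_def \<beta>1_def \<beta>2_def \<alpha>_def by blast+

lemma coframe_derivs:
  assumes "y \<in> W"
  shows "((\<lambda>y. \<eta>1 y u) has_derivative (\<lambda>v. \<psi> y v * \<eta>2 y u + \<eta>1 y (\<Lambda> y u v))) (at y)"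
    "((\<lambda>y. \<eta>2 y u) has_derivative (\<lambda>v. - \<psi> y v * \<eta>1 y u + \<eta>2 y (\<Lambda> y u v))) (at y)"
  using tg assms unfolding tg_frame_def by blast+

text \<open>The covariant derivatives of the invariants. The connection form of the base drops out of
  all of them, so the system is closed.\<close>

lemma scalar_derivs:
  assumes y: "y \<in> W"
  shows "(\<rho> has_derivative (\<lambda>v. 2 * (\<theta>1 y * \<eta>1 y v + \<theta>2 y * \<eta>2 y v))) (at y)"
    "(\<theta>1 has_derivative (\<lambda>v. \<psi> y v * \<theta>2 y + (1 - A11 y) * \<eta>1 y v - A12 y * \<eta>2 y v)) (at y)"
    "(\<theta>2 has_derivative (\<lambda>v. - \<psi> y v * \<theta>1 y - A12 y * \<eta>1 y v + (1 - A22 y) * \<eta>2 y v)) (at y)"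
    "(\<beta>1 has_derivative (\<lambda>v. \<psi> y v * \<beta>2 y - \<sigma> y * \<eta>2 y v)) (at y)"
    "(\<beta>2 has_derivative (\<lambda>v. - \<psi> y v * \<beta>1 y + \<sigma> y * \<eta>1 y v)) (at y)"
    "(\<alpha> has_derivative (\<lambda>v. K / 2 * ((A11 y * \<eta>1 y v + A12 y * \<eta>2 y v) * \<beta>2 y - (A12 y * \<eta>1 y v +
        A22 y * \<eta>2 y v) * \<beta>1 y))) (at y)"
    "(\<delta> has_derivative (\<lambda>v. - (K / 2) * \<alpha> y * (\<theta>1 y * \<eta>1 y v + \<theta>2 y * \<eta>2 y v))) (at y)"
    "(A11 has_derivative (\<lambda>v. 2 * \<psi> y v * A12 y - K * \<alpha> y * \<beta>1 y * \<eta>2 y v)) (at y)"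
    "(A12 has_derivative (\<lambda>v. \<psi> y v * (A22 y - A11 y) + K / 2 * \<alpha> y * (\<beta>1 y * \<eta>1 y v - \<beta>2 y *
        \<eta>2 y v))) (at y)"
    "(A22 has_derivative (\<lambda>v. - 2 * \<psi> y v * A12 y + K * \<alpha> y * \<beta>2 y * \<eta>1 y v)) (at y)"
proof -
  note d = frame_derivs[OF y] and B = B_eq[OF y]
  have A12': "A12 y = - (Re (b1 y) * Re (b2 y) + Im (b1 y) * Im (b2 y))" using B(3) by simp
  show "(\<rho> has_derivative (\<lambda>v. 2 * (\<theta>1 y * \<eta>1 y v + \<theta>2 y * \<eta>2 y v))) (at y)"
    unfolding \<rho>_def
    by (rule has_derivative_eq_rhs[OF has_derivative_Re_cnj[OF d(5) d(5)]])
      (simp add: fun_eq_iff \<theta>1_def \<theta>2_def algebra_simps)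
  show "(\<theta>1 has_derivative (\<lambda>v. \<psi> y v * \<theta>2 y + (1 - A11 y) * \<eta>1 y v - A12 y * \<eta>2 y v)) (at y)"
    unfolding \<theta>1_def[abs_def] B(1,2)[symmetric] A12'
    by (rule has_derivative_eq_rhs[OF has_derivative_Re_cnj[OF d(5) d(3)]])
      (simp add: fun_eq_iff \<theta>2_def algebra_simps)
  show "(\<theta>2 has_derivative (\<lambda>v. - \<psi> y v * \<theta>1 y - A12 y * \<eta>1 y v + (1 - A22 y) * \<eta>2 y v)) (at y)"
    unfolding \<theta>2_def[abs_def] B(1,2)[symmetric] A12'
    by (rule has_derivative_eq_rhs[OF has_derivative_Re_cnj[OF d(5) d(4)]])
      (simp add: fun_eq_iff \<theta>1_def algebra_simps)
  show "(\<beta>1 has_derivative (\<lambda>v. \<psi> y v * \<beta>2 y - \<sigma> y * \<eta>2 y v)) (at y)"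
    unfolding \<beta>1_def[abs_def]
    by (rule has_derivative_eq_rhs[OF has_derivative_Im_cnj[OF d(5) d(3)]])
      (simp add: fun_eq_iff \<beta>2_def \<sigma>_def \<delta>_def \<rho>_def algebra_simps)
  show "(\<beta>2 has_derivative (\<lambda>v. - \<psi> y v * \<beta>1 y + \<sigma> y * \<eta>1 y v)) (at y)"
    unfolding \<beta>2_def[abs_def]
    by (rule has_derivative_eq_rhs[OF has_derivative_Im_cnj[OF d(5) d(4)]])
      (simp add: fun_eq_iff \<beta>1_def \<sigma>_def \<delta>_def \<rho>_def algebra_simps)
  show "(\<alpha> has_derivative (\<lambda>v. K / 2 * ((A11 y * \<eta>1 y v + A12 y * \<eta>2 y v) * \<beta>2 y - (A12 y * \<eta>1 y v +
      A22 y * \<eta>2 y v) * \<beta>1 y))) (at y)"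
    unfolding \<alpha>_def[abs_def]
    by (rule has_derivative_eq_rhs[OF has_derivative_Im_cnj[OF d(1) d(2)]])
      (simp add: fun_eq_iff A11_def A12_def A22_def field_simps)
  show "(\<delta> has_derivative (\<lambda>v. - (K / 2) * \<alpha> y * (\<theta>1 y * \<eta>1 y v + \<theta>2 y * \<eta>2 y v))) (at y)"
    unfolding \<delta>_def[abs_def]
    by (rule has_derivative_eq_rhs[OF has_derivative_Im_cnj[OF d(3) d(4)]])
      (simp add: fun_eq_iff \<theta>1_def \<theta>2_def field_simps)
  show "(A11 has_derivative (\<lambda>v. 2 * \<psi> y v * A12 y - K * \<alpha> y * \<beta>1 y * \<eta>2 y v)) (at y)"
    unfolding A11_def[abs_def]
    by (rule has_derivative_eq_rhs[OF has_derivative_Re_cnj[OF d(1) d(1)]])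
      (simp add: fun_eq_iff A12_def \<alpha>_def field_simps)
  show "(A12 has_derivative (\<lambda>v. \<psi> y v * (A22 y - A11 y) + K / 2 * \<alpha> y * (\<beta>1 y * \<eta>1 y v - \<beta>2 y *
      \<eta>2 y v))) (at y)"
    unfolding A12_def[abs_def]
    by (rule has_derivative_eq_rhs[OF has_derivative_Re_cnj[OF d(1) d(2)]])
      (simp add: fun_eq_iff A11_def A22_def \<alpha>_def field_simps)
  show "(A22 has_derivative (\<lambda>v. - 2 * \<psi> y v * A12 y + K * \<alpha> y * \<beta>2 y * \<eta>1 y v)) (at y)"
    unfolding A22_def[abs_def]
    by (rule has_derivative_eq_rhs[OF has_derivative_Re_cnj[OF d(2) d(2)]])
      (simp add: fun_eq_iff A12_def \<alpha>_def field_simps)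
qed

lemma scalar_continuous:
  "continuous_on W \<alpha>" "continuous_on W \<delta>"
  using scalar_derivs has_derivative_continuous
  by (blast intro: continuous_at_imp_continuous_on)+

lemma scalar_algebra:
  assumes y: "y \<in> W"
  shows "\<rho> y * (1 - A11 y) = (\<theta>1 y)\<^sup>2 + (\<beta>1 y)\<^sup>2" "\<rho> y * (1 - A22 y) = (\<theta>2 y)\<^sup>2 + (\<beta>2 y)\<^sup>2"
    "- \<rho> y * A12 y = \<theta>1 y * \<theta>2 y + \<beta>1 y * \<beta>2 y"
    "\<rho> y * \<delta> y = \<theta>1 y * \<beta>2 y - \<theta>2 y * \<beta>1 y"
    "(\<alpha> y)\<^sup>2 = A11 y * A22 y - (A12 y)\<^sup>2" "(\<delta> y)\<^sup>2 = (1 - A11 y) * (1 - A22 y) - (A12 y)\<^sup>2"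
  unfolding B_eq[OF y, symmetric]
  subgoal by (simp add: scalar_defs power2_eq_square algebra_simps)
  subgoal by (simp add: scalar_defs power2_eq_square algebra_simps)
  subgoal using B_eq(3)[OF y] by (simp add: \<rho>_def \<theta>1_def \<theta>2_def \<beta>1_def \<beta>2_def) algebra
  subgoal by (simp add: scalar_defs power2_eq_square algebra_simps)
  subgoal by (simp add: scalar_defs power2_eq_square algebra_simps)
  subgoal using B_eq(3)[OF y] by (simp add: \<delta>_def power2_eq_square) algebra
  done

lemma scalar_signs: "\<rho> y \<ge> 0" "\<rho> y = 0 \<longleftrightarrow> \<xi> y = 0"
  "A11 y * p\<^sup>2 + 2 * A12 y * p * q + A22 y * q\<^sup>2 \<ge> 0"
proof -
  show "\<rho> y \<ge> 0" "\<rho> y = 0 \<longleftrightarrow> \<xi> y = 0"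
    unfolding \<rho>_def by (simp_all add: complex_eq_iff sum_squares_eq_zero_iff)
  have "A11 y * p\<^sup>2 + 2 * A12 y * p * q + A22 y * q\<^sup>2 =
    (p * Re (a1 y) + q * Re (a2 y))\<^sup>2 + (p * Im (a1 y) + q * Im (a2 y))\<^sup>2"
    unfolding A11_def A12_def A22_def by (simp add: power2_eq_square algebra_simps)
  then show "A11 y * p\<^sup>2 + 2 * A12 y * p * q + A22 y * q\<^sup>2 \<ge> 0" by simp
qed

text \<open>The function \<open>\<theta>1\<^sup>2 + \<theta>2\<^sup>2\<close> is the squared length of the gradient of \<open>\<rho>/2\<close>. Its second
  derivatives commute. Since the covariant derivatives of the Hessian \<open>1 - A\<close> of \<open>\<rho>/2\<close> are
  multiples of \<open>\<alpha> \<beta>\<close>, this is a condition on the product of \<open>\<alpha>\<close> with the value of \<open>\<beta>\<close> on the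
  gradient.\<close>

lemma gradient_orthogonal:
  assumes y: "y \<in> W" and \<alpha>: "\<alpha> y \<noteq> 0"
  shows "\<beta>1 y * \<theta>1 y + \<beta>2 y * \<theta>2 y = 0"
proof -
  \<comment> \<open>The differential of \<open>q\<close> is \<open>2 (P \<eta>1 + Q \<eta>2)\<close>.\<close>
  define q where "q y = \<theta>1 y * \<theta>1 y + \<theta>2 y * \<theta>2 y" for y
  define P where "P y = \<theta>1 y * (1 - A11 y) - \<theta>2 y * A12 y" for y
  define Q where "Q y = - (\<theta>1 y * A12 y) + \<theta>2 y * (1 - A22 y)" for y
  have sm: "smooth_on W q"
    unfolding q_def \<theta>1_def \<theta>2_def
    by (intro smooth_intros smooth_on_Re_cnj W_open frame_smooth)
  have dq: "(q has_derivative (\<lambda>v. 2 * (P z * \<eta>1 z v + Q z * \<eta>2 z v))) (at z)" if z: "z \<in> W" for z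
    unfolding q_def
    by (rule has_derivative_eq_rhs[OF has_derivative_add[OF has_derivative_mult[OF scalar_derivs(2)[OF
        z] scalar_derivs(2)[OF z]]
        has_derivative_mult[OF scalar_derivs(3)[OF z] scalar_derivs(3)[OF z]]]])
      (simp add: fun_eq_iff P_def Q_def algebra_simps)
  define DP where "DP v = (\<psi> y v * \<theta>2 y + (1 - A11 y) * \<eta>1 y v - A12 y * \<eta>2 y v) * (1 - A11 y)
     + \<theta>1 y * - (2 * \<psi> y v * A12 y - K * \<alpha> y * \<beta>1 y * \<eta>2 y v)
     - ((- \<psi> y v * \<theta>1 y - A12 y * \<eta>1 y v + (1 - A22 y) * \<eta>2 y v) * A12 y +
        \<theta>2 y * (\<psi> y v * (A22 y - A11 y) + K / 2 * \<alpha> y * (\<beta>1 y * \<eta>1 y v - \<beta>2 y * \<eta>2 y v)))" for v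
  define DQ where "DQ v = - ((\<psi> y v * \<theta>2 y + (1 - A11 y) * \<eta>1 y v - A12 y * \<eta>2 y v) * A12 y
     + \<theta>1 y * (\<psi> y v * (A22 y - A11 y) + K / 2 * \<alpha> y * (\<beta>1 y * \<eta>1 y v - \<beta>2 y * \<eta>2 y v)))
     + ((- \<psi> y v * \<theta>1 y - A12 y * \<eta>1 y v + (1 - A22 y) * \<eta>2 y v) * (1 - A22 y) +
        \<theta>2 y * - (- 2 * \<psi> y v * A12 y + K * \<alpha> y * \<beta>2 y * \<eta>1 y v))" for v
  note d = scalar_derivs[OF y]
  have dP: "(P has_derivative DP) (at y)"
    unfolding P_def DP_def
    by (rule has_derivative_eq_rhs[OF has_derivative_diff[OF
         has_derivative_mult[OF d(2) has_derivative_diff[OF has_derivative_const d(8)]]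
             has_derivative_mult[OF d(3) d(9)]]])
       (simp add: fun_eq_iff algebra_simps)
  have dQ: "(Q has_derivative DQ) (at y)"
    unfolding Q_def DQ_def
    by (rule has_derivative_eq_rhs[OF has_derivative_add[OF has_derivative_minus[OF
        has_derivative_mult[OF d(2) d(9)]]
         has_derivative_mult[OF d(3) has_derivative_diff[OF has_derivative_const d(10)]]]])
       (simp add: fun_eq_iff algebra_simps)
  have dd: "frechet_derivative (\<lambda>y. frechet_derivative q (at y) u) (at y) v =
      2 * (DP v * \<eta>1 y u + P y * (\<psi> y v * \<eta>2 y u + \<eta>1 y (\<Lambda> y u v)) +
          (DQ v * \<eta>2 y u + Q y * (- \<psi> y v * \<eta>1 y u + \<eta>2 y (\<Lambda> y u v))))" for u v
  proof -
    have "((\<lambda>y. frechet_derivative q (at y) u) has_derivative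
       (\<lambda>v. 2 * (DP v * \<eta>1 y u + P y * (\<psi> y v * \<eta>2 y u + \<eta>1 y (\<Lambda> y u v)) +
          (DQ v * \<eta>2 y u + Q y * (- \<psi> y v * \<eta>1 y u + \<eta>2 y (\<Lambda> y u v)))))) (at y)"
    proof (rule has_derivative_transform_within_open[OF _ W_open y])
      show "((\<lambda>y. 2 * (P y * \<eta>1 y u + Q y * \<eta>2 y u)) has_derivative
       (\<lambda>v. 2 * (DP v * \<eta>1 y u + P y * (\<psi> y v * \<eta>2 y u + \<eta>1 y (\<Lambda> y u v)) +
          (DQ v * \<eta>2 y u + Q y * (- \<psi> y v * \<eta>1 y u + \<eta>2 y (\<Lambda> y u v)))))) (at y)"
        by (rule has_derivative_eq_rhs[OF has_derivative_mult_right[OF has_derivative_add[OF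
            has_derivative_mult[OF dP coframe_derivs(1)[OF y]]
           has_derivative_mult[OF dQ coframe_derivs(2)[OF y]]]]])
          (simp add: fun_eq_iff algebra_simps)
      show "2 * (P z * \<eta>1 z u + Q z * \<eta>2 z u) = frechet_derivative q (at z) u" if "z \<in> W" for z
        using fun_cong[OF frechet_derivative_at[OF dq[OF that]], of u] .
    qed
    from fun_cong[OF frechet_derivative_at[OF this], of v] show ?thesis by (rule sym)
  qed
  obtain f1 f2 where f: "\<eta>1 y f1 = 1" "\<eta>2 y f1 = 0" "\<eta>1 y f2 = 0" "\<eta>2 y f2 = 1"
    by (rule frame_vectors[OF y])
  have Ls: "\<Lambda> y f1 f2 = \<Lambda> y f2 f1" using tg y unfolding tg_frame_def by blast
  have "2 * (DP f2 + (P y * \<eta>1 y (\<Lambda> y f2 f1)) - Q y * \<psi> y f2 + Q y * \<eta>2 y (\<Lambda> y f2 f1)) =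
        2 * (P y * \<psi> y f1 + P y * \<eta>1 y (\<Lambda> y f2 f1) + DQ f1 + Q y * \<eta>2 y (\<Lambda> y f2 f1))"
    using symmetric_second_derivative[OF W_open sm y, of f1 f2] unfolding dd f Ls
        by (simp add: algebra_simps)
  then have "DP f2 - Q y * \<psi> y f2 = P y * \<psi> y f1 + DQ f1" by simp
  then have "3 * K * \<alpha> y * (\<beta>1 y * \<theta>1 y + \<beta>2 y * \<theta>2 y) = 0"
    unfolding DP_def DQ_def P_def Q_def f by (simp add: field_simps)
  then show ?thesis using \<alpha> K0 by simp
qed

lemma alpha_open: "open {y\<in>W. \<alpha> y \<noteq> 0}"
proof -
  have "open (W \<inter> \<alpha> -` (- {0}))"
    by (rule continuous_open_preimage[OF scalar_continuous(1) W_open]) auto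
  moreover have "W \<inter> \<alpha> -` (- {0}) = {y\<in>W. \<alpha> y \<noteq> 0}" by auto
  ultimately show ?thesis by simp
qed

text \<open>The derivative of \<open>gradient_orthogonal\<close> says that the vertical form, applied to the Killing
  field, is \<open>\<sigma>\<close> times the rotated gradient.\<close>

lemma killing_length:
  assumes y: "y \<in> W" and \<alpha>: "\<alpha> y \<noteq> 0"
  shows "((\<beta>1 y)\<^sup>2 + (\<beta>2 y)\<^sup>2)\<^sup>2 = (\<rho> y)\<^sup>2 * \<sigma> y * \<delta> y"
proof -
  note d = scalar_derivs[OF y] and alg = scalar_algebra[OF y]
  obtain f1 f2 where f: "\<eta>1 y f1 = 1" "\<eta>2 y f1 = 0" "\<eta>1 y f2 = 0" "\<eta>2 y f2 = 1"
    by (rule frame_vectors[OF y])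
  have z: "\<beta>1 y * \<theta>1 y + \<beta>2 y * \<theta>2 y = 0" by (rule gradient_orthogonal[OF y \<alpha>])
  note der = derivative_zero_of_constant[OF alpha_open _ has_derivative_add[OF has_derivative_mult[OF
      d(4) d(2)] has_derivative_mult[OF d(5) d(3)]],
       where c=0]
  have 1: "\<beta>1 y * (1 - A11 y) - \<beta>2 y * A12 y = - \<sigma> y * \<theta>2 y"
    using der[of f1] y \<alpha> gradient_orthogonal unfolding f by (simp add: algebra_simps)
  have 2: "- \<beta>1 y * A12 y + \<beta>2 y * (1 - A22 y) = \<sigma> y * \<theta>1 y"
    using der[of f2] y \<alpha> gradient_orthogonal unfolding f by (simp add: algebra_simps)
  show ?thesis using 1 2 z alg(1-4) by algebra
qed

text \<open>Along the field with components \<open>\<beta>2\<close>, \<open>- \<beta>1\<close> the derivative of \<open>killing_length\<close> expresses a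
  positive square as the negative of a nonnegative quantity.\<close>

lemma killing_field_zero:
  assumes y: "y \<in> W" and \<alpha>: "\<alpha> y \<noteq> 0"
  shows "\<beta>1 y = 0 \<and> \<beta>2 y = 0"
proof (rule ccontr)
  assume neg: "\<not> (\<beta>1 y = 0 \<and> \<beta>2 y = 0)"
  note d = scalar_derivs[OF y] and alg = scalar_algebra[OF y]
  define N where "N y = (\<beta>1 y)\<^sup>2 + (\<beta>2 y)\<^sup>2" for y
  have N0: "N y > 0" using neg unfolding N_def by (metis not_sum_power2_lt_zero sum_power2_eq_zero_iff
      linorder_neqE_linordered_idom)
  obtain f1 f2 where f: "\<eta>1 y f1 = 1" "\<eta>2 y f1 = 0" "\<eta>1 y f2 = 0" "\<eta>2 y f2 = 1"
    by (rule frame_vectors[OF y])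
  have z: "\<beta>1 y * \<theta>1 y + \<beta>2 y * \<theta>2 y = 0" by (rule gradient_orthogonal[OF y \<alpha>])
  have k: "(N y)\<^sup>2 = (\<rho> y)\<^sup>2 * \<sigma> y * \<delta> y" unfolding N_def by (rule killing_length[OF y \<alpha>])
  then have nz: "\<rho> y \<noteq> 0" "\<sigma> y \<noteq> 0" "\<delta> y \<noteq> 0" using N0 by auto
  \<comment> \<open>\<open>D\<sigma>\<close> is the derivative of \<open>\<sigma>\<close>, and \<open>L\<close> below that of the identity \<open>killing_length\<close>, which
      vanishes.\<close>
  define D\<sigma> where "D\<sigma> v = - (K / 2) * \<alpha> y * (\<theta>1 y * \<eta>1 y v + \<theta>2 y * \<eta>2 y v) -
      K / 2 * (K / 2 * ((A11 y * \<eta>1 y v + A12 y * \<eta>2 y v) * \<beta>2 y - (A12 y * \<eta>1 y v + A22 y * \<eta>2 y v) *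
          \<beta>1 y) * \<rho> y
        + \<alpha> y * (2 * (\<theta>1 y * \<eta>1 y v + \<theta>2 y * \<eta>2 y v)))" for v
  have d\<sigma>: "(\<sigma> has_derivative D\<sigma>) (at y)"
    unfolding \<sigma>_def D\<sigma>_def
    by (rule has_derivative_eq_rhs[OF has_derivative_diff[OF d(7) has_derivative_mult[OF
        has_derivative_mult_right[OF d(6)] d(1)]]])
      (simp add: fun_eq_iff algebra_simps)
  have dN: "(N has_derivative (\<lambda>v. 2 * \<sigma> y * (\<beta>2 y * \<eta>1 y v - \<beta>1 y * \<eta>2 y v))) (at y)"
    unfolding N_def power2_eq_square
    by (rule has_derivative_eq_rhs[OF has_derivative_add[OF has_derivative_mult[OF d(4) d(4)]
        has_derivative_mult[OF d(5) d(5)]]])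
      (simp add: fun_eq_iff algebra_simps)
  define L where "L v = 2 * N y * (2 * \<sigma> y * (\<beta>2 y * \<eta>1 y v - \<beta>1 y * \<eta>2 y v))
      - (2 * \<rho> y * (2 * (\<theta>1 y * \<eta>1 y v + \<theta>2 y * \<eta>2 y v)) * \<sigma> y * \<delta> y
        + (\<rho> y)\<^sup>2 * D\<sigma> v * \<delta> y + (\<rho> y)\<^sup>2 * \<sigma> y * (- (K / 2) * \<alpha> y * (\<theta>1 y * \<eta>1 y v + \<theta>2 y *
            \<eta>2 y v)))" for v
  have "((\<lambda>y. N y * N y - \<rho> y * \<rho> y * \<sigma> y * \<delta> y) has_derivative L) (at y)"
    by (rule has_derivative_eq_rhs[OF has_derivative_diff[OF has_derivative_mult[OF dN dN]
          has_derivative_mult[OF has_derivative_mult[OF has_derivative_mult[OF d(1) d(1)] d\<sigma>] d(7)]]])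
      (simp add: fun_eq_iff L_def power2_eq_square algebra_simps)
  then have L0: "L v = 0" for v
    by (rule derivative_zero_of_constant[OF alpha_open, where c=0, rotated])
      (use y \<alpha> killing_length in \<open>auto simp: N_def power2_eq_square\<close>)
  \<comment> \<open>The squared length of the horizontal part of the field with components \<open>\<beta>2\<close>, \<open>- \<beta>1\<close>\<close>
  define Ann where "Ann = A11 y * (\<beta>2 y)\<^sup>2 + 2 * A12 y * \<beta>2 y * (- \<beta>1 y) + A22 y * (- \<beta>1 y)\<^sup>2"
  have Ann: "Ann \<ge> 0" unfolding Ann_def by (rule scalar_signs(3))
  define \<kappa> where "\<kappa> = K / 2 * \<alpha> y * \<rho> y"
  have \<sigma>: "\<sigma> y = \<delta> y - \<kappa>" unfolding \<sigma>_def \<kappa>_def by simp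
  \<comment> \<open>The derivative along the field with components \<open>\<beta>2\<close>, \<open>- \<beta>1\<close>\<close>
  have "\<beta>2 y * L f1 - \<beta>1 y * L f2 = 0" using L0 by simp
  then have "4 * (N y)\<^sup>2 * \<sigma> y = 4 * (\<rho> y)\<^sup>2 * \<sigma> y * (\<delta> y)\<^sup>2 - 3 * (\<rho> y)\<^sup>2 * \<delta> y * (\<kappa> * \<delta> y)
     - (\<rho> y)\<^sup>2 * \<delta> y * (K\<^sup>2 / 4 * \<rho> y * Ann) - (\<rho> y)\<^sup>2 * \<sigma> y * \<kappa> * \<delta> y"
  proof -
    have lin: "\<beta>2 y * L f1 - \<beta>1 y * L f2 = 2 * N y * (2 * \<sigma> y * N y)
      - (4 * \<rho> y * (\<rho> y * \<delta> y) * \<sigma> y * \<delta> y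
        + (\<rho> y)\<^sup>2 * (- (K / 2) * \<alpha> y * (\<rho> y * \<delta> y) - K / 2 * (K / 2 * Ann * \<rho> y + \<alpha> y * (2 * (\<rho> y *
            \<delta> y)))) * \<delta> y
        + (\<rho> y)\<^sup>2 * \<sigma> y * (- (K / 2) * \<alpha> y * (\<rho> y * \<delta> y)))"
      unfolding L_def D\<sigma>_def f alg(4) Ann_def
      by (simp add: N_def power2_eq_square algebra_simps)
    show ?thesis using \<open>\<beta>2 y * L f1 - \<beta>1 y * L f2 = 0\<close> unfolding lin \<kappa>_def
        by (simp add: power2_eq_square field_simps)
  qed
  then have "(\<rho> y)\<^sup>2 * \<delta> y * (4 * (\<sigma> y)\<^sup>2) = (\<rho> y)\<^sup>2 * \<delta> y * (4 * \<sigma> y * \<delta> y - 3 * \<kappa> * \<delta> y - K\<^sup>2 / 4 *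
      \<rho> y * Ann - \<sigma> y * \<kappa>)"
    unfolding k by (simp add: power2_eq_square algebra_simps)
  then have "4 * (\<sigma> y)\<^sup>2 = 4 * \<sigma> y * \<delta> y - 3 * \<kappa> * \<delta> y - K\<^sup>2 / 4 * \<rho> y * Ann - \<sigma> y * \<kappa>"
    using nz by simp
  then have "3 * \<kappa>\<^sup>2 = - (K\<^sup>2 / 4 * \<rho> y * Ann)"
    unfolding \<sigma> by (simp add: power2_eq_square algebra_simps)
  moreover have "K\<^sup>2 / 4 * \<rho> y * Ann \<ge> 0" using Ann scalar_signs(1)[of y] by simp
  moreover have "\<kappa>\<^sup>2 > 0" using nz \<alpha> K0 unfolding \<kappa>_def by simp
  ultimately show False by linarith
qed

lemma alpha_nonzero_imp_zero_section:
  assumes y: "y \<in> W" and \<alpha>: "\<alpha> y \<noteq> 0"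
  shows "\<xi> y = 0"
proof -
  note d = scalar_derivs[OF y] and alg = scalar_algebra[OF y]
  obtain f1 f2 where f: "\<eta>1 y f1 = 1" "\<eta>2 y f1 = 0" "\<eta>1 y f2 = 0" "\<eta>2 y f2 = 1"
    by (rule frame_vectors[OF y])
  have b0: "\<beta>1 y = 0" "\<beta>2 y = 0" using killing_field_zero[OF y \<alpha>] by auto
  have "- \<psi> y f1 * \<beta>1 y + \<sigma> y * \<eta>1 y f1 = 0"
    by (rule derivative_zero_of_constant[OF alpha_open _ d(5), where c=0])
      (use y \<alpha> killing_field_zero in auto)
  then have "\<sigma> y = 0" using b0 f by simp
  then have e: "\<delta> y = K / 2 * \<alpha> y * \<rho> y" unfolding \<sigma>_def by simp
  have "\<rho> y * \<delta> y = 0" using alg(4) b0 by simp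
  then have "\<rho> y = 0" unfolding e using K0 \<alpha> by simp
  then show ?thesis by (simp add: scalar_signs)
qed

text \<open>On the zero section the vertical part vanishes, and the horizontal part is an isometry.\<close>

lemma alpha_nonzero_imp_unit:
  assumes y: "y \<in> W" and \<alpha>: "\<alpha> y \<noteq> 0"
  shows "(\<alpha> y)\<^sup>2 = 1"
proof -
  obtain f1 f2 where f: "\<eta>1 y f1 = 1" "\<eta>2 y f1 = 0" "\<eta>1 y f2 = 0" "\<eta>2 y f2 = 1"
    by (rule frame_vectors[OF y])
  have "of_real (\<eta>1 y v) * b1 y + of_real (\<eta>2 y v) * b2 y - \<i> * of_real (\<phi> y v) * \<xi> y = 0" for v
    by (rule derivative_zero_of_constant[OF alpha_open _ frame_derivs(5)[OF y], where c=0])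
      (use y \<alpha> alpha_nonzero_imp_zero_section in auto)
  from this[of f1] this[of f2] have "b1 y = 0" "b2 y = 0"
    using f alpha_nonzero_imp_zero_section[OF y \<alpha>] by auto
  then show ?thesis using scalar_algebra(5)[OF y] B_eq[OF y] by simp
qed

text \<open>The derivative of \<open>\<alpha> = 0\<close> says that \<open>n\<close>, with components \<open>\<beta>2\<close>, \<open>- \<beta>1\<close>, is in the kernel of
  the horizontal form \<open>A\<close>. By \<open>\<nabla>n = \<sigma> id\<close> one more derivative gives \<open>\<sigma> A = 0\<close>, and \<open>\<sigma> = \<delta>\<close> here.\<close>

lemma alpha_zero_cases:
  assumes U: "open U" "U \<subseteq> W" and \<alpha>: "\<And>y. y \<in> U \<Longrightarrow> \<alpha> y = 0" and y: "y \<in> U"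
  shows "\<delta> y = 0 \<or> (a1 y = 0 \<and> a2 y = 0)" "a1 y = 0 \<and> a2 y = 0 \<Longrightarrow> (\<delta> y)\<^sup>2 = 1"
    "\<delta> y = 0 \<Longrightarrow> \<beta>1 y = 0 \<and> \<beta>2 y = 0"
proof -
  have An: "A11 y * \<beta>2 y - A12 y * \<beta>1 y = 0 \<and> A12 y * \<beta>2 y - A22 y * \<beta>1 y = 0" if y: "y \<in> U" for y
  proof -
    have yW: "y \<in> W" using y U by auto
    obtain f1 f2 where f: "\<eta>1 y f1 = 1" "\<eta>2 y f1 = 0" "\<eta>1 y f2 = 0" "\<eta>2 y f2 = 1"
      by (rule frame_vectors[OF yW])
    have "K / 2 * ((A11 y * \<eta>1 y v + A12 y * \<eta>2 y v) * \<beta>2 y - (A12 y * \<eta>1 y v + A22 y * \<eta>2 y v) *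
        \<beta>1 y) = 0" for v
      by (rule derivative_zero_of_constant[OF U(1) y scalar_derivs(6)[OF yW] \<alpha>])
    from this[of f1] this[of f2] show ?thesis using K0 f by simp
  qed
  have yW: "y \<in> W" using y U by auto
  note d = scalar_derivs[OF yW] and alg = scalar_algebra[OF yW] and \<alpha>y = \<alpha>[OF y]
  obtain f1 f2 where f: "\<eta>1 y f1 = 1" "\<eta>2 y f1 = 0" "\<eta>1 y f2 = 0" "\<eta>2 y f2 = 1"
    by (rule frame_vectors[OF yW])
  note d1 = derivative_zero_of_constant[OF U(1) y has_derivative_diff[OF has_derivative_mult[OF d(8)
      d(5)] has_derivative_mult[OF d(9) d(4)]] An[THEN conjunct1]]
  note d2 = derivative_zero_of_constant[OF U(1) y has_derivative_diff[OF has_derivative_mult[OF d(9)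
      d(5)] has_derivative_mult[OF d(10) d(4)]] An[THEN conjunct2]]
  have \<sigma>: "\<sigma> y = \<delta> y" unfolding \<sigma>_def using \<alpha>y by simp
  have "\<delta> y * A11 y = 0"
    using d1[of f1] An[OF y] unfolding f \<sigma> \<alpha>y by (simp add: algebra_simps)
  moreover have "\<delta> y * A22 y = 0"
    using d2[of f2] An[OF y] unfolding f \<sigma> \<alpha>y by algebra
  moreover have "A11 y = 0 \<longleftrightarrow> a1 y = 0" "A22 y = 0 \<longleftrightarrow> a2 y = 0"
    unfolding A11_def A22_def by (simp_all add: complex_eq_iff sum_squares_eq_zero_iff)
  ultimately show "\<delta> y = 0 \<or> (a1 y = 0 \<and> a2 y = 0)" by auto
  show "a1 y = 0 \<and> a2 y = 0 \<Longrightarrow> (\<delta> y)\<^sup>2 = 1"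
    unfolding alg(6) A11_def A12_def A22_def by simp
  show "\<beta>1 y = 0 \<and> \<beta>2 y = 0" if \<delta>: "\<delta> y = 0"
  proof -
    have "\<rho> y * \<beta>1 y = 0" "\<rho> y * \<beta>2 y = 0"
      using An[OF y] alg(1-4) \<delta> by algebra+
    moreover have "\<rho> y = 0 \<Longrightarrow> \<beta>1 y = 0 \<and> \<beta>2 y = 0"
      unfolding scalar_signs \<beta>1_def \<beta>2_def by simp
    ultimately show ?thesis by auto
  qed
qed

text \<open>The type is constant near \<open>y0\<close> because \<open>\<alpha>\<^sup>2\<close> takes only the values \<open>0\<close> and \<open>1\<close>, and so does
  \<open>\<delta>\<^sup>2\<close> where \<open>\<alpha> = 0\<close>, while both functions are continuous.\<close>

lemma frame_classification:
  assumes y0: "y0 \<in> W"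
  shows "\<exists>U. open U \<and> y0 \<in> U \<and> U \<subseteq> W \<and>
    ((\<forall>y\<in>U. \<xi> y = 0) \<or> (\<forall>y\<in>U. a1 y = 0 \<and> a2 y = 0) \<or>
     (\<forall>y\<in>U. \<alpha> y = 0 \<and> \<delta> y = 0 \<and> \<beta>1 y = 0 \<and> \<beta>2 y = 0 \<and> \<not> (a1 y = 0 \<and> a2 y = 0) \<and> \<not> (b1 y = 0 \<and> b2 y =
         0)))"
proof (cases "\<alpha> y0 = 0")
  case False
  show ?thesis
    by (rule exI[of _ "{y\<in>W. \<alpha> y \<noteq> 0}"])
      (use False y0 alpha_open alpha_nonzero_imp_zero_section in auto)
next
  case True
  define U where "U = W \<inter> \<alpha> -` {-1<..<1}"
  have U: "open U" "U \<subseteq> W"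
    unfolding U_def using continuous_open_preimage[OF scalar_continuous(1) W_open, of "{-1<..<1}"]
        by auto
  have y0U: "y0 \<in> U" using True y0 unfolding U_def by simp
  have \<alpha>0: "\<alpha> y = 0" if "y \<in> U" for y
    using alpha_nonzero_imp_unit[of y] that unfolding U_def by (auto simp: power2_eq_1_iff)
  note cases = alpha_zero_cases[OF U \<alpha>0]
  have \<delta>c: "continuous_on U \<delta>" using scalar_continuous(2) U(2) by (rule continuous_on_subset)
  show ?thesis
  proof (cases "\<delta> y0 = 0")
    case False
    have "open (U \<inter> \<delta> -` (- {0}))"
      by (rule continuous_open_preimage[OF \<delta>c U(1)]) auto
    then show ?thesis
      by (intro exI[of _ "U \<inter> \<delta> -` (- {0})"]) (use False y0U U cases(1) in auto)
  next
    case True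
    have o: "open (U \<inter> \<delta> -` {-1<..<1})"
      by (rule continuous_open_preimage[OF \<delta>c U(1)]) auto
    have \<delta>0: "\<delta> y = 0" "\<not> (a1 y = 0 \<and> a2 y = 0)" if "y \<in> U \<inter> \<delta> -` {-1<..<1}" for y
      using cases(1,2)[of y] that by (auto simp: power2_eq_1_iff)
    have b: "\<not> (b1 y = 0 \<and> b2 y = 0)" if "y \<in> U" for y
    proof
      assume "b1 y = 0 \<and> b2 y = 0"
      then have "(\<alpha> y)\<^sup>2 = 1" using scalar_algebra(5)[of y] B_eq[of y] that U(2) by auto
      then show False using \<alpha>0[OF that] by simp
    qed
    show ?thesis
      by (intro exI[of _ "U \<inter> \<delta> -` {-1<..<1}"]) (use o True y0U U \<alpha>0 \<delta>0 cases(3) b in auto)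
  qed
qed

end

lemma tg_system_classification:
  assumes tg: "tg_system W K a b \<xi> \<phi> \<Lambda>" and K: "K \<noteq> 0" and y0: "y0 \<in> W"
  shows "\<exists>U. open U \<and> y0 \<in> U \<and> U \<subseteq> W \<and>
    ((\<forall>y\<in>U. \<xi> y = 0) \<or> (\<forall>y\<in>U. \<forall>u. a y u = 0) \<or>
     (\<forall>y\<in>U. (\<forall>u v. Im (cnj (a y u) * a y v) = 0 \<and> Im (cnj (b y u) * b y v) = 0) \<and>
       (\<forall>u. Im (cnj (\<xi> y) * b y u) = 0) \<and> (\<exists>u. a y u \<noteq> 0) \<and> (\<exists>u. b y u \<noteq> 0)))"
proof -
  obtain f1 f2 \<eta>1 \<eta>2 \<psi> where fr: "tg_frame W K (\<lambda>y. a y (f1 y)) (\<lambda>y. a y (f2 y)) (\<lambda>y. b y (f1 y)) (\<lambda>y. b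
      y (f2 y)) \<xi> \<eta>1 \<eta>2 \<phi> \<psi> \<Lambda>"
    and ex: "\<And>y u. y \<in> W \<Longrightarrow> u = \<eta>1 y u *\<^sub>R f1 y + \<eta>2 y u *\<^sub>R f2 y"
    using tg_system_frame[OF tg] by blast
  have av: "a y v = of_real (\<eta>1 y v) * a y (f1 y) + of_real (\<eta>2 y v) * a y (f2 y)"
    and bv: "b y v = of_real (\<eta>1 y v) * b y (f1 y) + of_real (\<eta>2 y v) * b y (f2 y)" if y: "y \<in> W"
        for y v
  proof -
    have l: "linear (a y)" "linear (b y)" using tg y by (auto simp: tg_system_def)
    show "a y v = of_real (\<eta>1 y v) * a y (f1 y) + of_real (\<eta>2 y v) * a y (f2 y)"
      "b y v = of_real (\<eta>1 y v) * b y (f1 y) + of_real (\<eta>2 y v) * b y (f2 y)"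
      using arg_cong[OF ex[OF y, of v], of "a y"] arg_cong[OF ex[OF y, of v], of "b y"]
      by (simp_all add: linear_add[OF l(1)] linear_cmul[OF l(1)] linear_add[OF l(2)] linear_cmul[OF
          l(2)]
        scaleR_conv_of_real[where 'a=complex])
  qed
  note defs = \<alpha>_def[OF fr K] \<delta>_def[OF fr K] \<beta>1_def[OF fr K] \<beta>2_def[OF fr K]
  obtain U where U: "open U" "y0 \<in> U" "U \<subseteq> W" and
    c: "(\<forall>y\<in>U. \<xi> y = 0) \<or> (\<forall>y\<in>U. a y (f1 y) = 0 \<and> a y (f2 y) = 0) \<or>
     (\<forall>y\<in>U. Im (cnj (a y (f1 y)) * a y (f2 y)) = 0 \<and> Im (cnj (b y (f1 y)) * b y (f2 y)) = 0 \<and>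
        Im (cnj (\<xi> y) * b y (f1 y)) = 0 \<and> Im (cnj (\<xi> y) * b y (f2 y)) = 0 \<and>
        \<not> (a y (f1 y) = 0 \<and> a y (f2 y) = 0) \<and> \<not> (b y (f1 y) = 0 \<and> b y (f2 y) = 0))"
    using frame_classification[OF fr K y0] unfolding defs by blast
  have lin: "Im (cnj (of_real p * z + of_real q * w) * (of_real r * z + of_real s * w)) =
      (p * s - q * r) * Im (cnj z * w)"
    "Im (cnj x * (of_real p * z + of_real q * w)) = p * Im (cnj x * z) + q * Im (cnj x * w)"
        for p q r s z w x
    by (simp_all add: algebra_simps)
  have c1: "a y u = 0" if "y \<in> W" "a y (f1 y) = 0" "a y (f2 y) = 0" for y u
    by (subst av[OF that(1)]) (simp add: that)
  have c2: "Im (cnj (a y u) * a y v) = 0" if "y \<in> W" "Im (cnj (a y (f1 y)) * a y (f2 y)) = 0" for y u v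
    by (subst av[OF that(1), of u], subst av[OF that(1), of v]) (simp only: lin(1) that mult_zero_right)
  have c3: "Im (cnj (b y u) * b y v) = 0" if "y \<in> W" "Im (cnj (b y (f1 y)) * b y (f2 y)) = 0" for y u v
    by (subst bv[OF that(1), of u], subst bv[OF that(1), of v]) (simp only: lin(1) that mult_zero_right)
  have c4: "Im (cnj (\<xi> y) * b y u) = 0" if "y \<in> W" "Im (cnj (\<xi> y) * b y (f1 y)) = 0"
      "Im (cnj (\<xi> y) * b y (f2 y)) = 0" for y u
    by (subst bv[OF that(1), of u]) (simp only: lin(2) that mult_zero_right add_0)
  have a0: "\<exists>u. a y u \<noteq> 0" if "\<not> (a y (f1 y) = 0 \<and> a y (f2 y) = 0)" for y using that by blast
  have b0: "\<exists>u. b y u \<noteq> 0" if "\<not> (b y (f1 y) = 0 \<and> b y (f2 y) = 0)" for y using that by blast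
  have UW: "y \<in> W" if "y \<in> U" for y using that U(3) by (rule rev_subsetD)
  show ?thesis
  proof (intro exI[of _ U] conjI U)
    from c show "(\<forall>y\<in>U. \<xi> y = 0) \<or> (\<forall>y\<in>U. \<forall>u. a y u = 0) \<or>
     (\<forall>y\<in>U. (\<forall>u v. Im (cnj (a y u) * a y v) = 0 \<and> Im (cnj (b y u) * b y v) = 0) \<and>
       (\<forall>u. Im (cnj (\<xi> y) * b y u) = 0) \<and> (\<exists>u. a y u \<noteq> 0) \<and> (\<exists>u. b y u \<noteq> 0))"
    proof (elim disjE)
      assume "\<forall>y\<in>U. a y (f1 y) = 0 \<and> a y (f2 y) = 0"
      then have "\<forall>y\<in>U. \<forall>u. a y u = 0" using c1[OF UW] by simp
      then show ?thesis by simp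
    next
      assume *: "\<forall>y\<in>U. Im (cnj (a y (f1 y)) * a y (f2 y)) = 0 \<and> Im (cnj (b y (f1 y)) * b y (f2 y)) = 0 \<and>
        Im (cnj (\<xi> y) * b y (f1 y)) = 0 \<and> Im (cnj (\<xi> y) * b y (f2 y)) = 0 \<and>
        \<not> (a y (f1 y) = 0 \<and> a y (f2 y) = 0) \<and> \<not> (b y (f1 y) = 0 \<and> b y (f2 y) = 0)"
      show ?thesis
      proof (intro disjI2 ballI conjI allI)
        fix y u v assume y: "y \<in> U"
        note h = bspec[OF * y]
        show "Im (cnj (a y u) * a y v) = 0" by (rule c2[OF UW[OF y]]) (rule h[THEN conjunct1])
        show "Im (cnj (b y u) * b y v) = 0" by (rule c3[OF UW[OF y]]) (rule h[THEN conjunct2, THEN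
            conjunct1])
        show "Im (cnj (\<xi> y) * b y u) = 0"
          by (rule c4[OF UW[OF y]]) (rule h[THEN conjunct2, THEN conjunct2, THEN conjunct1]
             h[THEN conjunct2, THEN conjunct2, THEN conjunct2, THEN conjunct1])+
      next
        fix y assume y: "y \<in> U"
        note h = bspec[OF * y, THEN conjunct2, THEN conjunct2, THEN conjunct2, THEN conjunct2]
        show "\<exists>u. a y u \<noteq> 0" by (rule a0[OF h[THEN conjunct1]])
        show "\<exists>u. b y u \<noteq> 0" by (rule b0[OF h[THEN conjunct2]])
      qed
    qed simp
  qed
qed

section \<open>Parallel unit fields along the surface\<close>

text \<open>The length of \<open>P\<close> grows by the real part \<open>c\<close> of the factor, so dividing by it leaves the
  rotation.\<close>

lemma normalised_parallel:
  fixes P :: "real^2 \<Rightarrow> complex"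
  assumes P: "(P has_derivative (\<lambda>v. (of_real (c v) - \<i> * of_real (\<phi> v)) * P y)) (at y)" "P y \<noteq> 0"
  shows "((\<lambda>y. of_real (inverse (sqrt (Re (cnj (P y) * P y)))) * P y) has_derivative
    (\<lambda>v. - \<i> * of_real (\<phi> v) * (of_real (inverse (sqrt (Re (cnj (P y) * P y)))) * P y))) (at y)"
proof -
  define N where "N y = Re (cnj (P y) * P y)" for y
  have N0: "N y > 0"
    unfolding N_def using P(2) by (auto simp: complex_eq_iff sum_squares_gt_zero_iff)
  have dN: "(N has_derivative (\<lambda>v. 2 * c v * N y)) (at y)"
    unfolding N_def
    by (rule has_derivative_eq_rhs[OF has_derivative_Re_cnj[OF P(1) P(1)]])
      (simp add: fun_eq_iff algebra_simps)
  have "((\<lambda>x. inverse (sqrt x)) has_real_derivative - (inverse (sqrt (N y)) / (2 * N y))) (at (N y))"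
    using N0 by (auto intro!: derivative_eq_intros simp: field_simps power2_eq_square)
  then have "((\<lambda>y. inverse (sqrt (N y))) has_derivative
      (\<lambda>v. - (inverse (sqrt (N y)) / (2 * N y)) * (2 * c v * N y))) (at y)"
    unfolding has_field_derivative_def by (rule has_derivative_compose[OF dN])
  then have dI: "((\<lambda>y. inverse (sqrt (N y))) has_derivative (\<lambda>v. - c v * inverse (sqrt (N y)))) (at y)"
    by (rule has_derivative_eq_rhs) (use N0 in \<open>simp add: fun_eq_iff\<close>)
  show ?thesis unfolding N_def[symmetric]
    by (rule has_derivative_eq_rhs[OF has_derivative_mult[OF has_derivative_of_real[OF dI] P(1)]])
      (simp add: fun_eq_iff algebra_simps)
qed

text \<open>A unit vector field along the projection of the surface \<open>r\<close> to the base, with vanishing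
  covariant derivatives in all directions of the surface.\<close>

definition parallel_unit where
  "parallel_unit G r U T \<longleftrightarrow> smooth_on U T \<and> (\<forall>y\<in>U. G (fst (r y)) (T y) (T y) = 1 \<and>
     (T has_derivative (\<lambda>v. - chr G (fst (r y)) (fst (frechet_derivative r (at y) v)) (T y))) (at y))"
  for G :: "real^2 \<Rightarrow> real^2 \<Rightarrow> real^2 \<Rightarrow> real" and r :: "real^2 \<Rightarrow> (real^2) \<times> (real^2)"

context
  fixes X :: "(real^2) set" and G E F
  assumes XG: "riem_metric X G" and EF: "orthonormal_frame X G E F"
begin

lemma normalised_parallel_unit:
  assumes r: "open U" "smooth_on U r" "r ` U \<subseteq> X \<times> UNIV" and p: "smooth_on U p"
    and P: "\<And>y. y \<in> U \<Longrightarrow> p y \<noteq> 0" "\<And>y. y \<in> U \<Longrightarrow> \<exists>c. ((\<lambda>y. frame_comp G E F (fst (r y)) (p y))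
        has_derivative
      (\<lambda>v. (of_real (c v) - \<i> * of_real (conn_form G E F (fst (r y)) (fst (frechet_derivative r (at y)
          v)))) *
         frame_comp G E F (fst (r y)) (p y))) (at y)"
  shows "parallel_unit G r U (\<lambda>y. inverse (sqrt (G (fst (r y)) (p y) (p y))) *\<^sub>R p y)"
  unfolding parallel_unit_def
proof (intro conjI ballI)
  define x where "x y = fst (r y)" for y
  have xX: "x y \<in> X" if "y \<in> U" for y using r(3) that unfolding x_def by auto
  have smx: "smooth_on U x" unfolding x_def by (rule smooth_on_fst[OF r(1,2)])
  have Gpos: "G (x y) (p y) (p y) > 0" if "y \<in> U" for y
    by (rule pd_formD(3)[OF pd_G[OF XG xX[OF that]] P(1)[OF that]])
  have smG: "smooth_on U (\<lambda>y. G (x y) (p y) (p y))"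
  proof (rule smooth_on_bilinear_family[where B="\<lambda>y. G (x y)", OF r(1) _ _ p p])
    show "bilinear (G (x y))" if "y \<in> U" for y using xX[OF that] pd_formD(1)[OF pd_G[OF XG]] by blast
    show "smooth_on U (\<lambda>y. G (x y) u w)" for u w
      by (rule smooth_on_compose[OF r(1) open_X[OF XG] smx smooth_G[OF XG]]) (use xX in auto)
  qed
  define T where "T y = inverse (sqrt (G (x y) (p y) (p y))) *\<^sub>R p y" for y
  show smT: "smooth_on U (\<lambda>y. inverse (sqrt (G (fst (r y)) (p y) (p y))) *\<^sub>R p y)"
    unfolding x_def[symmetric] by (intro smooth_on_scaleR smooth_on_inverse_sqrt r(1) smG p Gpos)
  fix y assume y: "y \<in> U"
  note Gs = G_simps[OF XG xX[OF y]]
  show "G (fst (r y)) (inverse (sqrt (G (fst (r y)) (p y) (p y))) *\<^sub>R p y) (inverse (sqrt (G (fst (r y))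
      (p y) (p y))) *\<^sub>R p y) = 1"
    unfolding x_def[symmetric] Gs using Gpos[OF y] by (simp add: field_simps)
  have dT: "(T has_derivative frechet_derivative T (at y)) (at y)"
    by (rule smooth_on_has_derivative[OF _ y]) (use smT in \<open>simp add: T_def[abs_def] x_def\<close>)
  have dx: "(x has_derivative (\<lambda>v. fst (frechet_derivative r (at y) v))) (at y)"
    unfolding x_def by (rule has_derivative_fst[OF smooth_on_has_derivative[OF r(2) y]])
  define P where "P y = frame_comp G E F (x y) (p y)" for y
  obtain c where c: "(P has_derivative (\<lambda>v. (of_real (c v) - \<i> *
      of_real (conn_form G E F (x y) (fst (frechet_derivative r (at y) v)))) * P y)) (at y)"
    using P(2)[OF y] unfolding P_def x_def by blast
  have P0: "P y \<noteq> 0" using frame_comp_inj[OF XG EF xX[OF y]] P(1)[OF y] unfolding P_def by blast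
  have TP: "frame_comp G E F (x z) (T z) = of_real (inverse (sqrt (Re (cnj (P z) * P z)))) * P z"
      if z: "z \<in> U" for z
  proof -
    have "G (x z) (p z) (p z) = Re (cnj (P z) * P z)"
      unfolding P_def using frame_metric[OF XG EF xX[OF z], of "p z" "p z"] by simp
    then show ?thesis unfolding T_def P_def
      by (simp add: linear_cmul[OF frame_comp_linear[OF XG EF xX[OF z]]] scaleR_conv_of_real[where
          'a=complex])
  qed
  have "((\<lambda>y. frame_comp G E F (x y) (T y)) has_derivative
    (\<lambda>v. - \<i> * of_real (conn_form G E F (x y) (fst (frechet_derivative r (at y) v))) *
        frame_comp G E F (x y) (T y))) (at y)"
    unfolding TP[OF y]
    by (rule has_derivative_transform_within_open[OF normalised_parallel[OF c P0] r(1) y]) (rule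
        TP[symmetric])
  from has_derivative_unique[OF this frame_comp_has_derivative[where f=x and y=y, OF XG EF xX[OF y] dx
      dT]]
  have "frame_comp G E F (x y) (frechet_derivative T (at y) v +
      chr G (x y) (fst (frechet_derivative r (at y) v)) (T y)) = 0" for v
    by (auto dest: fun_cong[of _ _ v])
  then have "frechet_derivative T (at y) v + chr G (x y) (fst (frechet_derivative r (at y) v)) (T y) =
      0" for v
    by (rule frame_comp_inj[OF XG EF xX[OF y]])
  then have "frechet_derivative T (at y) = (\<lambda>v. -
      chr G (x y) (fst (frechet_derivative r (at y) v)) (T y))"
    by (auto simp: eq_neg_iff_add_eq_0)
  with dT show "((\<lambda>y. inverse (sqrt (G (fst (r y)) (p y) (p y))) *\<^sub>R p y) has_derivative
     (\<lambda>v. - chr G (fst (r y)) (fst (frechet_derivative r (at y) v)) (inverse (sqrt (G (fst (r y)) (p y)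
         (p y))) *\<^sub>R p y))) (at y)"
    unfolding T_def x_def by simp
qed

text \<open>If \<open>a\<close> and \<open>b\<close> have rank one and \<open>\<beta> = 0\<close>, then by the equations of the surface the covariant
  derivatives of \<open>a u0\<close> and \<open>b u1\<close> are multiples of these fields, so that they become parallel
  after normalisation. The form \<open>ds\<close> is closed since \<open>T\<close> is parallel and \<open>\<Lambda>\<close> is symmetric, while
  \<open>\<tau>\<close> can be written down. The condition on \<open>T y \<bullet> T y0\<close> keeps the base curve moving to one side,
  so that it will be embedded.\<close>

lemma cylinder_fields:
  assumes tg: "tg_immersion X G W r" and K: "const_curv X G K" and U0: "open U0" "U0 \<subseteq> W" "y0 \<in> U0"
  defines "x \<equiv> \<lambda>y. fst (r y)" and "hor \<equiv> \<lambda>y u. fst (frechet_derivative r (at y) u)"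
    and "ver \<equiv> \<lambda>y u. vert G (r y) (frechet_derivative r (at y) u)"
  defines "a \<equiv> \<lambda>y u. frame_comp G E F (x y) (hor y u)" and "b \<equiv> \<lambda>y u. frame_comp G E F (x y) (ver y u)"
    and "\<xi> \<equiv> \<lambda>y. frame_comp G E F (x y) (snd (r y))"
  assumes C: "\<And>y u v. y \<in> U0 \<Longrightarrow> Im (cnj (a y u) * a y v) = 0"
      "\<And>y u v. y \<in> U0 \<Longrightarrow> Im (cnj (b y u) * b y v) = 0"
    "\<And>y u. y \<in> U0 \<Longrightarrow> Im (cnj (\<xi> y) * b y u) = 0" and n0: "a y0 u0 \<noteq> 0" "b y0 u1 \<noteq> 0"
  obtains U T N s \<tau> where "open U" "y0 \<in> U" "U \<subseteq> U0" "parallel_unit G r U T" "parallel_unit G r U N"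
    "smooth_on U s" "smooth_on U \<tau>" "\<And>y. y \<in> U \<Longrightarrow> T y \<bullet> T y0 > 0"
    "\<And>y v. y \<in> U \<Longrightarrow> hor y v = frechet_derivative s (at y) v *\<^sub>R T y"
    "\<And>y v. y \<in> U \<Longrightarrow> ver y v = frechet_derivative \<tau> (at y) v *\<^sub>R N y"
    "\<And>y. y \<in> U \<Longrightarrow> snd (r y) = \<tau> y *\<^sub>R N y"
proof -
  have W: "open W" and r: "smooth_on W r" and rX: "\<And>y. y \<in> W \<Longrightarrow> x y \<in> X"
    using tg unfolding tg_immersion_def x_def by auto
  define \<phi> where "\<phi> y v = conn_form G E F (x y) (hor y v)" for y v
  obtain \<Lambda> where sys: "tg_system W K a b \<xi> \<phi> \<Lambda>"
    using tg_immersion_system[OF XG EF tg K]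
    unfolding a_def b_def \<xi>_def \<phi>_def[abs_def] x_def hor_def ver_def by blast
  have sa: "smooth_on W (\<lambda>y. a y u)" and sb: "smooth_on W (\<lambda>y. b y u)" for u
    using sys by (auto simp: tg_system_def)
  have Ls: "\<Lambda> y u v = \<Lambda> y v u"
    and da0: "((\<lambda>y. a y u) has_derivative (\<lambda>v. a y (\<Lambda> y u v)
          + \<i> * of_real (K / 2 * Im (cnj (\<xi> y) * b y u)) * a y v
          + \<i> * of_real (K / 2 * Im (cnj (\<xi> y) * b y v)) * a y u - \<i> * of_real (\<phi> y v) * a y u)) (at y)"
    and db0: "((\<lambda>y. b y u) has_derivative (\<lambda>v. b y (\<Lambda> y u v)
          - \<i> * of_real (K / 2 * Im (cnj (a y v) * a y u)) * \<xi> y - \<i> * of_real (\<phi> y v) * b y u)) (at y)"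
    and la: "linear (a y)"
    if "y \<in> W" for y u v
    using sys that unfolding tg_system_def by blast+
  have da: "((\<lambda>y. a y u) has_derivative (\<lambda>v. a y (\<Lambda> y u v) - \<i> * of_real (\<phi> y v) * a y u)) (at y)"
    if y: "y \<in> U0" for y u
    using da0[of y u] y U0(2) unfolding C(3)[OF y] by auto
  have db: "((\<lambda>y. b y u) has_derivative (\<lambda>v. b y (\<Lambda> y u v) - \<i> * of_real (\<phi> y v) * b y u)) (at y)"
    if y: "y \<in> U0" for y u
    using db0[of y u] y U0(2) unfolding C(1)[OF y] by auto
  have mult: "z = of_real (Re (cnj p * z) / Re (cnj p * p)) * p" if "p \<noteq> 0" "Im (cnj p * z) = 0"
      for p z :: complex
  proof -
    define A where "A = Re (cnj p * z)"
    define B where "B = Re (cnj p * p)"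
    have "of_real B * z = of_real A * p"
      using that(2) unfolding A_def B_def by (simp add: complex_eq_iff) algebra
    moreover have "B \<noteq> 0" using that(1) unfolding B_def
        by (simp add: complex_eq_iff sum_squares_eq_zero_iff)
    ultimately have "z = of_real (A / B) * p" by (simp add: field_simps)
    then show ?thesis unfolding A_def B_def .
  qed
  have par: "\<exists>k. w = k *\<^sub>R p" if h: "y \<in> W" "frame_comp G E F (x y) p \<noteq> 0"
      "Im (cnj (frame_comp G E F (x y) p) * frame_comp G E F (x y) w) = 0" for y p w
  proof -
    note l = frame_comp_linear[OF XG EF rX[OF h(1)]]
    obtain k :: real where "frame_comp G E F (x y) w = of_real k * frame_comp G E F (x y) p"
        using mult[OF h(2,3)] by blast
    then have "frame_comp G E F (x y) (w - k *\<^sub>R p) = 0"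
      by (simp add: linear_diff[OF l] linear_cmul[OF l] scaleR_conv_of_real[where 'a=complex])
    then have "w - k *\<^sub>R p = 0" by (rule frame_comp_inj[OF XG EF rX[OF h(1)]])
    then show ?thesis by auto
  qed
  have smh: "smooth_on W (\<lambda>y. hor y u)" and smv: "smooth_on W (\<lambda>y. ver y u)" for u
    unfolding hor_def ver_def by (rule smooth_horizontal_vertical[OF tg])+
  define U1 where "U1 = {y \<in> U0. a y u0 \<noteq> 0} \<inter> {y \<in> U0. b y u1 \<noteq> 0}"
  have o: "open {y \<in> U0. f y \<noteq> (0::complex)}" if "continuous_on U0 f" for f
  proof -
    have "open (U0 \<inter> f -` (- {0}))" by (rule continuous_open_preimage[OF that U0(1)]) auto
    moreover have "U0 \<inter> f -` (- {0}) = {y \<in> U0. f y \<noteq> 0}" by auto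
    ultimately show ?thesis by simp
  qed
  have U1: "open U1" "U1 \<subseteq> U0" "U1 \<subseteq> W" "y0 \<in> U1"
    unfolding U1_def using U0 n0
    by (auto intro!: open_Int o smooth_on_continuous smooth_on_subset[OF sa] smooth_on_subset[OF sb])
  have rU1: "r ` U1 \<subseteq> X \<times> UNIV" using tg U1(3) unfolding tg_immersion_def by blast
  define T where "T y = inverse (sqrt (G (x y) (hor y u0) (hor y u0))) *\<^sub>R hor y u0" for y
  define N where "N y = inverse (sqrt (G (x y) (ver y u1) (ver y u1))) *\<^sub>R ver y u1" for y
  have fc0: "frame_comp G E F (x y) 0 = 0" if "y \<in> W" for y
    using linear_0[OF frame_comp_linear[OF XG EF rX[OF that]]] .
  have T: "parallel_unit G r U1 T"
    unfolding T_def x_def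
  proof (rule normalised_parallel_unit[OF U1(1) smooth_on_subset[OF r U1(3)] rU1 smooth_on_subset[OF smh
      U1(3)]])
    fix y assume y: "y \<in> U1"
    then have yU: "y \<in> U0" "y \<in> W" "a y u0 \<noteq> 0" using U1 by (auto simp: U1_def)
    show "hor y u0 \<noteq> 0" using yU(3) fc0[OF yU(2)] unfolding a_def by auto
    define c where "c v = Re (cnj (a y u0) * a y (\<Lambda> y u0 v)) / Re (cnj (a y u0) * a y u0)" for v
    have "a y (\<Lambda> y u0 v) = of_real (c v) * a y u0" for v
      unfolding c_def by (rule mult[OF yU(3) C(1)[OF yU(1)]])
    then have "((\<lambda>y. a y u0) has_derivative (\<lambda>v. (of_real (c v) - \<i> * of_real (\<phi> y v)) *
        a y u0)) (at y)"
      using da[OF yU(1), of u0] by (simp add: left_diff_distrib)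
    then show "\<exists>c. ((\<lambda>y. frame_comp G E F (fst (r y)) (hor y u0)) has_derivative
      (\<lambda>v. (of_real (c v) - \<i> * of_real (conn_form G E F (fst (r y)) (fst (frechet_derivative r (at y)
          v)))) *
         frame_comp G E F (fst (r y)) (hor y u0))) (at y)"
      unfolding a_def \<phi>_def x_def hor_def by blast
  qed
  have N: "parallel_unit G r U1 N"
    unfolding N_def x_def
  proof (rule normalised_parallel_unit[OF U1(1) smooth_on_subset[OF r U1(3)] rU1 smooth_on_subset[OF smv
      U1(3)]])
    fix y assume y: "y \<in> U1"
    then have yU: "y \<in> U0" "y \<in> W" "b y u1 \<noteq> 0" using U1 by (auto simp: U1_def)
    show "ver y u1 \<noteq> 0" using yU(3) fc0[OF yU(2)] unfolding b_def by auto
    define c where "c v = Re (cnj (b y u1) * b y (\<Lambda> y u1 v)) / Re (cnj (b y u1) * b y u1)" for v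
    have "b y (\<Lambda> y u1 v) = of_real (c v) * b y u1" for v
      unfolding c_def by (rule mult[OF yU(3) C(2)[OF yU(1)]])
    then have "((\<lambda>y. b y u1) has_derivative (\<lambda>v. (of_real (c v) - \<i> * of_real (\<phi> y v)) *
        b y u1)) (at y)"
      using db[OF yU(1), of u1] by (simp add: left_diff_distrib)
    then show "\<exists>c. ((\<lambda>y. frame_comp G E F (fst (r y)) (ver y u1)) has_derivative
      (\<lambda>v. (of_real (c v) - \<i> * of_real (conn_form G E F (fst (r y)) (fst (frechet_derivative r (at y)
          v)))) *
         frame_comp G E F (fst (r y)) (ver y u1))) (at y)"
      unfolding b_def \<phi>_def x_def hor_def by blast
  qed
  have T1: "G (x y) (T y) (T y) = 1" and N1: "G (x y) (N y) (N y) = 1"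
    and dT: "(T has_derivative (\<lambda>v. - chr G (x y) (hor y v) (T y))) (at y)"
    and dN: "(N has_derivative (\<lambda>v. - chr G (x y) (hor y v) (N y))) (at y)" if "y \<in> U1" for y
    using T N that unfolding parallel_unit_def x_def hor_def by auto
  have smT: "smooth_on U1 T" and smN: "smooth_on U1 N" using T N unfolding parallel_unit_def by auto
  have horT: "hor y v = G (x y) (T y) (hor y v) *\<^sub>R T y" if y: "y \<in> U1" for y v
  proof -
    have yU: "y \<in> U0" "y \<in> W" "a y u0 \<noteq> 0" using y U1 by (auto simp: U1_def)
    note Gs = G_simps[OF XG rX[OF yU(2)]]
    have "hor y u0 \<noteq> 0" using yU(3) fc0[OF yU(2)] unfolding a_def by auto
    then have "G (x y) (hor y u0) (hor y u0) > 0" by (rule pd_formD(3)[OF pd_G[OF XG rX[OF yU(2)]]])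
    then have u0: "hor y u0 = sqrt (G (x y) (hor y u0) (hor y u0)) *\<^sub>R T y" unfolding T_def by simp
    obtain k where "hor y v = k *\<^sub>R hor y u0"
      using par[OF yU(2), of "hor y u0" "hor y v"] yU(3) C(1)[OF yU(1)] unfolding a_def by blast
    then obtain m where m: "hor y v = m *\<^sub>R T y" using u0 by (metis scaleR_scaleR)
    then show ?thesis using T1[OF y] by (simp add: Gs)
  qed
  have verpar: "w = G (x y) (N y) w *\<^sub>R N y" if y: "y \<in> U1" and w: "Im (cnj (b y u1) *
      frame_comp G E F (x y) w) = 0" for y w
  proof -
    have yU: "y \<in> U0" "y \<in> W" "b y u1 \<noteq> 0" using y U1 by (auto simp: U1_def)
    note Gs = G_simps[OF XG rX[OF yU(2)]]
    have "ver y u1 \<noteq> 0" using yU(3) fc0[OF yU(2)] unfolding b_def by auto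
    then have "G (x y) (ver y u1) (ver y u1) > 0" by (rule pd_formD(3)[OF pd_G[OF XG rX[OF yU(2)]]])
    then have u1: "ver y u1 = sqrt (G (x y) (ver y u1) (ver y u1)) *\<^sub>R N y" unfolding N_def by simp
    obtain k where "w = k *\<^sub>R ver y u1"
      using par[OF yU(2), of "ver y u1" w] yU(3) w unfolding b_def by blast
    then obtain m where m: "w = m *\<^sub>R N y" using u1 by (metis scaleR_scaleR)
    then show ?thesis using N1[OF y] by (simp add: Gs)
  qed
  have verN: "ver y v = G (x y) (N y) (ver y v) *\<^sub>R N y" if y: "y \<in> U1" for y v
    by (rule verpar[OF y]) (use C(2)[of y u1 v] y U1(2) in \<open>auto simp: b_def\<close>)
  have xiN: "snd (r y) = G (x y) (N y) (snd (r y)) *\<^sub>R N y" if y: "y \<in> U1" for y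
    by (rule verpar[OF y]) (use C(3)[of y u1] y U1(2) in \<open>auto simp: \<xi>_def algebra_simps\<close>)
  have smx: "smooth_on U1 x" unfolding x_def by (rule smooth_on_fst[OF U1(1) smooth_on_subset[OF r
      U1(3)]])
  have xU1: "x ` U1 \<subseteq> X" using rX U1(3) by auto
  have smG: "smooth_on U1 (\<lambda>y. G (x y) (p y) (q y))" if "smooth_on U1 p" "smooth_on U1 q" for p q
  proof (rule smooth_on_bilinear_family[where B="\<lambda>y. G (x y)", OF U1(1) _ _ that])
    show "bilinear (G (x y))" if "y \<in> U1" for y using xU1 that pd_formD(1)[OF pd_G[OF XG]] by blast
    show "smooth_on U1 (\<lambda>y. G (x y) u w)" for u w
      by (rule smooth_on_compose[OF U1(1) open_X[OF XG] smx smooth_G[OF XG] xU1])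
  qed
  have dx: "(x has_derivative hor y) (at y)" if "y \<in> U1" for y
    unfolding x_def hor_def
    using has_derivative_fst[OF smooth_on_has_derivative[OF r, of y]] that U1(3) by auto
  define \<tau> where "\<tau> y = G (x y) (N y) (snd (r y))" for y
  have sm\<tau>: "smooth_on U1 \<tau>"
    unfolding \<tau>_def by (intro smG smN smooth_on_snd U1(1) smooth_on_subset[OF r U1(3)])
  have d\<tau>: "(\<tau> has_derivative (\<lambda>v. G (x y) (N y) (ver y v))) (at y)" if y: "y \<in> U1" for y
  proof -
    have yW: "y \<in> W" using y U1 by auto
    have ds: "((\<lambda>y. snd (r y)) has_derivative (\<lambda>v. snd (frechet_derivative r (at y) v))) (at y)"
      by (rule has_derivative_snd[OF smooth_on_has_derivative[OF r yW]])
    show ?thesis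
      unfolding \<tau>_def
      by (rule has_derivative_eq_rhs[OF G_has_derivative[where f=x and y=y, OF XG rX[OF yW] dx[OF y]
          dN[OF y] ds]])
        (simp add: G_simps[OF XG rX[OF yW, unfolded x_def]] ver_def vert_def x_def hor_def chr_sym[OF
            XG, of "fst (r y)" "snd (r y)"] rX[OF yW, unfolded x_def])
  qed
  obtain e where e: "e > 0" "ball y0 e \<subseteq> {y \<in> U1. T y \<bullet> T y0 > 0}"
  proof -
    have "continuous_on U1 (\<lambda>y. T y \<bullet> T y0)" by (intro continuous_intros smooth_on_continuous smT)
    then have "open (U1 \<inter> (\<lambda>y. T y \<bullet> T y0) -` {0<..})"
        by (rule continuous_open_preimage[OF _ U1(1)]) auto
    moreover have "U1 \<inter> (\<lambda>y. T y \<bullet> T y0) -` {0<..} = {y \<in> U1. T y \<bullet> T y0 > 0}" by auto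
    moreover have "T y0 \<noteq> 0" using T1[OF U1(4)] pd_form_simps(10)[OF pd_G[OF XG rX]] U1 by auto
    ultimately show ?thesis using that open_contains_ball U1(4)
        by (metis (no_types, lifting) inner_gt_zero_iff mem_Collect_eq)
  qed
  define U where "U = ball y0 e"
  have U: "open U" "convex U" "U \<subseteq> U1" "y0 \<in> U" unfolding U_def using e by auto
  \<comment> \<open>The coefficient of \<open>T\<close> in the horizontal part; a convex domain provides its primitive\<close>
  define ds where "ds y v = G (x y) (T y) (hor y v)" for y v
  have smds: "smooth_on U (\<lambda>y. ds y u)" for u
    unfolding ds_def by (rule smooth_on_subset[OF smG[OF smT smooth_on_subset[OF smh U1(3)]] U(3)])
  define Th where "Th y = frame_comp G E F (x y) (T y)" for y
  have ds_eq: "ds y u = Re (cnj (Th y) * a y u)" if "y \<in> U" for y u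
    unfolding ds_def Th_def a_def using frame_metric[OF XG EF rX, of y "T y" "hor y u"] that U(3) U1(3)
        by auto
  have dTh: "(Th has_derivative (\<lambda>v. - \<i> * of_real (\<phi> y v) * Th y)) (at y)" if y: "y \<in> U" for y
  proof -
    have y1: "y \<in> U1" "y \<in> W" using y U(3) U1(3) by auto
    show ?thesis
      unfolding Th_def \<phi>_def
      by (rule has_derivative_eq_rhs[OF frame_comp_has_derivative[where f=x and y=y, OF XG EF rX[OF
          y1(2)] dx[OF y1(1)] dT[OF y1(1)]]])
        (simp add: fun_eq_iff fc0[OF y1(2)])
  qed
  have dds: "((\<lambda>y. ds y u) has_derivative (\<lambda>v. ds y (\<Lambda> y u v))) (at y)" if y: "y \<in> U" for y u
  proof -
    have y1: "y \<in> U0" using y U(3) U1(2) by auto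
    have "((\<lambda>y. Re (cnj (Th y) * a y u)) has_derivative (\<lambda>v. ds y (\<Lambda> y u v))) (at y)"
      unfolding ds_eq[OF y]
      by (rule has_derivative_eq_rhs[OF has_derivative_Re_cnj[OF dTh[OF y] da[OF y1]]])
        (simp add: fun_eq_iff algebra_simps)
    then show ?thesis
      by (rule has_derivative_transform_within_open[OF _ U(1) y]) (simp add: ds_eq)
  qed
  have "\<exists>s. \<forall>y\<in>U. (s has_derivative ds y) (at y)"
  proof (rule closed_form_primitive[OF U(1,2) _ smds])
    show "linear (ds y)" if "y \<in> U" for y
    proof -
      have y: "y \<in> W" using that U(3) U1(3) by auto
      show ?thesis
        unfolding ds_eq[OF that, abs_def]
        by (rule linearI) (simp_all add: ds_eq[OF that] linear_add[OF la[OF y]] linear_cmul[OF la[OF y]]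
            algebra_simps)
    qed
    show "frechet_derivative (\<lambda>y. ds y u) (at y) v = frechet_derivative (\<lambda>y. ds y v) (at y) u"
        if "y \<in> U" for y u v
      unfolding frechet_derivative_at[OF dds[OF that], symmetric] using Ls[of y u v] that U(3) U1(3)
          by auto
  qed
  then obtain s where s: "\<And>y. y \<in> U \<Longrightarrow> (s has_derivative ds y) (at y)" by blast
  have sms: "smooth_on U s"
    by (rule smooth_onI_derivative[OF U(1) s]) (use smds in \<open>auto simp: smooth_on_def\<close>)
  have fs: "frechet_derivative s (at y) = ds y" if "y \<in> U" for y
    using frechet_derivative_at[OF s[OF that]] by simp
  have ft: "frechet_derivative \<tau> (at y) v = G (x y) (N y) (ver y v)" if "y \<in> U" for y v
    using fun_cong[OF frechet_derivative_at[OF d\<tau>], of y v] that U(3) by auto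
  have sub: "parallel_unit G r U T" "parallel_unit G r U N"
    using T N U(3) smooth_on_subset unfolding parallel_unit_def by blast+
  show ?thesis
  proof (rule that[OF U(1,4) _ sub sms smooth_on_subset[OF sm\<tau> U(3)]])
    show "U \<subseteq> U0" using U(3) U1(2) by auto
    fix y assume y: "y \<in> U"
    show "T y \<bullet> T y0 > 0" using e(2) y unfolding U_def by auto
    show "hor y v = frechet_derivative s (at y) v *\<^sub>R T y" for v
      unfolding fs[OF y] ds_def using horT[of y v] y U(3) by auto
    show "ver y v = frechet_derivative \<tau> (at y) v *\<^sub>R N y" for v
      unfolding ft[OF y] using verN[of y v] y U(3) by auto
    show "snd (r y) = \<tau> y *\<^sub>R N y" unfolding \<tau>_def using xiN[of y] y U(3) by auto
  qed
qed

end

section \<open>The generating geodesic of a cylinder\<close>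

text \<open>The inverse function theorem for smooth maps, with the derivative of the inverse in the form
  of a right inverse.\<close>

lemma inverse_chart:
  fixes f :: "'a::euclidean_space \<Rightarrow> 'a"
  assumes U: "open U" "y0 \<in> U" and sm: "smooth_on U f" and inj: "inj (frechet_derivative f (at y0))"
  obtains U' V g where "open U'" "U' \<subseteq> U" "y0 \<in> U'" "open V" "f y0 \<in> V" "homeomorphism U' V f g"
    "\<And>z. z \<in> V \<Longrightarrow> \<exists>g'. (g has_derivative g') (at z) \<and> (\<forall>w. frechet_derivative f (at (g z)) (g' w) = w)"
proof -
  define f' where "f' y = Blinfun (frechet_derivative f (at y))" for y
  have lin: "linear (frechet_derivative f (at y))" if "y \<in> U" for y
      by (rule linear_frechet_smooth[OF sm that])
  have f': "blinfun_apply (f' y) = frechet_derivative f (at y)" if "y \<in> U" for y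
    unfolding f'_def using lin[OF that] by (intro bounded_linear_Blinfun_apply) (simp add:
        linear_conv_bounded_linear)
  have der: "(f has_derivative blinfun_apply (f' y)) (at y)" if "y \<in> U" for y
    unfolding f'[OF that] by (rule smooth_on_has_derivative[OF sm that])
  have cont: "continuous_on U f'"
  proof (rule continuous_on_blinfun_componentwise)
    fix i :: 'a
    show "continuous_on U (\<lambda>y. blinfun_apply (f' y) i)"
      by (rule continuous_on_eq[OF smooth_on_continuous[OF smooth_on_frechet[OF sm, of i]]]) (simp add:
          f')
  qed
  obtain h where h: "linear h" "h \<circ> frechet_derivative f (at y0) = id"
    using linear_injective_left_inverse[OF lin[OF U(2)] inj] by blast
  have "Blinfun h o\<^sub>L f' y0 = id_blinfun"
  proof (rule blinfun_eqI)
    fix v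
    have "blinfun_apply (Blinfun h) = h" using h(1)
        by (intro bounded_linear_Blinfun_apply) (simp add: linear_conv_bounded_linear)
    then show "blinfun_apply (Blinfun h o\<^sub>L f' y0) v = blinfun_apply id_blinfun v"
      using fun_cong[OF h(2), of v] by (simp add: f'[OF U(2)])
  qed
  from inverse_function_theorem[OF U(1) der cont U(2) this]
  obtain U' V g g' where *: "open U'" "U' \<subseteq> U" "y0 \<in> U'" "open V" "f y0 \<in> V" "homeomorphism U' V f g"
    "\<And>y. y \<in> V \<Longrightarrow> (g has_derivative (g' y)) (at y)"
    "\<And>y. y \<in> V \<Longrightarrow> g' y = inv (blinfun_apply (f'(g y)))"
    "\<And>y. y \<in> V \<Longrightarrow> bij (blinfun_apply (f'(g y)))" by metis
  show ?thesis
  proof (rule that[OF *(1-6)])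
    fix z assume z: "z \<in> V"
    then have gz: "g z \<in> U" using *(2,6) unfolding homeomorphism_def by blast
    have "frechet_derivative f (at (g z)) (g' z w) = w" for w
      unfolding *(8)[OF z] f'[OF gz, symmetric] by (rule surj_f_inv_f[OF bij_is_surj[OF *(9)[OF z]]])
    then show "\<exists>g'. (g has_derivative g') (at z) \<and> (\<forall>w. frechet_derivative f (at (g z)) (g' w) = w)"
      using *(7)[OF z] by blast
  qed
qed

text \<open>The three equations form one first order system with smooth right-hand side.\<close>

lemma geodesic_system_smooth:
  fixes c p e :: "real \<Rightarrow> real^2"
  assumes XG: "riem_metric X G" and I: "open I" and cX: "\<And>s. s \<in> I \<Longrightarrow> c s \<in> X"
    and ode: "\<And>s. s \<in> I \<Longrightarrow> (c has_vector_derivative p s) (at s)"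
      "\<And>s. s \<in> I \<Longrightarrow> (p has_vector_derivative - chr G (c s) (p s) (p s)) (at s)"
      "\<And>s. s \<in> I \<Longrightarrow> (e has_vector_derivative - chr G (c s) (p s) (e s)) (at s)"
  shows "smooth_on I c" "smooth_on I p" "smooth_on I e"
proof -
  define z where "z s = (c s, p s, e s)" for s
  \<comment> \<open>The right-hand side of the system for \<open>(c, p, e)\<close>\<close>
  define \<Phi> where "\<Phi> w = (fst (snd w), - chr G (fst w) (fst (snd w)) (fst (snd w)), -
      chr G (fst w) (fst (snd w)) (snd (snd w)))"
    for w :: "(real^2) \<times> (real^2) \<times> (real^2)"
  define Y where "Y = X \<times> (UNIV :: ((real^2) \<times> (real^2)) set)"
  have Y: "open Y" unfolding Y_def using open_X[OF XG] by (intro open_Times) auto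
  have f: "smooth_on Y fst" "smooth_on Y (\<lambda>w. fst (snd w))" "smooth_on Y (\<lambda>w. snd (snd w))"
    by (intro smooth_on_fst[OF Y] smooth_on_snd[OF Y] smooth_on_id[OF Y])+
  have chr: "smooth_on Y (\<lambda>w. chr G (fst w) (q w) (q' w))" if "smooth_on Y q" "smooth_on Y q'" for q q'
  proof (rule smooth_on_bilinear_family[where B="\<lambda>w. chr G (fst w)", OF Y _ _ that])
    show "bilinear (chr G (fst w))" if "w \<in> Y" for w using that chr_bilinear[OF XG] unfolding Y_def
        by auto
    show "smooth_on Y (\<lambda>w. chr G (fst w) u v)" for u v
      by (rule smooth_on_compose[OF Y open_X[OF XG] f(1) smooth_chr[OF XG]]) (auto simp: Y_def)
  qed
  have \<Phi>: "smooth_on Y \<Phi>"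
    unfolding \<Phi>_def by (intro smooth_on_Pair smooth_on_minus Y f chr)
  have zY: "z ` I \<subseteq> Y" unfolding z_def Y_def using cX by auto
  have "smooth_on I z"
  proof (rule smooth_onI_derivative[OF I])
    show "(z has_derivative (\<lambda>h. h *\<^sub>R \<Phi> (z s))) (at s)" if "s \<in> I" for s
      using has_derivative_Pair[OF ode(1)[OF that, unfolded has_vector_derivative_def]
          has_derivative_Pair[OF ode(2)[OF that, unfolded has_vector_derivative_def]
             ode(3)[OF that, unfolded has_vector_derivative_def]]]
      unfolding z_def \<Phi>_def by simp
    show "Ck_on k I (\<lambda>s. u *\<^sub>R \<Phi> (z s))" if "Ck_on k I z" for k and u :: real
      using Ck_on_compose[OF I Y that _ zY, of \<Phi>] \<Phi>
      by (intro bounded_bilinear.Ck_on_prod[OF bounded_bilinear_scaleR] I Ck_on_const) (auto simp: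
          smooth_on_def)
  qed
  then have "smooth_on I (\<lambda>s. fst (z s))" "smooth_on I (\<lambda>s. fst (snd (z s)))"
      "smooth_on I (\<lambda>s. snd (snd (z s)))"
    by (intro smooth_on_fst smooth_on_snd I; assumption)+
  then show "smooth_on I c" "smooth_on I p" "smooth_on I e" by (simp_all add: z_def)
qed

text \<open>The curve moves to one side of a fixed direction, so its parameter is a continuous function
  of its points. Hence so is the height over the curve, on a neighbourhood of the whole cylinder.\<close>

lemma cylinder_tube:
  fixes c p e :: "real \<Rightarrow> real^2"
  assumes I: "open I" "is_interval I" and J: "open J"
    and dc: "\<And>s. s \<in> I \<Longrightarrow> (c has_vector_derivative p s) (at s)" and pos: "\<And>s. s \<in> I \<Longrightarrow> p s \<bullet> d > 0"
    and e: "continuous_on I e" "\<And>s. s \<in> I \<Longrightarrow> e s \<noteq> 0"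
  obtains Q where "open Q" "\<And>s t. s \<in> I \<Longrightarrow> (c s, t *\<^sub>R e s) \<in> Q \<longleftrightarrow> t \<in> J"
proof -
  define m where "m s = c s \<bullet> d" for s
  have dm: "(m has_real_derivative p s \<bullet> d) (at s)" if "s \<in> I" for s
    using has_derivative_inner_left[OF dc[OF that, unfolded has_vector_derivative_def], of d]
    unfolding m_def has_field_derivative_def by (simp add: mult.commute[of _ "p s \<bullet> d"])
  have mono: "m s < m s'" if "s \<in> I" "s' \<in> I" "s < s'" for s s'
  proof (rule DERIV_pos_imp_increasing[OF that(3)])
    fix u assume "s \<le> u" "u \<le> s'"
    then have "u \<in> I" using that I(2) mem_is_interval_1_I by blast
    then show "\<exists>y. (m has_real_derivative y) (at u) \<and> 0 < y" using dm pos by blast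
  qed
  have inj: "inj_on m I"
    by (rule inj_onI) (metis mono less_irrefl linorder_neqE_linordered_idom)
  have cm: "continuous_on I m"
    using dm by (auto intro!: continuous_at_imp_continuous_on DERIV_isCont)
  obtain k where k: "homeomorphism I (m ` I) m k"
    by (rule invariance_of_domain_homeomorphism[OF I(1) cm _ inj]) auto
  have om: "open (m ` I)" by (rule invariance_of_domain[OF cm I(1) inj])
  have km: "k (m s) = s" if "s \<in> I" for s using k that by (simp add: homeomorphism_def)
  have kI: "k v \<in> I" if "v \<in> m ` I" for v using k that by (auto simp: homeomorphism_def)
  \<comment> \<open>Over \<open>S\<close> the parameter of the curve is \<open>k (fst z \<bullet> d)\<close>, and \<open>h\<close> is the height.\<close>
  define S :: "((real^2) \<times> (real^2)) set" where "S = (\<lambda>z. fst z \<bullet> d) -` (m ` I)"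
  have S: "open S" unfolding S_def by (rule open_vimage[OF om]) (intro continuous_intros)
  define h where "h z = (snd z \<bullet> e (k (fst z \<bullet> d))) / (e (k (fst z \<bullet> d)) \<bullet> e (k (fst z \<bullet> d)))" for z
  have ce: "continuous_on S (\<lambda>z. e (k (fst z \<bullet> d)))"
  proof (rule continuous_on_compose2[OF e(1)])
    show "continuous_on S (\<lambda>z. k (fst z \<bullet> d))"
      by (rule continuous_on_compose2[of "m ` I" k]) (use k in \<open>auto simp: homeomorphism_def S_def
          intro!: continuous_intros\<close>)
  qed (auto simp: S_def kI)
  have ch: "continuous_on S h"
    unfolding h_def by (intro continuous_intros ce) (use e(2) kI in \<open>auto simp: S_def\<close>)
  show ?thesis
  proof (rule that[of "S \<inter> h -` J"])
    show "open (S \<inter> h -` J)" by (rule continuous_open_preimage[OF ch S J])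
    fix s t assume s: "s \<in> I"
    have "(c s, t *\<^sub>R e s) \<in> S" unfolding S_def using s by (auto simp: m_def)
    moreover have "h (c s, t *\<^sub>R e s) = t"
      unfolding h_def using km[OF s] e(2)[OF s] by (simp add: m_def)
    ultimately show "(c s, t *\<^sub>R e s) \<in> S \<inter> h -` J \<longleftrightarrow> t \<in> J" by simp
  qed
qed

text \<open>The functions \<open>s\<close> and \<open>\<tau>\<close> are local coordinates, because \<open>ds\<close> and \<open>d\<tau>\<close> determine the
  differential of \<open>r\<close>. In these coordinates the base point and \<open>N\<close> are constant along the lines \<open>s
  = const\<close>, and along a line \<open>\<tau> = const\<close> the base point has velocity \<open>T\<close>.\<close>

lemma local_cylinder:
  assumes XG: "riem_metric X G" and tg: "tg_immersion X G W r" and U: "open U" "U \<subseteq> W" "y0 \<in> U"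
    and T: "parallel_unit G r U T" and N: "parallel_unit G r U N"
    and sm: "smooth_on U s" "smooth_on U \<tau>" and pos: "\<And>y. y \<in> U \<Longrightarrow> T y \<bullet> T y0 > 0"
    and hor: "\<And>y v. y \<in> U \<Longrightarrow> fst (frechet_derivative r (at y) v) = frechet_derivative s (at y) v *\<^sub>R T y"
    and ver: "\<And>y v. y \<in> U \<Longrightarrow> vert G (r y) (frechet_derivative r (at y) v) =
        frechet_derivative \<tau> (at y) v *\<^sub>R N y"
    and xi: "\<And>y. y \<in> U \<Longrightarrow> snd (r y) = \<tau> y *\<^sub>R N y"
  obtains I J V c p e Q where "open I" "is_interval I" "open V" "y0 \<in> V" "V \<subseteq> U"
    "r ` V = {(c \<sigma>, t *\<^sub>R e \<sigma>) | \<sigma> t. \<sigma> \<in> I \<and> t \<in> J}"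
    "open Q" "\<And>\<sigma> t. \<sigma> \<in> I \<Longrightarrow> (c \<sigma>, t *\<^sub>R e \<sigma>) \<in> Q \<longleftrightarrow> t \<in> J"
    "\<And>\<sigma>. \<sigma> \<in> I \<Longrightarrow> c \<sigma> \<in> X"
    "\<And>\<sigma>. \<sigma> \<in> I \<Longrightarrow> (c has_vector_derivative p \<sigma>) (at \<sigma>)"
    "\<And>\<sigma>. \<sigma> \<in> I \<Longrightarrow> (p has_vector_derivative - chr G (c \<sigma>) (p \<sigma>) (p \<sigma>)) (at \<sigma>)"
    "\<And>\<sigma>. \<sigma> \<in> I \<Longrightarrow> (e has_vector_derivative - chr G (c \<sigma>) (p \<sigma>) (e \<sigma>)) (at \<sigma>)"
    "\<And>\<sigma>. \<sigma> \<in> I \<Longrightarrow> G (c \<sigma>) (p \<sigma>) (p \<sigma>) = 1" "\<And>\<sigma>. \<sigma> \<in> I \<Longrightarrow> G (c \<sigma>) (e \<sigma>) (e \<sigma>) = 1"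
proof -
  have W: "open W" and r: "smooth_on W r" and rX: "\<And>y. y \<in> W \<Longrightarrow> fst (r y) \<in> X"
    and Dinj: "\<And>y. y \<in> W \<Longrightarrow> inj (frechet_derivative r (at y))"
    using tg unfolding tg_immersion_def by auto
  have T1: "G (fst (r y)) (T y) (T y) = 1" and N1: "G (fst (r y)) (N y) (N y) = 1"
    and dT: "(T has_derivative (\<lambda>v. - chr G (fst (r y)) (fst (frechet_derivative r (at y) v)) (T y)))
        (at y)"
    and dN: "(N has_derivative (\<lambda>v. - chr G (fst (r y)) (fst (frechet_derivative r (at y) v)) (N y)))
        (at y)" if "y \<in> U" for y
    using T N that unfolding parallel_unit_def by auto
  define e1 e2 where "e1 = (axis 1 1 :: real^2)" and "e2 = (axis 2 1 :: real^2)"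
  have e12: "e1 $ 1 = 1" "e1 $ 2 = 0" "e2 $ 1 = 0" "e2 $ 2 = 1" unfolding e1_def e2_def
      by (simp_all add: axis_def)
  define F where "F y = s y *\<^sub>R e1 + \<tau> y *\<^sub>R e2" for y
  have smF: "smooth_on U F" unfolding F_def by (intro smooth_intros U(1) sm)
  have fF: "frechet_derivative F (at y) v = frechet_derivative s (at y) v *\<^sub>R e1 +
      frechet_derivative \<tau> (at y) v *\<^sub>R e2" if y: "y \<in> U" for y v
  proof -
    have "(F has_derivative (\<lambda>v. frechet_derivative s (at y) v *\<^sub>R e1 +
        frechet_derivative \<tau> (at y) v *\<^sub>R e2)) (at y)"
      unfolding F_def
      by (intro has_derivative_add has_derivative_scaleR_left smooth_on_has_derivative[OF sm(1) y]
          smooth_on_has_derivative[OF sm(2) y])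
    from fun_cong[OF frechet_derivative_at[OF this], of v] show ?thesis by (rule sym)
  qed
  have "inj (frechet_derivative F (at y0))"
  proof (subst linear_injective_0[OF linear_frechet_smooth[OF smF U(3)]], intro allI impI)
    fix v assume "frechet_derivative F (at y0) v = 0"
    then have "(frechet_derivative s (at y0) v *\<^sub>R e1 + frechet_derivative \<tau> (at y0) v *\<^sub>R e2) $ i = 0"
        for i
      unfolding fF[OF U(3)] by simp
    from this[of 1] this[of 2] have "frechet_derivative s (at y0) v = 0"
        "frechet_derivative \<tau> (at y0) v = 0" using e12 by auto
    then have 0: "fst (frechet_derivative r (at y0) v) = 0"
        "vert G (r y0) (frechet_derivative r (at y0) v) = 0"
      using hor[OF U(3), of v] ver[OF U(3), of v] by auto
    have yW: "y0 \<in> W" using U by auto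
    have "frechet_derivative r (at y0) v = 0"
      using 0 linear_0[OF chr_linear(1)[OF XG rX[OF yW]]] unfolding vert_def by (simp add: prod_eq_iff)
    then show "v = 0" using Dinj[OF yW] linear_frechet_smooth[OF r yW] by (metis linear_injective_0)
  qed
  from inverse_chart[OF U(1,3) smF this]
  obtain U' V g where UV: "open U'" "U' \<subseteq> U" "y0 \<in> U'" "open V" "F y0 \<in> V" "homeomorphism U' V F g"
    and dg: "\<And>z. z \<in> V \<Longrightarrow> \<exists>g'. (g has_derivative g') (at z) \<and>
        (\<forall>w. frechet_derivative F (at (g z)) (g' w) = w)" by blast
  have gU: "g z \<in> U'" "g z \<in> U" "g z \<in> W" and Fg: "F (g z) = z" if "z \<in> V" for z
    using UV(2,6) U(2) that unfolding homeomorphism_def by blast+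
  have gF: "g (F y) = y" "F y \<in> V" if "y \<in> U'" for y using UV(6) that unfolding homeomorphism_def
      by blast+
  define g' where "g' z = (SOME g'. (g has_derivative g') (at z) \<and>
      (\<forall>w. frechet_derivative F (at (g z)) (g' w) = w))" for z
  have g': "(g has_derivative g' z) (at z)" "frechet_derivative F (at (g z)) (g' z w) = w" if "z \<in> V"
      for z w
    using someI_ex[OF dg[OF that]] unfolding g'_def[symmetric] by auto
  have ds: "frechet_derivative s (at (g z)) (g' z w) =
      w $ 1" and dt: "frechet_derivative \<tau> (at (g z)) (g' z w) = w $ 2" if z: "z \<in> V" for z w
  proof -
    have "(frechet_derivative s (at (g z)) (g' z w) *\<^sub>R e1 +
        frechet_derivative \<tau> (at (g z)) (g' z w) *\<^sub>R e2) $ i = w $ i" for i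
      using g'(2)[OF z, of w] unfolding fF[OF gU(2)[OF z]] by simp
    from this[of 1] this[of 2] show "frechet_derivative s (at (g z)) (g' z w) = w $ 1"
        "frechet_derivative \<tau> (at (g z)) (g' z w) = w $ 2"
      using e12 by auto
  qed
  have tau: "\<tau> (g z) = z $ 2" if "z \<in> V" for z
    using arg_cong[OF Fg[OF that], of "\<lambda>z. z $ 2"] unfolding F_def using e12 by simp
  have dxg: "((\<lambda>z. fst (r (g z))) has_derivative (\<lambda>w. w $ 1 *\<^sub>R T (g z))) (at z)" if z: "z \<in> V" for z
  proof -
    have "((\<lambda>z. fst (r (g z))) has_derivative (\<lambda>w. fst (frechet_derivative r (at (g z)) (g' z w)))) (at
        z)"
      by (rule has_derivative_fst[OF has_derivative_compose[OF g'(1)[OF z] smooth_on_has_derivative[OF r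
          gU(3)[OF z]]]])
    then show ?thesis unfolding hor[OF gU(2)[OF z]] ds[OF z] .
  qed
  have dTg: "((\<lambda>z. T (g z)) has_derivative (\<lambda>w. -
      (w $ 1 *\<^sub>R chr G (fst (r (g z))) (T (g z)) (T (g z))))) (at z)" if z: "z \<in> V" for z
    using has_derivative_compose[OF g'(1)[OF z] dT[OF gU(2)[OF z]]]
    unfolding hor[OF gU(2)[OF z]] ds[OF z] linear_cmul[OF chr_linear(2)[OF XG rX[OF gU(3)[OF z]]]] .
  have dNg: "((\<lambda>z. N (g z)) has_derivative (\<lambda>w. -
      (w $ 1 *\<^sub>R chr G (fst (r (g z))) (T (g z)) (N (g z))))) (at z)" if z: "z \<in> V" for z
    using has_derivative_compose[OF g'(1)[OF z] dN[OF gU(2)[OF z]]]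
    unfolding hor[OF gU(2)[OF z]] ds[OF z] linear_cmul[OF chr_linear(2)[OF XG rX[OF gU(3)[OF z]]]] .
  define s0 t0 where "s0 = s y0" and "t0 = \<tau> y0"
  have F0: "F y0 = s0 *\<^sub>R e1 + t0 *\<^sub>R e2" unfolding F_def s0_def t0_def ..
  obtain \<epsilon> where \<epsilon>: "\<epsilon> > 0" "ball (F y0) \<epsilon> \<subseteq> V" using UV(4,5) open_contains_ball by blast
  define I where "I = {s0 - \<epsilon>/2 <..< s0 + \<epsilon>/2}"
  define J where "J = {t0 - \<epsilon>/2 <..< t0 + \<epsilon>/2}"
  have I: "open I" "is_interval I" "s0 \<in> I" and J: "open J" "convex J" "t0 \<in> J"
    unfolding I_def J_def using \<epsilon>(1) by (auto simp: is_interval_oo)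
  have box: "\<sigma> *\<^sub>R e1 + t *\<^sub>R e2 \<in> V" if "\<sigma> \<in> I" "t \<in> J" for \<sigma> t
  proof -
    have "dist (F y0) (\<sigma> *\<^sub>R e1 + t *\<^sub>R e2) = norm ((s0 - \<sigma>) *\<^sub>R e1 + (t0 - t) *\<^sub>R e2)"
      unfolding dist_norm F0 by (simp add: algebra_simps)
    also have "\<dots> \<le> norm ((s0 - \<sigma>) *\<^sub>R e1) + norm ((t0 - t) *\<^sub>R e2)" by (rule norm_triangle_ineq)
    also have "\<dots> = \<bar>s0 - \<sigma>\<bar> + \<bar>t0 - t\<bar>" unfolding e1_def e2_def by (simp add: norm_axis_1)
    also have "\<dots> < \<epsilon>" using that unfolding I_def J_def by (auto simp: abs_if)
    finally show ?thesis using \<epsilon>(2) by auto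
  qed
  \<comment> \<open>The generating curve is the coordinate line through the given point.\<close>
  define q where "q \<sigma> = \<sigma> *\<^sub>R e1 + t0 *\<^sub>R e2" for \<sigma> :: real
  define c where "c \<sigma> = fst (r (g (q \<sigma>)))" for \<sigma>
  define p where "p \<sigma> = T (g (q \<sigma>))" for \<sigma>
  define e where "e \<sigma> = N (g (q \<sigma>))" for \<sigma>
  have qV: "q \<sigma> \<in> V" if "\<sigma> \<in> I" for \<sigma> unfolding q_def by (rule box[OF that J(3)])
  have dq: "(q has_derivative (\<lambda>h. h *\<^sub>R e1)) (at \<sigma>)" for \<sigma> unfolding q_def
      by (auto intro!: derivative_eq_intros)
  have cX: "c \<sigma> \<in> X" if "\<sigma> \<in> I" for \<sigma> unfolding c_def by (rule rX[OF gU(3)[OF qV[OF that]]])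
  have dc: "(c has_vector_derivative p \<sigma>) (at \<sigma>)" if "\<sigma> \<in> I" for \<sigma>
    using has_derivative_compose[OF dq dxg[OF qV[OF that]]]
    unfolding has_vector_derivative_def c_def p_def by (simp add: e12)
  have dp: "(p has_vector_derivative - chr G (c \<sigma>) (p \<sigma>) (p \<sigma>)) (at \<sigma>)" if "\<sigma> \<in> I" for \<sigma>
    using has_derivative_compose[OF dq dTg[OF qV[OF that]]]
    unfolding has_vector_derivative_def c_def p_def by (simp add: e12)
  have de: "(e has_vector_derivative - chr G (c \<sigma>) (p \<sigma>) (e \<sigma>)) (at \<sigma>)" if "\<sigma> \<in> I" for \<sigma>
    using has_derivative_compose[OF dq dNg[OF qV[OF that]]]
    unfolding has_vector_derivative_def c_def p_def e_def by (simp add: e12)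
  have G1: "G (c \<sigma>) (p \<sigma>) (p \<sigma>) = 1" "G (c \<sigma>) (e \<sigma>) (e \<sigma>) = 1" if "\<sigma> \<in> I" for \<sigma>
    unfolding c_def p_def e_def using T1 N1 gU(2)[OF qV[OF that]] by auto
  have ruled: "r (g (\<sigma> *\<^sub>R e1 + t *\<^sub>R e2)) = (c \<sigma>, t *\<^sub>R e \<sigma>)" if st: "\<sigma> \<in> I" "t \<in> J" for \<sigma> t
  proof -
    have dv: "((\<lambda>t. \<sigma> *\<^sub>R e1 + t *\<^sub>R e2) has_derivative (\<lambda>h. h *\<^sub>R e2)) (at t)" for t
      by (auto intro!: derivative_eq_intros)
    have "\<exists>k. \<forall>t\<in>J. fst (r (g (\<sigma> *\<^sub>R e1 + t *\<^sub>R e2))) = k"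
    proof (rule has_derivative_zero_constant[OF J(2)])
      fix t assume t: "t \<in> J"
      show "((\<lambda>t. fst (r (g (\<sigma> *\<^sub>R e1 + t *\<^sub>R e2)))) has_derivative (\<lambda>h. 0)) (at t within J)"
        using has_derivative_compose[OF dv dxg[OF box[OF st(1) t]]]
            by (simp add: e12 has_derivative_at_withinI)
    qed
    then have x: "fst (r (g (\<sigma> *\<^sub>R e1 + t *\<^sub>R e2))) = c \<sigma>" unfolding c_def q_def using J(3) st(2)
        by auto
    have "\<exists>k. \<forall>t\<in>J. N (g (\<sigma> *\<^sub>R e1 + t *\<^sub>R e2)) = k"
    proof (rule has_derivative_zero_constant[OF J(2)])
      fix t assume t: "t \<in> J"
      show "((\<lambda>t. N (g (\<sigma> *\<^sub>R e1 + t *\<^sub>R e2))) has_derivative (\<lambda>h. 0)) (at t within J)"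
        using has_derivative_compose[OF dv dNg[OF box[OF st(1) t]]]
            by (simp add: e12 has_derivative_at_withinI)
    qed
    then have "N (g (\<sigma> *\<^sub>R e1 + t *\<^sub>R e2)) = e \<sigma>" unfolding e_def q_def using J(3) st(2) by auto
    then have "snd (r (g (\<sigma> *\<^sub>R e1 + t *\<^sub>R e2))) = t *\<^sub>R e \<sigma>"
      using xi[OF gU(2)[OF box[OF st]]] tau[OF box[OF st]] e12 by simp
    with x show ?thesis by (simp add: prod_eq_iff)
  qed
  define V' where "V' = U' \<inter> F -` {z. z $ 1 \<in> I \<and> z $ 2 \<in> J}"
  have V': "open V'"
  proof -
    have "open {z::real^2. z $ 1 \<in> I \<and> z $ 2 \<in> J}"
    proof -
      have "{z::real^2. z $ 1 \<in> I \<and> z $ 2 \<in> J} = (\<lambda>z. z $ 1) -` I \<inter> (\<lambda>z. z $ 2) -` J" by auto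
      then show ?thesis using I(1) J(1) by (auto intro!: open_Int open_vimage continuous_intros)
    qed
    then show ?thesis unfolding V'_def
      by (intro continuous_open_preimage[OF _ UV(1)] continuous_on_subset[OF smooth_on_continuous[OF
          smF] UV(2)])
  qed
  have y0V: "y0 \<in> V'" unfolding V'_def using UV(3) I(3) J(3) by (simp add: F0 e12)
  have dec: "z = (z $ 1) *\<^sub>R e1 + (z $ 2) *\<^sub>R e2" for z :: "real^2"
    by (simp add: vec_eq_iff forall_2 e12)
  have img: "r ` V' = {(c \<sigma>, t *\<^sub>R e \<sigma>) | \<sigma> t. \<sigma> \<in> I \<and> t \<in> J}"
  proof (intro set_eqI iffI)
    fix w assume "w \<in> r ` V'"
    then obtain y where y: "y \<in> U'" "F y $ 1 \<in> I" "F y $ 2 \<in> J" "w = r y" unfolding V'_def by auto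
    have "w = (c (F y $ 1), (F y $ 2) *\<^sub>R e (F y $ 1))"
      using ruled[OF y(2,3)] dec[of "F y"] gF(1)[OF y(1)] y(4) by simp
    then show "w \<in> {(c \<sigma>, t *\<^sub>R e \<sigma>) | \<sigma> t. \<sigma> \<in> I \<and> t \<in> J}" using y by blast
  next
    fix w assume "w \<in> {(c \<sigma>, t *\<^sub>R e \<sigma>) | \<sigma> t. \<sigma> \<in> I \<and> t \<in> J}"
    then obtain \<sigma> t where st: "\<sigma> \<in> I" "t \<in> J" "w = (c \<sigma>, t *\<^sub>R e \<sigma>)" by blast
    have "g (\<sigma> *\<^sub>R e1 + t *\<^sub>R e2) \<in> V'"
      unfolding V'_def using gU(1)[OF box[OF st(1,2)]] Fg[OF box[OF st(1,2)]] st by (simp add: e12)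
    then show "w \<in> r ` V'" using ruled[OF st(1,2)] st(3) by (metis image_eqI)
  qed
  have p0: "p s0 = T y0" unfolding p_def q_def F0[symmetric] gF(1)[OF UV(3)] ..
  have ce: "continuous_on I e"
    using de by (auto intro!: continuous_at_imp_continuous_on has_vector_derivative_continuous)
  have e0: "e \<sigma> \<noteq> 0" if "\<sigma> \<in> I" for \<sigma>
    using G1(2)[OF that] pd_form_simps(10)[OF pd_G[OF XG cX[OF that]]] by auto
  obtain Q where Q: "open Q" "\<And>\<sigma> t. \<sigma> \<in> I \<Longrightarrow> (c \<sigma>, t *\<^sub>R e \<sigma>) \<in> Q \<longleftrightarrow> t \<in> J"
  proof (rule cylinder_tube[OF I(1,2) J(1) dc _ ce e0])
    show "p \<sigma> \<bullet> T y0 > 0" if "\<sigma> \<in> I" for \<sigma>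
      unfolding p_def by (rule pos[OF gU(2)[OF qV[OF that]]])
  qed auto
  have VU: "V' \<subseteq> U" unfolding V'_def using UV(2) by auto
  show ?thesis
    by (rule that[OF I(1,2) V' y0V VU img Q cX dc dp de G1])
qed

section \<open>Totally geodesic submanifolds of the tangent bundle in charts\<close>

context
  fixes A :: "('a, real^2) chart set" and g :: "('a, real^2) metric_tensor"
  assumes Ag: "riemannian_manifold A g"
begin

text \<open>The second fundamental form in the induced charts is that of the coordinate expression
  \<open>sas\<close>, by \<open>sasaki_in_chart\<close> and \<open>sasaki_christoffel\<close>.\<close>

lemma tg_immersion_chart:
  assumes F: "submanifold (tangent_bundle A) F" "totally_geodesic (tangent_bundle A) (sasaki A g) F"
    and b: "b \<in> F" and c: "c \<in> A"
  shows "tg_immersion (cimg c) (metric_in A g c) (chart_map b ` (chart_dom b \<inter> chart_dom (tangent_chart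
      A c)))
    (chart_map (tangent_chart A c) \<circ> chart_inv b)"
proof -
  define tc where "tc = tangent_chart A c"
  define r where "r = chart_map tc \<circ> chart_inv b"
  define W where "W = chart_map b ` (chart_dom b \<inter> chart_dom tc)"
  define D where "D y = frechet_derivative r (at y)" for y
  have tc: "tc \<in> tangent_bundle A" unfolding tc_def tangent_bundle_def using c by simp
  have sF: "smooth_atlas F" and W: "open W" and r: "smooth_on W r" and Dinj: "\<And>y. y \<in> W \<Longrightarrow> inj (D y)"
    using F(1) b tc unfolding submanifold_def W_def r_def D_def by blast+
  have rX: "fst (r y) \<in> cimg c" if y: "y \<in> W" for y
  proof -
    obtain Q where Q: "Q \<in> chart_dom b" "Q \<in> chart_dom tc" "y = chart_map b Q" using y unfolding W_def
        by auto
    have "r y = chart_map tc Q" unfolding r_def Q(3) by (simp add: chart_inv_map[OF sF b Q(1)])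
    then show ?thesis
      using Q(2) unfolding tc_def tchart_map tchart_dom by (auto intro: cimg_mem)
  qed
  have "\<exists>w. D y w = frechet_derivative (\<lambda>y'. D y' u) (at y) v +
      chr (sas (metric_in A g c)) (r y) (D y v) (D y u)"
    if y: "y \<in> W" for y u v
  proof -
    have "second_fundamental_form (tangent_bundle A) (sasaki A g) b tc y u v = 0"
      using F(2) b tc y unfolding totally_geodesic_def W_def by blast
    then have "(THE n. frechet_derivative (\<lambda>y'. D y' u) (at y) v +
        chr (sas (metric_in A g c)) (r y) (D y v) (D y u) - n \<in> range (D y) \<and>
        (\<forall>z. sas (metric_in A g c) (r y) n (D y z) = 0)) = 0"
      unfolding second_fundamental_form_def Let_def r_def[symmetric] D_def[symmetric]
      unfolding tc_def sasaki_in_chart[OF Ag c rX[OF y]] sasaki_christoffel[OF Ag c rX[OF y]] .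
    from tangent_of_zero_normal_part[OF sas_pd_form[OF chart_riem_metric[OF Ag c] rX[OF y]] _ Dinj[OF y]
        this]
    show ?thesis using linear_frechet_smooth[OF r y] unfolding D_def by metis
  qed
  moreover have "r ` W \<subseteq> cimg c \<times> UNIV"
    by (rule image_subsetI) (simp add: rX mem_Times_iff)
  ultimately have "tg_immersion (cimg c) (metric_in A g c) W r"
    unfolding tg_immersion_def using chart_riem_metric[OF Ag c] W r Dinj
    unfolding D_def by simp
  then show ?thesis unfolding W_def r_def tc_def .
qed

text \<open>The domain of an induced chart is open in the tangent bundle, so whether a piece of a
  submanifold is open in a model set can be read off in this chart.\<close>

lemma open_piece_in_chart:
  assumes F: "smooth_atlas F" "b \<in> F" and c: "c \<in> A"
  defines "tc \<equiv> tangent_chart A c"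
  assumes V: "open V" "V \<subseteq> chart_map b ` (chart_dom b \<inter> chart_dom tc)" and Q: "open Q"
    and M: "\<And>P. P \<in> chart_dom tc \<Longrightarrow> P \<in> M \<and> chart_map tc P \<in> Q \<longleftrightarrow>
        chart_map tc P \<in> (chart_map tc \<circ> chart_inv b) ` V"
  shows "openin (atlas_topology F) (chart_inv b ` V)"
      "open_piece (tangent_bundle A) (chart_inv b ` V) M"
proof -
  have inv: "chart_inv b (chart_map b P) = P" if "P \<in> chart_dom b" for P
      by (rule chart_inv_map[OF F that])
  have V1: "chart_inv b ` V = chart_dom b \<inter> chart_map b -` V"
  proof (intro set_eqI iffI)
    fix P assume "P \<in> chart_inv b ` V"
    then obtain y where "y \<in> V" "P = chart_inv b y" by blast
    then show "P \<in> chart_dom b \<inter> chart_map b -` V" using V(2) inv by auto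
  next
    fix P assume "P \<in> chart_dom b \<inter> chart_map b -` V"
    then show "P \<in> chart_inv b ` V" using inv by (metis Int_iff image_eqI vimageE)
  qed
  have Vtc: "chart_inv b ` V \<subseteq> chart_dom tc"
    using V(2) inv by auto
  show "openin (atlas_topology F) (chart_inv b ` V)"
    unfolding V1 atlas_topology_def by (rule topology_generated_by_Basis) (use F V(1) in blast)
  have tcA: "tc \<in> tangent_bundle A" using c unfolding tangent_bundle_def tc_def by blast
  define S where "S = chart_dom tc \<inter> chart_map tc -` Q"
  have "openin (atlas_topology (tangent_bundle A)) S"
    unfolding S_def atlas_topology_def
    by (rule topology_generated_by_Basis) (use Q tcA in blast)
  moreover have "chart_inv b ` V = S \<inter> M"
  proof (intro set_eqI iffI)
    fix P assume P: "P \<in> chart_inv b ` V"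
    then have "chart_map tc P \<in> (chart_map tc \<circ> chart_inv b) ` V" by auto
    then show "P \<in> S \<inter> M" using M[of P] P Vtc unfolding S_def by auto
  next
    fix P assume P: "P \<in> S \<inter> M"
    then have Pt: "P \<in> chart_dom tc" unfolding S_def by auto
    then have "chart_map tc P \<in> (chart_map tc \<circ> chart_inv b) ` V" using M[OF Pt] P unfolding S_def
        by auto
    then obtain y where y: "y \<in> V" "chart_map tc P = chart_map tc (chart_inv b y)" by auto
    have "chart_inv b y \<in> chart_dom tc" using Vtc y(1) by blast
    then have "P = chart_inv b y"
      using tchart_inj[OF A_atlas[OF Ag] c] y(2) Pt unfolding tc_def by (meson inj_onD)
    then show "P \<in> chart_inv b ` V" using y(1) by blast
  qed
  ultimately show "open_piece (tangent_bundle A) (chart_inv b ` V) M"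
    unfolding open_piece_def openin_subtopology by blast
qed

context
  fixes c :: "('a, real^2) chart" and I :: "real set" and \<kappa> p :: "real \<Rightarrow> real^2"
  assumes c: "c \<in> A" and I: "open I" and \<kappa>X: "\<And>s. s \<in> I \<Longrightarrow> \<kappa> s \<in> cimg c"
    and d\<kappa>: "\<And>s. s \<in> I \<Longrightarrow> (\<kappa> has_vector_derivative p s) (at s)" and sm\<kappa>: "smooth_on I \<kappa>"
begin

text \<open>In the following lemmas \<open>\<kappa>\<close> is the coordinate expression of a curve in one chart \<open>c\<close>, and
  vector fields along the curve are given by their components in this chart.\<close>

lemma curve_in_dom: "s \<in> I \<Longrightarrow> chart_inv c (\<kappa> s) \<in> chart_dom c"
    "s \<in> I \<Longrightarrow> chart_map c (chart_inv c (\<kappa> s)) = \<kappa> s"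
  by (rule chart_inv_in[OF \<kappa>X], assumption, rule chart_map_inv[OF \<kappa>X], assumption)

lemma curve_dom: "I \<inter> (\<lambda>s. chart_inv c (\<kappa> s)) -` chart_dom d = I \<inter> \<kappa> -` overlap c d"
  using overlap_iff[OF A_atlas[OF Ag] c, of _ d] \<kappa>X by auto

lemma curve_dom_open: "d \<in> A \<Longrightarrow> open (I \<inter> (\<lambda>s. chart_inv c (\<kappa> s)) -` chart_dom d)"
  unfolding curve_dom
  by (rule continuous_open_preimage[OF smooth_on_continuous[OF sm\<kappa>] I open_overlap[OF A_atlas[OF Ag]
      c]])

lemma curve_coord: "s \<in> I \<Longrightarrow> d \<in> A \<Longrightarrow> chart_inv c (\<kappa> s) \<in> chart_dom d \<Longrightarrow>
    coord_vec A c (chart_inv c (\<kappa> s)) v d = dtrans c d (\<kappa> s) v"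
  unfolding coord_vec_eq by (simp add: curve_in_dom)

lemma smooth_curve_chart: "smooth_curve A I (\<lambda>s. chart_inv c (\<kappa> s))"
  unfolding smooth_curve_def
proof (intro conjI ballI)
  show "(\<lambda>s. chart_inv c (\<kappa> s)) ` I \<subseteq> points A" unfolding points_def using c curve_in_dom(1) by blast
  fix d assume d: "d \<in> A"
  show o: "open (I \<inter> (\<lambda>s. chart_inv c (\<kappa> s)) -` chart_dom d)" by (rule curve_dom_open[OF d])
  have "smooth_on (I \<inter> (\<lambda>s. chart_inv c (\<kappa> s)) -` chart_dom d) (\<lambda>s. transition c d (\<kappa> s))"
    by (rule smooth_on_compose[OF o open_overlap[OF A_atlas[OF Ag] c d] smooth_on_subset[OF sm\<kappa>]
        smooth_trans[OF A_atlas[OF Ag] c d]])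
      (auto simp: curve_dom)
  then show "smooth_on (I \<inter> (\<lambda>s. chart_inv c (\<kappa> s)) -` chart_dom d) (chart_map d \<circ> (\<lambda>s. chart_inv c (\<kappa>
      s)))"
    unfolding transition_def o_def .
qed

lemma smooth_field_chart:
  assumes v: "smooth_on I v"
  shows "smooth_field_along A I (\<lambda>s. chart_inv c (\<kappa> s)) (\<lambda>s. coord_vec A c (chart_inv c (\<kappa> s)) (v s))"
  unfolding smooth_field_along_def
proof (intro conjI ballI)
  fix s assume "s \<in> I"
  then show "coord_vec A c (chart_inv c (\<kappa> s)) (v s) \<in> tangent_space A (chart_inv c (\<kappa> s))"
    by (intro coord_vec_tangent[OF A_atlas[OF Ag] c] curve_in_dom)
next
  fix d assume d: "d \<in> A"
  define I' where "I' = I \<inter> (\<lambda>s. chart_inv c (\<kappa> s)) -` chart_dom d"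
  have o: "open I'" unfolding I'_def by (rule curve_dom_open[OF d])
  have \<kappa>o: "\<kappa> s \<in> overlap c d" if "s \<in> I'" for s using that curve_dom unfolding I'_def by auto
  have "smooth_on I' (\<lambda>s. dtrans c d (\<kappa> s) (v s))"
  proof (rule smooth_on_linear_family[where B="\<lambda>s. dtrans c d (\<kappa> s)", OF o])
    show "linear (dtrans c d (\<kappa> s))" if "s \<in> I'" for s
        by (rule dtrans_linear[OF A_atlas[OF Ag] c d \<kappa>o[OF that]])
    show "smooth_on I' (\<lambda>s. dtrans c d (\<kappa> s) u)" for u
      by (rule smooth_on_compose[OF o open_overlap[OF A_atlas[OF Ag] c d] smooth_on_subset[OF sm\<kappa>]
           smooth_on_frechet[OF smooth_trans[OF A_atlas[OF Ag] c d]]]) (use \<kappa>o in \<open>auto simp: I'_def\<close>)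
    show "smooth_on I' v" by (rule smooth_on_subset[OF v]) (auto simp: I'_def)
  qed
  then have "smooth_on I' (\<lambda>s. coord_vec A c (chart_inv c (\<kappa> s)) (v s) d)"
    by (rule smooth_on_cong[OF o, rotated]) (use curve_coord d in \<open>auto simp: I'_def\<close>)
  then show "smooth_on (I \<inter> (\<lambda>s. chart_inv c (\<kappa> s)) -` chart_dom d) (\<lambda>s. coord_vec A c (chart_inv c (\<kappa>
      s)) (v s) d)"
    unfolding I'_def .
qed

lemma velocity_chart:
  assumes s: "s \<in> I"
  shows "velocity A (\<lambda>s. chart_inv c (\<kappa> s)) s = coord_vec A c (chart_inv c (\<kappa> s)) (p s)"
proof
  fix d
  show "velocity A (\<lambda>s. chart_inv c (\<kappa> s)) s d = coord_vec A c (chart_inv c (\<kappa> s)) (p s) d"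
  proof (cases "d \<in> A \<and> chart_inv c (\<kappa> s) \<in> chart_dom d")
    case True
    then have d: "d \<in> A" "chart_inv c (\<kappa> s) \<in> chart_dom d" by auto
    have o: "\<kappa> s \<in> overlap c d" using s True overlap_iff[OF A_atlas[OF Ag] c] \<kappa>X by blast
    have "((\<lambda>s. transition c d (\<kappa> s)) has_derivative (\<lambda>h. dtrans c d (\<kappa> s) (h *\<^sub>R p s))) (at s)"
      by (rule has_derivative_compose[OF d\<kappa>[OF s, unfolded has_vector_derivative_def]
          dtrans_has_derivative[OF A_atlas[OF Ag] c d(1) o]])
    then have "((chart_map d \<circ> (\<lambda>s. chart_inv c (\<kappa> s))) has_vector_derivative dtrans c d (\<kappa> s) (p s))
        (at s)"
      unfolding has_vector_derivative_def transition_def o_def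
      using linear_cmul[OF dtrans_linear[OF A_atlas[OF Ag] c d(1) o]]
          by (simp add: transition_def o_def)
    from vector_derivative_at[OF this] show ?thesis
      unfolding velocity_def using True curve_coord[OF s d] by simp
  qed (auto simp: velocity_def coord_vec_eq)
qed

text \<open>In another chart the second derivative of the coordinate change appears, and it is absorbed
  by \<open>christoffel_change\<close>.\<close>

lemma parallel_chart:
  assumes s: "s \<in> I" and v: "(v has_vector_derivative - chr (metric_in A g c) (\<kappa> s) (p s) (v s)) (at s)"
    and Z: "\<And>s. s \<in> I \<Longrightarrow> Z s = coord_vec A c (chart_inv c (\<kappa> s)) (v s)"
  shows "covariant_derivative A g (\<lambda>s. chart_inv c (\<kappa> s)) Z s = (\<lambda>d. 0)"
proof
  fix d
  show "covariant_derivative A g (\<lambda>s. chart_inv c (\<kappa> s)) Z s d = 0"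
  proof (cases "d \<in> A \<and> chart_inv c (\<kappa> s) \<in> chart_dom d")
    case True
    then have d: "d \<in> A" "chart_inv c (\<kappa> s) \<in> chart_dom d" by auto
    define I' where "I' = I \<inter> (\<lambda>s. chart_inv c (\<kappa> s)) -` chart_dom d"
    have o: "open I'" "s \<in> I'" unfolding I'_def using curve_dom_open[OF d(1)] s d(2) by auto
    have \<kappa>o: "\<kappa> t \<in> overlap c d" if "t \<in> I'" for t using that curve_dom unfolding I'_def by auto
    note lin = dtrans_linear[OF A_atlas[OF Ag] c d(1) \<kappa>o]
    define w where "w = - chr (metric_in A g c) (\<kappa> s) (p s) (v s)"
    have "((\<lambda>s. dtrans c d (\<kappa> s) (v s)) has_derivative
        (\<lambda>h. ddtrans c d (\<kappa> s) (h *\<^sub>R p s) (v s) + dtrans c d (\<kappa> s) (h *\<^sub>R w))) (at s)"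
    proof (rule has_derivative_linear_family[where B="\<lambda>s. dtrans c d (\<kappa> s)" and B'="\<lambda>h u. ddtrans c d (\<kappa>
        s) (h *\<^sub>R p s) u", OF o lin])
      show "((\<lambda>t. dtrans c d (\<kappa> t) u) has_derivative (\<lambda>h. ddtrans c d (\<kappa> s) (h *\<^sub>R p s) u)) (at s)"
          for u
        by (rule has_derivative_compose[OF d\<kappa>[OF s, unfolded has_vector_derivative_def]
            ddtrans_has_derivative[OF A_atlas[OF Ag] c d(1) \<kappa>o[OF o(2)]]])
      show "(v has_derivative (\<lambda>h. h *\<^sub>R w)) (at s)" using v unfolding has_vector_derivative_def w_def .
    qed
    then have "((\<lambda>s. dtrans c d (\<kappa> s) (v s)) has_vector_derivative (ddtrans c d (\<kappa> s) (p s) (v s) +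
        dtrans c d (\<kappa> s) w)) (at s)"
      unfolding has_vector_derivative_def
      using linear_cmul[OF has_derivative_linear[OF ddtrans_has_derivative[OF A_atlas[OF Ag] c d(1)
          \<kappa>o[OF o(2)]]]] linear_cmul[OF lin[OF o(2)]]
      by (simp add: scaleR_add_right)
    then have "((\<lambda>t. Z t d) has_vector_derivative (ddtrans c d (\<kappa> s) (p s) (v s) +
        dtrans c d (\<kappa> s) w)) (at s)"
      unfolding has_vector_derivative_def
      by (rule has_derivative_transform_within_open[OF _ o]) (use Z curve_coord d(1) in \<open>auto simp:
          I'_def\<close>)
    then have "vector_derivative (\<lambda>t. Z t d) (at s) =
        ddtrans c d (\<kappa> s) (p s) (v s) + dtrans c d (\<kappa> s) w"
      by (rule vector_derivative_at)
    then have "covariant_derivative A g (\<lambda>s. chart_inv c (\<kappa> s)) Z s d =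
       (ddtrans c d (\<kappa> s) (p s) (v s) + dtrans c d (\<kappa> s) w) +
       chr (metric_in A g d) (transition c d (\<kappa> s)) (dtrans c d (\<kappa> s) (p s)) (dtrans c d (\<kappa> s) (v s))"
      unfolding covariant_derivative_def christoffel_eq_chr velocity_chart[OF s] Z[OF s] curve_coord[OF
          s d]
      using True by (simp add: transition_def)
    also have "\<dots> = dtrans c d (\<kappa> s) (chr (metric_in A g c) (\<kappa> s) (p s) (v s)) + dtrans c d (\<kappa> s) w"
      unfolding christoffel_change[OF Ag c d(1) \<kappa>o[OF o(2)]] by simp
    also have "\<dots> = 0" unfolding w_def using linear_neg[OF lin[OF o(2)]] by simp
    finally show ?thesis .
  qed (auto simp: covariant_derivative_def)
qed

lemma unit_chart:
  "s \<in> I \<Longrightarrow> g (chart_inv c (\<kappa> s)) (coord_vec A c (chart_inv c (\<kappa> s)) u) (coord_vec A c (chart_inv c (\<kappa>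
      s)) u) = metric_in A g c (\<kappa> s) u u"
  using metric_in_eq[OF A_atlas[OF Ag] c curve_in_dom(1), of s g u u] curve_in_dom(2) by simp

end

lemma zero_tangent: "(\<lambda>c. 0) \<in> tangent_space A p"
  unfolding tangent_space_iff
  by (auto simp: linear_0[OF dtrans_linear[OF A_atlas[OF Ag]]] overlap_mem)

lemma coord_vec_scaleR:
  "c \<in> A \<Longrightarrow> p \<in> chart_dom c \<Longrightarrow> coord_vec A c p (t *\<^sub>R u) = (\<lambda>d. t *\<^sub>R coord_vec A c p u d)"
  unfolding coord_vec_eq
  by (auto simp: linear_cmul[OF dtrans_linear[OF A_atlas[OF Ag]]] overlap_mem)

end

theorem theorem1:
  fixes A :: "('a, real ^ 2) chart set"
    and g :: "('a, real ^ 2) metric_tensor"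
    and K :: real
    and F :: "('a \<times> ('a, real ^ 2) tvec, real ^ 2) chart set"
  assumes "riemannian_manifold A g"
    and "constant_curvature A g K" and "K \<noteq> 0"
    and "submanifold (tangent_bundle A) F"
    and "totally_geodesic (tangent_bundle A) (sasaki A g) F"
  shows "\<forall>P\<in>points F. \<exists>V. openin (atlas_topology F) V \<and> P \<in> V \<and>
           ((\<exists>q\<in>points A. open_piece (tangent_bundle A) V (fiber A q)) \<or>
            (\<exists>I \<gamma> e. open I \<and> is_interval I \<and>
               unit_speed_geodesic A g I \<gamma> \<and> parallel_unit_field A g I \<gamma> e \<and>
               open_piece (tangent_bundle A) V (cylinder I \<gamma> e)) \<or>
            open_piece (tangent_bundle A) V (zero_section A))"
proof
  note Ag = assms(1) and at = A_atlas[OF assms(1)]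
  fix P assume "P \<in> points F"
  then obtain b where b: "b \<in> F" "P \<in> chart_dom b" unfolding points_def by auto
  have "P \<in> points (tangent_bundle A)" using \<open>P \<in> points F\<close> assms(4) unfolding submanifold_def by blast
  then obtain c where c: "c \<in> A" "P \<in> chart_dom (tangent_chart A c)"
    unfolding points_def tangent_bundle_def by auto
  have sF: "smooth_atlas F" using assms(4) unfolding submanifold_def by blast
  define tc where "tc = tangent_chart A c"
  define r where "r = chart_map tc \<circ> chart_inv b"
  define W where "W = chart_map b ` (chart_dom b \<inter> chart_dom tc)"
  define y0 where "y0 = chart_map b P"
  define X where "X = cimg c"
  define G where "G = metric_in A g c"
  have y0: "y0 \<in> W" unfolding y0_def W_def tc_def using b c by auto
  have Py0: "P = chart_inv b y0" unfolding y0_def using chart_inv_map[OF sF b] by simp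
  have tg: "tg_immersion X G W r"
    unfolding X_def G_def W_def r_def tc_def by (rule tg_immersion_chart[OF Ag assms(4,5) b(1) c(1)])
  have XG: "riem_metric X G" unfolding X_def G_def by (rule chart_riem_metric[OF Ag c(1)])
  have K: "const_curv X G K" unfolding X_def G_def by (rule chart_const_curv[OF Ag assms(2) c(1)])
  have W: "open W" and r: "smooth_on W r" and rX: "\<And>y. y \<in> W \<Longrightarrow> fst (r y) \<in> X"
    using tg unfolding tg_immersion_def by auto
  have rinj: "inj_on r W"
  proof (rule inj_onI)
    fix y z assume yz: "y \<in> W" "z \<in> W" "r y = r z"
    then obtain Q R where Q: "Q \<in> chart_dom b" "Q \<in> chart_dom tc" "y = chart_map b Q"
      and R: "R \<in> chart_dom b" "R \<in> chart_dom tc" "z = chart_map b R" unfolding W_def by auto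
    have "chart_map tc Q = chart_map tc R"
      using yz(3) unfolding r_def Q(3) R(3) by (simp add: chart_inv_map[OF sF b(1)] Q R)
    then have "Q = R" using tchart_inj[OF at c(1)] Q(2) R(2) unfolding tc_def by (meson inj_onD)
    then show "y = z" using Q R by simp
  qed
  have piece: "\<exists>V'. openin (atlas_topology F) V' \<and> P \<in> V' \<and> open_piece (tangent_bundle A) V' M"
    if "open V" "V \<subseteq> W" "y0 \<in> V" "open Q"
      "\<And>P. P \<in> chart_dom tc \<Longrightarrow> P \<in> M \<and> chart_map tc P \<in> Q \<longleftrightarrow> chart_map tc P \<in> r ` V" for V Q M
    using open_piece_in_chart[OF Ag sF b(1) c(1), of V Q M] that Py0
    unfolding W_def r_def tc_def by blast
  have pX: "chart_map tc R = (chart_map c (fst R), snd R c)" for R unfolding tc_def by (rule tchart_map)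
  have pdom: "R \<in> chart_dom tc \<longleftrightarrow> fst R \<in> chart_dom c \<and> snd R \<in> tangent_space A (fst R)" for R
    unfolding tc_def by (rule tchart_dom)
  obtain E1 E2 where EF: "orthonormal_frame X G E1 E2"
    using smooth_orthonormal_frame[OF open_X[OF XG], of G] pd_G[OF XG] smooth_G[OF XG]
    unfolding orthonormal_frame_def by metis
  define hor where "hor y u = fst (frechet_derivative r (at y) u)" for y u
  define ver where "ver y u = vert G (r y) (frechet_derivative r (at y) u)" for y u
  define fc where "fc y w = frame_comp G E1 E2 (fst (r y)) w" for y w
  have fc0: "fc y w = 0 \<longleftrightarrow> w = 0" if "y \<in> W" for y w
    using frame_comp_inj[OF XG EF rX[OF that]] linear_0[OF frame_comp_linear[OF XG EF rX[OF that]]]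
    unfolding fc_def by blast
  obtain \<Lambda> where sys: "tg_system W K (\<lambda>y u. fc y (hor y u)) (\<lambda>y u. fc y (ver y u)) (\<lambda>y. fc y (snd (r
      y)))
     (\<lambda>y v. conn_form G E1 E2 (fst (r y)) (fst (frechet_derivative r (at y) v))) \<Lambda>"
    using tg_immersion_system[OF XG EF tg K] unfolding fc_def hor_def ver_def by blast
  obtain U0 where U0: "open U0" "y0 \<in> U0" "U0 \<subseteq> W" and cases:
    "(\<forall>y\<in>U0. fc y (snd (r y)) = 0) \<or> (\<forall>y\<in>U0. \<forall>u. fc y (hor y u) = 0) \<or>
     (\<forall>y\<in>U0. (\<forall>u v. Im (cnj (fc y (hor y u)) * fc y (hor y v)) = 0 \<and>
         Im (cnj (fc y (ver y u)) * fc y (ver y v)) = 0) \<and>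
       (\<forall>u. Im (cnj (fc y (snd (r y))) * fc y (ver y u)) = 0) \<and> (\<exists>u. fc y (hor y u) \<noteq> 0) \<and>
           (\<exists>u. fc y (ver y u) \<noteq> 0))"
    using tg_system_classification[OF sys assms(3) y0] by blast
  have UW: "y \<in> W" if "y \<in> U0" for y using that U0(3) by blast
  from cases show "\<exists>V. openin (atlas_topology F) V \<and> P \<in> V \<and>
           ((\<exists>q\<in>points A. open_piece (tangent_bundle A) V (fiber A q)) \<or>
            (\<exists>I \<gamma> e. open I \<and> is_interval I \<and>
               unit_speed_geodesic A g I \<gamma> \<and> parallel_unit_field A g I \<gamma> e \<and>
               open_piece (tangent_bundle A) V (cylinder I \<gamma> e)) \<or>
            open_piece (tangent_bundle A) V (zero_section A))"
  proof (elim disjE)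
    assume "\<forall>y\<in>U0. fc y (snd (r y)) = 0"
    then have z: "snd (r y) = 0" if "y \<in> U0" for y using fc0[OF UW[OF that]] that by blast
    \<comment> \<open>On the zero section \<open>r\<close> is determined by its base point; by invariance of domain the base
        points fill an open set.\<close>
    have "inj_on (\<lambda>y. fst (r y)) U0"
    proof (rule inj_onI)
      fix y y' assume "y \<in> U0" "y' \<in> U0" "fst (r y) = fst (r y')"
      then show "y = y'" using z rinj UW by (auto simp: inj_on_def prod_eq_iff)
    qed
    moreover have "continuous_on U0 (\<lambda>y. fst (r y))"
      by (intro continuous_intros continuous_on_subset[OF smooth_on_continuous[OF r] U0(3)])
    ultimately have o: "open ((\<lambda>y. fst (r y)) ` U0)" using invariance_of_domain U0(1) by blast
    have "R \<in> zero_section A \<and> chart_map tc R \<in> (\<lambda>y. fst (r y)) ` U0 \<times> UNIV \<longleftrightarrow> chart_map tc R \<in> r ` U0"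
      if R: "R \<in> chart_dom tc" for R
    proof -
      have "R \<in> zero_section A \<longleftrightarrow> snd R c = 0"
      proof
        assume "snd R c = 0"
        then have "snd R = (\<lambda>c. 0)"
          using tangent_space_eqI[OF at _ zero_tangent[OF Ag], of "snd R" "fst R" c] R c(1)
              unfolding pdom by auto
        then show "R \<in> zero_section A" using R c(1) unfolding pdom zero_section_def points_def
            by (cases R) auto
      qed (auto simp: zero_section_def)
      then show ?thesis unfolding pX using z by (force simp: image_iff prod_eq_iff)
    qed
    from piece[OF U0(1,3,2) open_Times[OF o open_UNIV] this] show ?thesis by blast
  next
    assume "\<forall>y\<in>U0. \<forall>u. fc y (hor y u) = 0"
    then have h0: "hor y u = 0" if "y \<in> U0" for y u using fc0[OF UW[OF that]] that by blast
    obtain \<epsilon> where \<epsilon>: "\<epsilon> > 0" "ball y0 \<epsilon> \<subseteq> U0" using U0 open_contains_ball by blast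
    define U where "U = ball y0 \<epsilon>"
    have U: "open U" "convex U" "U \<subseteq> U0" "U \<subseteq> W" "y0 \<in> U" unfolding U_def using \<epsilon> U0(3) by auto
    have "\<exists>k. \<forall>y\<in>U. fst (r y) = k"
    proof (rule has_derivative_zero_constant[OF U(2)])
      fix y assume y: "y \<in> U"
      have "((\<lambda>y. fst (r y)) has_derivative hor y) (at y)"
        unfolding hor_def using has_derivative_fst[OF smooth_on_has_derivative[OF r]] y U(4) by blast
      moreover have "hor y = (\<lambda>h. 0)" using h0 y U(3) by blast
      ultimately show "((\<lambda>y. fst (r y)) has_derivative (\<lambda>h. 0)) (at y within U)"
          by (simp add: has_derivative_at_withinI)
    qed
    then obtain x0 where x0: "\<And>y. y \<in> U \<Longrightarrow> fst (r y) = x0" by blast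
    have x0X: "x0 \<in> cimg c" using x0[OF U(5)] rX[OF y0] unfolding X_def by simp
    \<comment> \<open>Within one fibre \<open>r\<close> is determined by its fibre component.\<close>
    have "inj_on (\<lambda>y. snd (r y)) U"
    proof (rule inj_onI)
      fix y y' assume yy: "y \<in> U" "y' \<in> U" "snd (r y) = snd (r y')"
      then have "r y = r y'" by (simp add: x0 prod_eq_iff)
      then show "y = y'" using inj_onD[OF rinj] yy(1,2) U(4) by blast
    qed
    moreover have "continuous_on U (\<lambda>y. snd (r y))"
      by (intro continuous_intros continuous_on_subset[OF smooth_on_continuous[OF r] U(4)])
    ultimately have o: "open ((\<lambda>y. snd (r y)) ` U)" using invariance_of_domain U(1) by blast
    have "R \<in> fiber A (chart_inv c x0) \<and> chart_map tc R \<in> UNIV \<times> (\<lambda>y. snd (r y)) ` U \<longleftrightarrow>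
        chart_map tc R \<in> r ` U"
      if R: "R \<in> chart_dom tc" for R
    proof -
      have "R \<in> fiber A (chart_inv c x0) \<longleftrightarrow> chart_map c (fst R) = x0"
        using R chart_map_inv[OF x0X] chart_inv_map[OF at c(1), of "fst R"] unfolding pdom fiber_def
            by (cases R) auto
      then show ?thesis unfolding pX using x0 by (force simp: image_iff prod_eq_iff)
    qed
    from piece[OF U(1,4,5) open_Times[OF open_UNIV o] this]
    obtain V where "openin (atlas_topology F) V" "P \<in> V"
        "open_piece (tangent_bundle A) V (fiber A (chart_inv c x0))" by blast
    moreover have "chart_inv c x0 \<in> points A" unfolding points_def using chart_inv_in[OF x0X] c(1)
        by blast
    ultimately show ?thesis by blast
  next
    assume C: "\<forall>y\<in>U0. (\<forall>u v. Im (cnj (fc y (hor y u)) * fc y (hor y v)) = 0 \<and>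
        Im (cnj (fc y (ver y u)) * fc y (ver y v)) = 0) \<and>
       (\<forall>u. Im (cnj (fc y (snd (r y))) * fc y (ver y u)) = 0) \<and> (\<exists>u. fc y (hor y u) \<noteq> 0) \<and>
           (\<exists>u. fc y (ver y u) \<noteq> 0)"
    then obtain u0 u1 where u: "fc y0 (hor y0 u0) \<noteq> 0" "fc y0 (ver y0 u1) \<noteq> 0" using U0(2) by blast
    have C1: "Im (cnj (fc y (hor y u)) * fc y (hor y v)) = 0"
        "Im (cnj (fc y (ver y u)) * fc y (ver y v)) = 0"
      "Im (cnj (fc y (snd (r y))) * fc y (ver y u)) = 0" if "y \<in> U0" for y u v
      using bspec[OF C that] by simp_all
    obtain U T N s \<tau> where U: "open U" "y0 \<in> U" "U \<subseteq> U0" and f: "parallel_unit G r U T"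
        "parallel_unit G r U N"
      "smooth_on U s" "smooth_on U \<tau>" "\<And>y. y \<in> U \<Longrightarrow> T y \<bullet> T y0 > 0"
      "\<And>y v. y \<in> U \<Longrightarrow> fst (frechet_derivative r (at y) v) = frechet_derivative s (at y) v *\<^sub>R T y"
      "\<And>y v. y \<in> U \<Longrightarrow> vert G (r y) (frechet_derivative r (at y) v) =
          frechet_derivative \<tau> (at y) v *\<^sub>R N y"
      "\<And>y. y \<in> U \<Longrightarrow> snd (r y) = \<tau> y *\<^sub>R N y"
      using cylinder_fields[OF XG EF tg K U0(1,3,2) C1[unfolded fc_def hor_def ver_def] u[unfolded
          fc_def hor_def ver_def]]
      by metis
    have U': "U \<subseteq> W" using U(3) U0(3) by blast
    obtain I J V \<kappa> p e Q where cyl: "open I" "is_interval I" "open V" "y0 \<in> V" "V \<subseteq> U"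
      "r ` V = {(\<kappa> \<sigma>, t *\<^sub>R e \<sigma>) | \<sigma> t. \<sigma> \<in> I \<and> t \<in> J}"
      "open Q" "\<And>\<sigma> t. \<sigma> \<in> I \<Longrightarrow> (\<kappa> \<sigma>, t *\<^sub>R e \<sigma>) \<in> Q \<longleftrightarrow> t \<in> J"
      "\<And>\<sigma>. \<sigma> \<in> I \<Longrightarrow> \<kappa> \<sigma> \<in> X"
      "\<And>\<sigma>. \<sigma> \<in> I \<Longrightarrow> (\<kappa> has_vector_derivative p \<sigma>) (at \<sigma>)"
      "\<And>\<sigma>. \<sigma> \<in> I \<Longrightarrow> (p has_vector_derivative - chr G (\<kappa> \<sigma>) (p \<sigma>) (p \<sigma>)) (at \<sigma>)"
      "\<And>\<sigma>. \<sigma> \<in> I \<Longrightarrow> (e has_vector_derivative - chr G (\<kappa> \<sigma>) (p \<sigma>) (e \<sigma>)) (at \<sigma>)"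
      "\<And>\<sigma>. \<sigma> \<in> I \<Longrightarrow> G (\<kappa> \<sigma>) (p \<sigma>) (p \<sigma>) = 1" "\<And>\<sigma>. \<sigma> \<in> I \<Longrightarrow> G (\<kappa> \<sigma>) (e \<sigma>) (e \<sigma>) = 1"
    proof (rule local_cylinder[OF XG tg U(1) U' U(2) f])
      fix I J V \<kappa> p e Q
      assume a: "open I" "is_interval I" "open V" "y0 \<in> V" "V \<subseteq> U"
      "r ` V = {(\<kappa> \<sigma>, t *\<^sub>R e \<sigma>) | \<sigma> t. \<sigma> \<in> I \<and> t \<in> J}"
      "open Q" "\<And>\<sigma> t. \<sigma> \<in> I \<Longrightarrow> (\<kappa> \<sigma>, t *\<^sub>R e \<sigma>) \<in> Q \<longleftrightarrow> t \<in> J"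
      "\<And>\<sigma>. \<sigma> \<in> I \<Longrightarrow> \<kappa> \<sigma> \<in> X"
      "\<And>\<sigma>. \<sigma> \<in> I \<Longrightarrow> (\<kappa> has_vector_derivative p \<sigma>) (at \<sigma>)"
      "\<And>\<sigma>. \<sigma> \<in> I \<Longrightarrow> (p has_vector_derivative - chr G (\<kappa> \<sigma>) (p \<sigma>) (p \<sigma>)) (at \<sigma>)"
      "\<And>\<sigma>. \<sigma> \<in> I \<Longrightarrow> (e has_vector_derivative - chr G (\<kappa> \<sigma>) (p \<sigma>) (e \<sigma>)) (at \<sigma>)"
      "\<And>\<sigma>. \<sigma> \<in> I \<Longrightarrow> G (\<kappa> \<sigma>) (p \<sigma>) (p \<sigma>) = 1" "\<And>\<sigma>. \<sigma> \<in> I \<Longrightarrow> G (\<kappa> \<sigma>) (e \<sigma>) (e \<sigma>) = 1"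
      show thesis by (rule that[OF a])
    qed
    note sm = geodesic_system_smooth[OF XG cyl(1,9,10,11,12)]
    note \<kappa>X = cyl(9)[unfolded X_def]
    define \<gamma> where "\<gamma> = (\<lambda>\<sigma>. chart_inv c (\<kappa> \<sigma>))"
    define \<epsilon> where "\<epsilon> = (\<lambda>\<sigma>. coord_vec A c (\<gamma> \<sigma>) (e \<sigma>))"
    note ch = Ag c(1) cyl(1) \<kappa>X cyl(10) sm(1)
    have geo: "unit_speed_geodesic A g I \<gamma>"
      unfolding unit_speed_geodesic_def \<gamma>_def
    proof (intro conjI ballI)
      show "smooth_curve A I (\<lambda>\<sigma>. chart_inv c (\<kappa> \<sigma>))" by (rule smooth_curve_chart[OF ch])
      fix \<sigma> assume s: "\<sigma> \<in> I"
      show "covariant_derivative A g (\<lambda>\<sigma>. chart_inv c (\<kappa> \<sigma>)) (velocity A (\<lambda>\<sigma>. chart_inv c (\<kappa> \<sigma>))) \<sigma> =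
          (\<lambda>c. 0)"
        by (rule parallel_chart[OF ch s cyl(11)[OF s, unfolded G_def] velocity_chart[OF ch]])
      show "g (chart_inv c (\<kappa> \<sigma>)) (velocity A (\<lambda>\<sigma>. chart_inv c (\<kappa> \<sigma>)) \<sigma>) (velocity A (\<lambda>\<sigma>. chart_inv c (\<kappa>
          \<sigma>)) \<sigma>) = 1"
        using cyl(13)[OF s] velocity_chart[OF ch s] unit_chart[OF ch s, of "p \<sigma>"] unfolding G_def
            by simp
    qed
    have par: "parallel_unit_field A g I \<gamma> \<epsilon>"
      unfolding parallel_unit_field_def \<gamma>_def \<epsilon>_def
    proof (intro conjI ballI)
      show "smooth_field_along A I (\<lambda>\<sigma>. chart_inv c (\<kappa> \<sigma>)) (\<lambda>\<sigma>. coord_vec A c (chart_inv c (\<kappa> \<sigma>)) (e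
          \<sigma>))"
        by (rule smooth_field_chart[OF ch sm(3)])
      fix \<sigma> assume s: "\<sigma> \<in> I"
      show "covariant_derivative A g (\<lambda>\<sigma>. chart_inv c (\<kappa> \<sigma>)) (\<lambda>\<sigma>. coord_vec A c (chart_inv c (\<kappa> \<sigma>)) (e
          \<sigma>)) \<sigma> = (\<lambda>c. 0)"
        by (rule parallel_chart[OF ch s cyl(12)[OF s, unfolded G_def] refl])
      show "g (chart_inv c (\<kappa> \<sigma>)) (coord_vec A c (chart_inv c (\<kappa> \<sigma>)) (e \<sigma>)) (coord_vec A c (chart_inv c
          (\<kappa> \<sigma>)) (e \<sigma>)) = 1"
        using cyl(14)[OF s] unit_chart[OF ch s, of "e \<sigma>"] unfolding G_def by simp
    qed
    have "R \<in> cylinder I \<gamma> \<epsilon> \<and> chart_map tc R \<in> Q \<longleftrightarrow> chart_map tc R \<in> r ` V"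
      if R: "R \<in> chart_dom tc" for R
    proof -
      have "R = (\<gamma> \<sigma>, \<lambda>d. t *\<^sub>R \<epsilon> \<sigma> d) \<longleftrightarrow> chart_map tc R = (\<kappa> \<sigma>, t *\<^sub>R e \<sigma>)" if s: "\<sigma> \<in> I" for \<sigma> t
      proof -
        have k: "\<gamma> \<sigma> \<in> chart_dom c" "chart_map c (\<gamma> \<sigma>) = \<kappa> \<sigma>"
          unfolding \<gamma>_def using chart_inv_in[OF \<kappa>X[OF s]] chart_map_inv[OF \<kappa>X[OF s]] by auto
        have eq: "(\<lambda>d. t *\<^sub>R \<epsilon> \<sigma> d) = coord_vec A c (\<gamma> \<sigma>) (t *\<^sub>R e \<sigma>)"
          unfolding \<epsilon>_def using coord_vec_scaleR[OF Ag c(1) k(1)] by simp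
        let ?S = "(\<gamma> \<sigma>, coord_vec A c (\<gamma> \<sigma>) (t *\<^sub>R e \<sigma>))"
        have S: "?S \<in> chart_dom tc" "chart_map tc ?S = (\<kappa> \<sigma>, t *\<^sub>R e \<sigma>)"
          unfolding pdom pX using k coord_vec_tangent[OF at c(1) k(1)] coord_vec_self[OF at c(1) k(1)]
              by auto
        show ?thesis unfolding eq using S R tchart_inj[OF at c(1)] unfolding tc_def by (metis inj_onD)
      qed
      then have "R \<in> cylinder I \<gamma> \<epsilon> \<longleftrightarrow> (\<exists>\<sigma> t. \<sigma> \<in> I \<and> chart_map tc R = (\<kappa> \<sigma>, t *\<^sub>R e \<sigma>))"
        unfolding cylinder_def by blast
      then show ?thesis unfolding cyl(6) mem_Collect_eq using cyl(8) by metis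
    qed
    from piece[OF cyl(3) _ cyl(4,7) this] cyl(5) U'
    obtain V' where "openin (atlas_topology F) V'" "P \<in> V'"
        "open_piece (tangent_bundle A) V' (cylinder I \<gamma> \<epsilon>)" by blast
    then show ?thesis using cyl(1,2) geo par by blast
  qed
qed

end
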